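(* Let $T=(V,E,F)$ be an infinite simplicial topological triangulation of the hyperbolic plane $\mathbb H^2$, and let $\epsilon>0$. Suppose $\phi,\psi:|T|\to\mathbb H^2$ are Delaunay hyperbolic geodesic mappings of $T$ such that (a) $\phi$ and $\psi$ are homeomorphisms from $|T|$ onto $\mathbb H^2$; (b) the induced edge lengths $l(\phi)$ and $l(\psi)$ are discretely conformal; (c) every inner angle of the hyperbolic triangles $\phi(\triangle ijk)$ and $\psi(\triangle ijk)$ is at least $\epsilon$, for every $\triangle ijk\in F$; (d) $\sup_{ij\in E} l_{ij}(\phi)<\epsilon^3/8192$ and $\sup_{ij\in E} l_{ij}(\psi)<\epsilon^3/8192$. Then $l(\phi)=l(\psi)$.
   Context: The hyperbolic plane is modeled as the Poincaré disk $\mathbb H^2=(D,g)$, $D=\{z\in\mathbb C:|z|<1\}$, $g=\frac{4|dz|^2}{(1-|z|^2)^2}$; $d(z_1,z_2)$ denotes hyperbolic distance. $T=(V,E,F)$ has vertex set $V$, edge set $E$, face set $F$; for a subcomplex $T_0=(V_0,E_0,F_0)$, $|T_0|$ is its underlying space. A map $\phi:|T_0|\to\mathbb H^2$ is a hyperbolic geodesic mapping if it maps each edge of $T_0$ to a hyperbolic geodesic arc and each triangle of $T_0$ to a hyperbolic geodesic triangle. It induces edge lengths $l(\phi)\in\mathbb R^{E_0}$, $l_{ij}(\phi)=d(\phi(i),\phi(j))$. Two edge length vectors $l,l'\in\mathbb R^{E_0}$ are (hyperbolic) discretely conformal if there is $u\in\mathbb R^{V_0}$ with $\sinh\frac{l'_{ij}}{2}=e^{\frac12(u_i+u_j)}\sinh\frac{l_{ij}}{2}$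 for every edge $ij\in E_0$; one writes $l'=u*_h l$. A hyperbolic geodesic mapping $\phi$ is Delaunay if for every pair of adjacent triangles $\triangle ijk,\triangle ijk'$ of $T_0$, the point $\phi(k')$ does not lie in the open circumdisk of the triangle $\phi(\triangle ijk)$. *)

theory Defs
  imports "HOL-Analysis.Analysis"
begin

definition hdisk :: "complex set" where
  "hdisk = ball 0 1"

text \<open>Hyperbolic distance for the metric 4|dz|^2/(1-|z|^2)^2.\<close>
definition hdist :: "complex \<Rightarrow> complex \<Rightarrow> real" where
  "hdist z w = arcosh (1 + 2 * (cmod (z - w))^2 / ((1 - (cmod z)^2) * (1 - (cmod w)^2)))"

definition hseg :: "complex \<Rightarrow> complex \<Rightarrow> complex set" where
  "hseg a b = {x \<in> hdisk. hdist a x + hdist x b = hdist a b}"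

definition htri :: "complex \<Rightarrow> complex \<Rightarrow> complex \<Rightarrow> complex set" where
  "htri a b c = (\<Union>x \<in> hseg b c. hseg a x)"

text \<open>Inner angle at vertex a of the hyperbolic triangle abc (hyperbolic law of cosines).\<close>
definition hangle :: "complex \<Rightarrow> complex \<Rightarrow> complex \<Rightarrow> real" where
  "hangle a b c = arccos ((cosh (hdist a b) * cosh (hdist a c) - cosh (hdist b c))
                          / (sinh (hdist a b) * sinh (hdist a c)))"

text \<open>q lies in the open circumdisk of the hyperbolic triangle abc.  We move a to the
  origin by the hyperbolic isometry z \<mapsto> (z-a)/(1 - conj a z); there the circumcircle
  is a Euclidean circle through 0 and the circumdisk is the open Euclidean disk it bounds.\<close>
definition mob_to0 :: "complex \<Rightarrow> complex \<Rightarrow> complex" where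
  "mob_to0 a z = (z - a) / (1 - cnj a * z)"

definition in_open_circumdisk :: "complex \<Rightarrow> complex \<Rightarrow> complex \<Rightarrow> complex \<Rightarrow> bool" where
  "in_open_circumdisk a b c q \<longleftrightarrow>
     (\<exists>ctr. cmod (mob_to0 a b - ctr) = cmod ctr \<and> cmod (mob_to0 a c - ctr) = cmod ctr
          \<and> cmod (mob_to0 a q - ctr) < cmod ctr)"

text \<open>Faces F are 3-element vertex sets; V and E are the vertices/edges of faces.
  Points of |T| are barycentric coordinate functions 'v \<Rightarrow> real.\<close>

definition edges :: "'v set set \<Rightarrow> 'v set set" where
  "edges F = {e. card e = 2 \<and> (\<exists>f\<in>F. e \<subseteq> f)}"

definition vpt :: "'v \<Rightarrow> ('v \<Rightarrow> real)" where
  "vpt i = (\<lambda>v. if v = i then 1 else 0)"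

definition csimplex :: "'v set \<Rightarrow> ('v \<Rightarrow> real) set" where
  "csimplex s = {x. (\<forall>v. 0 \<le> x v) \<and> (\<forall>v. v \<notin> s \<longrightarrow> x v = 0) \<and> sum x s = 1}"

definition polyhedron :: "'v set set \<Rightarrow> ('v \<Rightarrow> real) set" where
  "polyhedron F = (\<Union>f\<in>F. csimplex f)"

text \<open>|T| carries the subspace topology of the product topology on 'v \<Rightarrow> real,
  which coincides with the weak topology for locally finite complexes.\<close>

definition triangulation_H2 :: "'v set set \<Rightarrow> bool" where
  "triangulation_H2 F \<longleftrightarrow>
     (\<forall>f\<in>F. card f = 3) \<and>
     (\<forall>v. finite {f\<in>F. v \<in> f}) \<and>
     polyhedron F homeomorphic hdisk"

definition geodesic_mapping :: "'v set set \<Rightarrow> (('v \<Rightarrow> real) \<Rightarrow> complex) \<Rightarrow> bool" where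
  "geodesic_mapping F \<phi> \<longleftrightarrow>
     \<phi> ` polyhedron F \<subseteq> hdisk \<and>
     (\<forall>i j. {i, j} \<in> edges F \<longrightarrow>
        \<phi> ` csimplex {i, j} = hseg (\<phi> (vpt i)) (\<phi> (vpt j))) \<and>
     (\<forall>i j k. {i, j, k} \<in> F \<longrightarrow>
        \<phi> ` csimplex {i, j, k} = htri (\<phi> (vpt i)) (\<phi> (vpt j)) (\<phi> (vpt k)))"

definition edge_length :: "(('v \<Rightarrow> real) \<Rightarrow> complex) \<Rightarrow> 'v \<Rightarrow> 'v \<Rightarrow> real" where
  "edge_length \<phi> i j = hdist (\<phi> (vpt i)) (\<phi> (vpt j))"

definition delaunay :: "'v set set \<Rightarrow> (('v \<Rightarrow> real) \<Rightarrow> complex) \<Rightarrow> bool" where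
  "delaunay F \<phi> \<longleftrightarrow>
     (\<forall>i j k k'. {i, j, k} \<in> F \<and> {i, j, k'} \<in> F \<and> k \<noteq> k' \<longrightarrow>
        \<not> in_open_circumdisk (\<phi> (vpt i)) (\<phi> (vpt j)) (\<phi> (vpt k)) (\<phi> (vpt k')))"

definition discretely_conformal :: "'v set set \<Rightarrow> ('v \<Rightarrow> 'v \<Rightarrow> real) \<Rightarrow> ('v \<Rightarrow> 'v \<Rightarrow> real) \<Rightarrow> bool" where
  "discretely_conformal F l l' \<longleftrightarrow>
     (\<exists>u :: 'v \<Rightarrow> real. \<forall>i j. {i, j} \<in> edges F \<longrightarrow>
        sinh (l' i j / 2) = exp ((u i + u j) / 2) * sinh (l i j / 2))"

end

theory Submission
  imports Defs
begin

text \<open>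
  Write \<open>z\<^sub>i\<close>, \<open>w\<^sub>i\<close> for the images of the vertices under \<open>\<phi>\<close>, \<open>\<psi>\<close> and \<open>u\<close> for the conformal factor.
  As in the Ahlfors--Schwarz lemma, \<open>\<psi>\<close> is compared with \<open>r \<phi>\<close> for \<open>r > 1\<close>, restricted to the
  finitely many vertices with \<open>r |z\<^sub>i| < 1\<close>; this changes \<open>exp u\<^sub>i\<close> into
  \<open>b\<^sub>i = exp u\<^sub>i (1 - r\<^sup>2 |z\<^sub>i|\<^sup>2) / (r (1 - |z\<^sub>i|\<^sup>2))\<close>. Suppose that the maximum of \<open>b\<close> exceeds 1 and is
  attained at \<open>i\<close>. If some edge at \<open>i\<close> is long compared with \<open>1 - r\<^sup>2 |z\<^sub>i|\<^sup>2\<close>, the angle bounds and the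
  smallness of the edges of \<open>\<psi>\<close> force \<open>b\<^sub>i \<le> 1\<close>. Otherwise move \<open>z\<^sub>i\<close> and \<open>w\<^sub>i\<close> to the origin and invert.
  By the Delaunay condition the two links become convex polygons around the origin; up to a scaling
  they have the same side lengths, but every vertex of the second is farther from the origin. Interpolating
  the squared distances linearly preserves convexity at each vertex and strictly decreases the angle sum
  at the origin, although both angle sums are \<open>2\<pi>\<close>. Hence \<open>b \<le> 1\<close>, and \<open>r \<rightarrow> 1\<close> gives \<open>u \<le> 0\<close>;
  exchanging the two maps gives \<open>u = 0\<close>.
\<close>

text \<open>The squared hyperbolic sine of half the distance is |z - w|^2 / ((1 - |z|^2)(1 -
  |w|^2)). Hence the dilation z -> r z is itself a discrete conformal change, with vertex factor r
  (1 - |z|^2) / (1 - r^2 |z|^2), and b is the quotient of two such factors. The obstacle is that a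
  dilation does not preserve geodesics, so r \<phi> is not a geodesic mapping, and neighbours of a
  vertex may leave the disk. Inverting first removes it: up to similarity, the dilation only moves
  the apex of the inverted link of \<phi> from 0 to a point H. Convexity of the link polygon does
  not depend on the apex, so it is inherited from \<phi>; what must be shown is that H stays inside,
  and this is where fat triangles and short edges are needed. A second difficulty is that \<phi> and
  \<psi> may induce opposite orientations; it is met by comparing unoriented angles, whose sum over
  a link does not depend on the direction of travel. The exponent 3 of \<epsilon> comes from the
  estimate for long edges: one factor sin \<epsilon> from the threshold for being long, and one from
  the fatness of a triangle in each of the two maps.\<close>

section \<open>Angle sums of polygonal links\<close>

text \<open>\<open>a\<close> and \<open>b\<close> are the squared legs at the apex and
  \<open>e\<close> is the side opposite to it. The square root in the result is four times the area,
  so each quotient over it is the cotangent of a base angle, and \<open>a' / (2 * a t)\<close> is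
  the logarithmic derivative of a leg: the classical cotangent formula for the variation of an
  angle.\<close>

lemma arccos_apex_deriv:
  fixes a b :: "real \<Rightarrow> real" and e t :: real
  assumes da: "(a has_real_derivative a') (at t)" and db: "(b has_real_derivative b') (at t)"
    and pos: "0 < a t" "0 < b t"
    and nd: "(a t + b t - e\<^sup>2)\<^sup>2 < 4 * a t * b t"
  shows "((\<lambda>t. arccos ((a t + b t - e\<^sup>2) / (2 * sqrt (a t * b t)))) has_real_derivative
     - (a' / (2 * a t) * ((a t - b t + e\<^sup>2) / sqrt (4 * a t * b t - (a t + b t - e\<^sup>2)\<^sup>2))
        + b' / (2 * b t) * ((b t - a t + e\<^sup>2) / sqrt (4 * a t * b t - (a t + b t - e\<^sup>2)\<^sup>2)))) (at t)"
proof -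
  define q where "q = sqrt (a t * b t)"
  define H where "H = sqrt (4 * a t * b t - (a t + b t - e\<^sup>2)\<^sup>2)"
  define g where "g = (a t + b t - e\<^sup>2) / (2 * q)"
  have q0: "q > 0" and q2: "q\<^sup>2 = a t * b t" using pos by (auto simp: q_def)
  have H0: "H > 0" using nd by (simp add: H_def)
  have H2: "H\<^sup>2 = 4 * a t * b t - (a t + b t - e\<^sup>2)\<^sup>2" using nd by (simp add: H_def)
  have g2: "1 - g\<^sup>2 = (H / (2 * q))\<^sup>2"
  proof -
    define n where "n = a t + b t - e\<^sup>2"
    have "1 - (n / (2 * q))\<^sup>2 = (4 * q\<^sup>2 - n\<^sup>2) / (4 * q\<^sup>2)"
      using q0 by (simp add: power_divide power_mult_distrib diff_divide_distrib)
    then have "1 - g\<^sup>2 = (4 * q\<^sup>2 - (a t + b t - e\<^sup>2)\<^sup>2) / (4 * q\<^sup>2)"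
      by (simp only: g_def n_def)
    also have "\<dots> = H\<^sup>2 / (4 * q\<^sup>2)" unfolding H2 q2 by (simp add: mult.assoc)
    finally show ?thesis by (simp add: power_divide power_mult_distrib)
  qed
  have "1 - g\<^sup>2 > 0" using g2 H0 q0 by simp
  then have g1: "\<bar>g\<bar> < 1" by (simp add: abs_square_less_1)
  have sq: "sqrt (1 - g\<^sup>2) = H / (2 * q)" using g2 H0 q0 by simp
  have "((\<lambda>t. sqrt (a t * b t)) has_real_derivative inverse (sqrt (a t * b t)) / 2 * (a' * b t + b' * a t)) (at t)"
    using pos by (intro DERIV_chain2[OF DERIV_real_sqrt DERIV_mult[OF da db]]) simp
  moreover have "inverse (sqrt (a t * b t)) / 2 * (a' * b t + b' * a t) = (a' * b t + b' * a t) / (2 * q)"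
    unfolding q_def[symmetric] by (simp add: field_simps)
  ultimately have D1: "((\<lambda>t. sqrt (a t * b t)) has_real_derivative (a' * b t + b' * a t) / (2 * q)) (at t)"
    by (simp only:)
  have D2: "((\<lambda>t. (a t + b t - e\<^sup>2) / (2 * sqrt (a t * b t))) has_real_derivative
      ((a' + b') * (2 * q) - (a t + b t - e\<^sup>2) * (2 * ((a' * b t + b' * a t) / (2 * q)))) / (2 * q)\<^sup>2) (at t)"
    using DERIV_divide[OF DERIV_diff[OF DERIV_add[OF da db] DERIV_const[of "e\<^sup>2"]] DERIV_cmult[OF D1, of 2]] q0
    unfolding q_def[symmetric] by (simp only: power2_eq_square diff_0_right mult.commute)
  have gg: "(a t + b t - e\<^sup>2) / (2 * sqrt (a t * b t)) = g" by (simp only: g_def q_def)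
  have "(arccos has_real_derivative inverse (- sqrt (1 - g\<^sup>2))) (at g)"
    by (rule DERIV_arccos) (use g1 in linarith)+
  then have D3: "((\<lambda>t. arccos ((a t + b t - e\<^sup>2) / (2 * sqrt (a t * b t)))) has_real_derivative
      inverse (- sqrt (1 - g\<^sup>2)) *
      (((a' + b') * (2 * q) - (a t + b t - e\<^sup>2) * (2 * ((a' * b t + b' * a t) / (2 * q)))) / (2 * q)\<^sup>2)) (at t)"
    by (rule DERIV_chain2[OF _ D2, unfolded gg])
  have key: "inverse (- sqrt (1 - g\<^sup>2)) *
      (((a' + b') * (2 * q) - (a t + b t - e\<^sup>2) * (2 * ((a' * b t + b' * a t) / (2 * q)))) / (2 * q)\<^sup>2)
     = - (a' / (2 * a t) * ((a t - b t + e\<^sup>2) / H) + b' / (2 * b t) * ((b t - a t + e\<^sup>2) / H))"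
    (is "?L = ?R")
  proof -
    have "?L = - (((a' + b') * 2 * q\<^sup>2 - (a t + b t - e\<^sup>2) * (a' * b t + b' * a t)) / (2 * q\<^sup>2 * H))"
      unfolding sq using q0 H0 by (simp add: divide_simps) (simp add: algebra_simps power2_eq_square)
    also have "\<dots> = ?R" unfolding q2 using pos H0
      by (simp add: divide_simps) (simp add: algebra_simps power2_eq_square)
    finally show ?thesis .
  qed
  show ?thesis using D3 unfolding key H_def .
qed

text \<open>Two triangles share a leg of squared length \<open>x\<^sup>2 + h\<^sup>2\<close>, and
  the quotients are the cotangents of the angles at one end of it. A nonnegative sum of cosines
  means that these angles add up to at most \<pi>, and then their cotangents have a nonnegative sum
  as well.\<close>

lemma cot_sum_nonneg:
  fixes x y h k :: real
  assumes "x\<^sup>2 + h\<^sup>2 = y\<^sup>2 + k\<^sup>2" "0 < h" "0 < k" "0 \<le> x + y"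
  shows "0 \<le> x / h + y / k" and "0 < x + y \<Longrightarrow> 0 < x / h + y / k"
proof -
  have main: "0 \<le> x / h + y / k \<and> (0 < x + y \<longrightarrow> 0 < x / h + y / k)"
    if "x\<^sup>2 + h\<^sup>2 = y\<^sup>2 + k\<^sup>2" "0 < h" "0 < k" "0 \<le> x + y" "y \<le> x" for x y h k :: real
  proof (cases "0 \<le> y")
    case True
    show ?thesis
    proof (cases "x = 0 \<and> y = 0")
      case False
      then have "0 < x / h" "0 \<le> y / k" using that True by auto
      then show ?thesis by linarith
    qed (use that in auto)
  next
    case False
    then have xy: "- y \<le> x" "0 < - y" using that by auto
    then have "(-y)\<^sup>2 \<le> x\<^sup>2" by (intro power_mono) auto
    then have "y\<^sup>2 \<le> x\<^sup>2" by simp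
    then have "h\<^sup>2 \<le> k\<^sup>2" using that(1) by linarith
    then have hk: "h \<le> k" by (rule power2_le_imp_le) (use that in simp)
    have 1: "- y / k \<le> x / k" using xy(1) \<open>0 < k\<close> by (rule divide_right_mono[OF _ less_imp_le])
    have "0 \<le> x" using xy by linarith
    then have q1: "x / k \<le> x / h" using \<open>0 < h\<close> hk by (intro divide_left_mono) auto
    have 2: "- y / k < x / k" if "0 < x + y"
      using that \<open>0 < k\<close> by (intro divide_strict_right_mono) auto
    show ?thesis using 1 q1 2 by auto
  qed
  show "0 \<le> x / h + y / k" and "0 < x + y \<Longrightarrow> 0 < x / h + y / k"
    using main[of x h y k] main[of y k x h] assms
    by (metis add.commute le_cases)+
qed

text \<open>Sixteen times the squared area, as a function of the squared legs, is minus the square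
  of \<open>a - b\<close> plus an affine function, hence concave. The identity in the proof displays
  the exact defect.\<close>

lemma apex_nondegenerate_convex:
  fixes a b c d e t :: real
  assumes "(a + b - e\<^sup>2)\<^sup>2 < 4 * a * b" "(c + d - e\<^sup>2)\<^sup>2 < 4 * c * d" "0 \<le> t" "t \<le> 1"
  shows "(((1 - t) * a + t * c) + ((1 - t) * b + t * d) - e\<^sup>2)\<^sup>2
       < 4 * ((1 - t) * a + t * c) * ((1 - t) * b + t * d)"
proof -
  define f where "f = (\<lambda>a b. 4 * a * b - (a + b - e\<^sup>2)\<^sup>2)"
  have "f ((1 - t) * a + t * c) ((1 - t) * b + t * d)
      = (1 - t) * f a b + t * f c d + t * (1 - t) * ((a - b) - (c - d))\<^sup>2"
    unfolding f_def by algebra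
  moreover have "0 \<le> t * (1 - t) * ((a - b) - (c - d))\<^sup>2" using assms by simp
  moreover have "0 < (1 - t) * f a b + t * f c d"
  proof (cases "t = 0")
    case True then show ?thesis using assms by (simp add: f_def)
  next
    case False
    then have "0 < t * f c d" "0 \<le> (1 - t) * f a b" using assms by (auto simp: f_def)
    then show ?thesis by linarith
  qed
  ultimately show ?thesis by (simp add: f_def)
qed

text \<open>\<open>S\<close> and \<open>T\<close> are squared distances to the apex and
  \<open>e\<close> the common side lengths; \<open>delS\<close> and \<open>delT\<close> say that the
  two base angles meeting at a vertex add up to at most \<pi>. Regrouped by vertices, the derivative
  of the angle sum along the interpolation is a combination of the sums in
  \<open>cot_sum_nonneg\<close> with negative coefficients.\<close>

lemma link_angle_sum_decreasing:
  fixes J :: "'v set" and \<sigma> :: "'v \<Rightarrow> 'v" and S T e :: "'v \<Rightarrow> real"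
  assumes fin: "finite J" and ne: "J \<noteq> {}" and bij: "bij_betw \<sigma> J J"
    and e0: "\<And>j. j \<in> J \<Longrightarrow> 0 < e j"
    and S0: "\<And>j. j \<in> J \<Longrightarrow> 0 < S j" and ST: "\<And>j. j \<in> J \<Longrightarrow> S j < T j"
    and ndS: "\<And>j. j \<in> J \<Longrightarrow> (S j + S (\<sigma> j) - (e j)\<^sup>2)\<^sup>2 < 4 * S j * S (\<sigma> j)"
    and ndT: "\<And>j. j \<in> J \<Longrightarrow> (T j + T (\<sigma> j) - (e j)\<^sup>2)\<^sup>2 < 4 * T j * T (\<sigma> j)"
    and delS: "\<And>j. j \<in> J \<Longrightarrow> 0 \<le> (S (\<sigma> j) - S j + (e j)\<^sup>2) / e j
                 + (S (\<sigma> j) - S (\<sigma> (\<sigma> j)) + (e (\<sigma> j))\<^sup>2) / e (\<sigma> j)"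
    and delT: "\<And>j. j \<in> J \<Longrightarrow> 0 \<le> (T (\<sigma> j) - T j + (e j)\<^sup>2) / e j
                 + (T (\<sigma> j) - T (\<sigma> (\<sigma> j)) + (e (\<sigma> j))\<^sup>2) / e (\<sigma> j)"
  shows "(\<Sum>j\<in>J. arccos ((T j + T (\<sigma> j) - (e j)\<^sup>2) / (2 * sqrt (T j * T (\<sigma> j)))))
       < (\<Sum>j\<in>J. arccos ((S j + S (\<sigma> j) - (e j)\<^sup>2) / (2 * sqrt (S j * S (\<sigma> j)))))"
proof -
  \<comment> \<open>In terms of the squared radii the Delaunay condition is linear (Stewart's theorem) and nondegeneracy is a concave inequality, so both survive linear interpolation.\<close>
  define R where "R = (\<lambda>t j. (1 - t) * S j + t * T j)"
  define H where "H = (\<lambda>t j. sqrt (4 * R t j * R t (\<sigma> j) - (R t j + R t (\<sigma> j) - (e j)\<^sup>2)\<^sup>2))"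
  define G where "G = (\<lambda>t. \<Sum>j\<in>J. arccos ((R t j + R t (\<sigma> j) - (e j)\<^sup>2) / (2 * sqrt (R t j * R t (\<sigma> j)))))"
  define D where "D = (\<lambda>t. \<Sum>j\<in>J. - ((T j - S j) / (2 * R t j) * ((R t j - R t (\<sigma> j) + (e j)\<^sup>2) / H t j)
        + (T (\<sigma> j) - S (\<sigma> j)) / (2 * R t (\<sigma> j)) * ((R t (\<sigma> j) - R t j + (e j)\<^sup>2) / H t j)))"
  have sJ: "\<sigma> j \<in> J" if "j \<in> J" for j using bij that by (auto simp: bij_betw_def)
  have R0: "0 < R t j" if "j \<in> J" "0 \<le> t" "t \<le> 1" for t j
  proof -
    have "R t j = S j + t * (T j - S j)" by (simp add: R_def algebra_simps)
    then show ?thesis using S0[OF that(1)] ST[OF that(1)] that by (simp add: add_pos_nonneg)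
  qed
  have ndR: "(R t j + R t (\<sigma> j) - (e j)\<^sup>2)\<^sup>2 < 4 * R t j * R t (\<sigma> j)" if "j \<in> J" "0 \<le> t" "t \<le> 1" for t j
    unfolding R_def by (rule apex_nondegenerate_convex[OF ndS ndT]) (use that in auto)
  have H0: "0 < H t j" if "j \<in> J" "0 \<le> t" "t \<le> 1" for t j
    using ndR[OF that] by (simp add: H_def)
  have derR: "((\<lambda>t. R t j) has_real_derivative (T j - S j)) (at t)" for t j
    unfolding R_def by (auto intro!: derivative_eq_intros)
  have derG: "(G has_real_derivative D t) (at t)" if "0 \<le> t" "t \<le> 1" for t
    unfolding G_def D_def H_def
    by (intro DERIV_sum arccos_apex_deriv derR R0 ndR sJ that)
  have Dneg: "D t < 0" if t: "0 \<le> t" "t \<le> 1" for t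
  proof -
    \<comment> \<open>\<open>x j\<close> and \<open>y j\<close> are the signed projections of the
      two legs to the edge, seen from its ends \<open>\<sigma> j\<close> and \<open>j\<close>;
      \<open>h j\<close> is the height of the apex over the edge.\<close>
    define x where "x = (\<lambda>j. (R t (\<sigma> j) - R t j + (e j)\<^sup>2) / (2 * e j))"
    define y where "y = (\<lambda>j. (R t j - R t (\<sigma> j) + (e j)\<^sup>2) / (2 * e j))"
    define h where "h = (\<lambda>j. H t j / (2 * e j))"
    have h0: "0 < h j" if "j \<in> J" for j using H0[OF that t] e0[OF that] by (simp add: h_def)
    have xh: "(R t (\<sigma> j) - R t j + (e j)\<^sup>2) / H t j = x j / h j"
      "(R t j - R t (\<sigma> j) + (e j)\<^sup>2) / H t j = y j / h j" if "j \<in> J" for j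
      using e0[OF that] by (simp_all add: x_def y_def h_def)
    have HH: "(H t j)\<^sup>2 = 4 * R t j * R t (\<sigma> j) - (R t j + R t (\<sigma> j) - (e j)\<^sup>2)\<^sup>2" if "j \<in> J" for j
      using ndR[OF that t] by (simp add: H_def)
    have xx: "(x j)\<^sup>2 + (h j)\<^sup>2 = R t (\<sigma> j)" "(y j)\<^sup>2 + (h j)\<^sup>2 = R t j" if "j \<in> J" for j
    proof -
      have "(R t (\<sigma> j) - R t j + (e j)\<^sup>2)\<^sup>2 + (H t j)\<^sup>2 = R t (\<sigma> j) * (2 * e j)\<^sup>2"
           "(R t j - R t (\<sigma> j) + (e j)\<^sup>2)\<^sup>2 + (H t j)\<^sup>2 = R t j * (2 * e j)\<^sup>2"
        unfolding HH[OF that] by algebra+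
      then show "(x j)\<^sup>2 + (h j)\<^sup>2 = R t (\<sigma> j)" "(y j)\<^sup>2 + (h j)\<^sup>2 = R t j"
        using e0[OF that] by (simp_all add: x_def y_def h_def power_divide add_divide_distrib[symmetric])
    qed
    have del: "0 \<le> x j + y (\<sigma> j)" if "j \<in> J" for j
    proof -
      have "2 * (x j + y (\<sigma> j)) = (1 - t) * ((S (\<sigma> j) - S j + (e j)\<^sup>2) / e j
                 + (S (\<sigma> j) - S (\<sigma> (\<sigma> j)) + (e (\<sigma> j))\<^sup>2) / e (\<sigma> j))
           + t * ((T (\<sigma> j) - T j + (e j)\<^sup>2) / e j
                 + (T (\<sigma> j) - T (\<sigma> (\<sigma> j)) + (e (\<sigma> j))\<^sup>2) / e (\<sigma> j))"
        using e0[OF that] e0[OF sJ[OF that]] by (simp add: x_def y_def R_def field_simps)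
      moreover have "\<dots> \<ge> 0" 
        using mult_nonneg_nonneg[OF _ delS[OF that], of "1 - t"] mult_nonneg_nonneg[OF _ delT[OF that], of t] t by linarith
      ultimately have "0 \<le> 2 * (x j + y (\<sigma> j))" by (simp only:)
      then show ?thesis by simp
    qed
    \<comment> \<open>The logarithmic derivative of the distance from the apex to vertex
      \<open>j\<close>.\<close>
    define W where "W = (\<lambda>j. (T j - S j) / (2 * R t j))"
    have W0: "0 < W j" if "j \<in> J" for j using ST[OF that] R0[OF that t] by (simp add: W_def)
    have "- D t = (\<Sum>j\<in>J. W j * (y j / h j) + W (\<sigma> j) * (x j / h j))"
      unfolding D_def W_def sum_negf[symmetric] by (intro sum.cong refl) (simp add: xh)
    also have "\<dots> = (\<Sum>j\<in>J. W j * (y j / h j)) + (\<Sum>j\<in>J. W (\<sigma> j) * (x j / h j))"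
      by (simp add: sum.distrib)
    \<comment> \<open>Shifting this sum by \<open>\<sigma>\<close> brings together the two edge
      terms that meet at \<open>\<sigma> j\<close>: a sum over edges becomes a sum over
      vertices.\<close>
    also have "(\<Sum>j\<in>J. W j * (y j / h j)) = (\<Sum>j\<in>J. W (\<sigma> j) * (y (\<sigma> j) / h (\<sigma> j)))"
      by (rule sum.reindex_bij_betw[OF bij, symmetric])
    also have "\<dots> + (\<Sum>j\<in>J. W (\<sigma> j) * (x j / h j)) = (\<Sum>j\<in>J. W (\<sigma> j) * (x j / h j + y (\<sigma> j) / h (\<sigma> j)))"
      by (simp add: sum.distrib[symmetric] algebra_simps)
    finally have eq: "- D t = \<dots>" .
    \<comment> \<open>The polygon cannot be straight at every vertex: the projections of the apex rays onto the edges add up to the perimeter.\<close>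
    have "(\<Sum>j\<in>J. x j + y (\<sigma> j)) = (\<Sum>j\<in>J. x j) + (\<Sum>j\<in>J. y j)"
      by (simp add: sum.distrib sum.reindex_bij_betw[OF bij, of y])
    also have "\<dots> = (\<Sum>j\<in>J. e j)"
      unfolding sum.distrib[symmetric]
    proof (intro sum.cong refl)
      fix j assume "j \<in> J"
      show "x j + y j = e j"
        using e0[OF \<open>j \<in> J\<close>] by (simp add: x_def y_def add_divide_distrib[symmetric] power2_eq_square)
    qed
    also have "\<dots> > 0" using fin ne e0 by (intro sum_pos) auto
    finally have "\<exists>j\<in>J. 0 < x j + y (\<sigma> j)"
      by (meson not_le sum_nonpos)
    then obtain j where j: "j \<in> J" "0 < x j + y (\<sigma> j)" by blast
    have sq: "(x j)\<^sup>2 + (h j)\<^sup>2 = (y (\<sigma> j))\<^sup>2 + (h (\<sigma> j))\<^sup>2" if "j \<in> J" for j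
      using xx[OF that] xx[OF sJ[OF that]] by simp
    have "0 < (\<Sum>j\<in>J. W (\<sigma> j) * (x j / h j + y (\<sigma> j) / h (\<sigma> j)))"
    proof (rule sum_pos2[OF fin j(1)])
      show "0 < W (\<sigma> j) * (x j / h j + y (\<sigma> j) / h (\<sigma> j))"
        using cot_sum_nonneg(2)[OF sq h0 h0 del] j sJ W0 by simp
      show "0 \<le> W (\<sigma> k) * (x k / h k + y (\<sigma> k) / h (\<sigma> k))" if "k \<in> J" for k
        using cot_sum_nonneg(1)[OF sq h0 h0 del, of k] that sJ W0[of "\<sigma> k"]
        by (simp add: less_imp_le)
    qed
    then show ?thesis using eq by simp
  qed
  have "G 1 < G 0"
    by (rule DERIV_neg_imp_decreasing) (use derG Dneg in auto)
  then show ?thesis by (simp add: G_def R_def)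
qed

section \<open>The Poincare disk\<close>

lemma hdisk_iff: "z \<in> hdisk \<longleftrightarrow> cmod z < 1"
  by (simp add: hdisk_def)

lemma hdisk_one_minus_pos: "z \<in> hdisk \<Longrightarrow> 0 < 1 - (cmod z)\<^sup>2"
  by (simp add: hdisk_iff abs_square_less_1)

lemma mob_denom_nonzero:
  assumes "a \<in> hdisk" "z \<in> hdisk"
  shows "1 - cnj a * z \<noteq> 0"
proof
  assume "1 - cnj a * z = 0"
  then have "cmod (cnj a * z) = 1" by simp
  moreover have "cmod a * cmod z < 1 * 1"
    using assms by (intro mult_strict_mono') (auto simp: hdisk_iff)
  ultimately show False by (simp add: norm_mult)
qed

lemma one_minus_mob:
  assumes "a \<in> hdisk" "z \<in> hdisk"
  shows "1 - (cmod (mob_to0 a z))\<^sup>2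
       = (1 - (cmod a)\<^sup>2) * (1 - (cmod z)\<^sup>2) / (cmod (1 - cnj a * z))\<^sup>2"
proof -
  define N where "N = (cmod (1 - cnj a * z))\<^sup>2"
  have "N \<noteq> 0" using mob_denom_nonzero[OF assms] by (simp add: N_def)
  have "N - (cmod (z - a))\<^sup>2 = (1 - (cmod a)\<^sup>2) * (1 - (cmod z)\<^sup>2)"
    unfolding cmod_power2 N_def by (simp add: power2_eq_square algebra_simps)
  moreover have "(cmod (mob_to0 a z))\<^sup>2 = (cmod (z - a))\<^sup>2 / N"
    by (simp add: mob_to0_def norm_divide power_divide N_def)
  ultimately show ?thesis using \<open>N \<noteq> 0\<close> unfolding N_def[symmetric] by (simp add: field_simps)
qed

lemma mob_in_hdisk: "a \<in> hdisk \<Longrightarrow> z \<in> hdisk \<Longrightarrow> mob_to0 a z \<in> hdisk"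
proof -
  assume a: "a \<in> hdisk" and z: "z \<in> hdisk"
  have "0 < 1 - (cmod (mob_to0 a z))\<^sup>2"
    unfolding one_minus_mob[OF a z]
    using hdisk_one_minus_pos[OF a] hdisk_one_minus_pos[OF z] mob_denom_nonzero[OF a z] by simp
  then show ?thesis by (simp add: hdisk_iff abs_square_less_1)
qed

lemma mob_diff:
  assumes "c \<in> hdisk" "z \<in> hdisk" "w \<in> hdisk"
  shows "mob_to0 c z - mob_to0 c w
       = of_real (1 - (cmod c)\<^sup>2) * (z - w) / ((1 - cnj c * z) * (1 - cnj c * w))"
proof -
  have "mob_to0 c z - mob_to0 c w
      = ((z - c) * (1 - cnj c * w) - (w - c) * (1 - cnj c * z)) / ((1 - cnj c * z) * (1 - cnj c * w))"
    using mob_denom_nonzero[OF assms(1,2)] mob_denom_nonzero[OF assms(1,3)]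
    by (simp add: mob_to0_def diff_frac_eq)
  also have "(z - c) * (1 - cnj c * w) - (w - c) * (1 - cnj c * z) = (1 - c * cnj c) * (z - w)"
    by (simp add: algebra_simps)
  also have "1 - c * cnj c = of_real (1 - (cmod c)\<^sup>2)"
    by (simp only: of_real_diff of_real_1 complex_norm_square)
  finally show ?thesis .
qed

text \<open>The square of \<open>sinh (hdist z w / 2)\<close>. In this quantity discrete
  conformality is multiplication by a product of two vertex factors, and so is the effect of a
  dilation of the disk.\<close>

definition chord2 :: "complex \<Rightarrow> complex \<Rightarrow> real" where
  "chord2 z w = (cmod (z - w))\<^sup>2 / ((1 - (cmod z)\<^sup>2) * (1 - (cmod w)\<^sup>2))"

lemma chord2_nonneg: "z \<in> hdisk \<Longrightarrow> w \<in> hdisk \<Longrightarrow> 0 \<le> chord2 z w"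
  using hdisk_one_minus_pos[of z] hdisk_one_minus_pos[of w] by (simp add: chord2_def)

lemma chord2_pos: "z \<in> hdisk \<Longrightarrow> w \<in> hdisk \<Longrightarrow> z \<noteq> w \<Longrightarrow> 0 < chord2 z w"
  using hdisk_one_minus_pos[of z] hdisk_one_minus_pos[of w] by (simp add: chord2_def)

lemma chord2_commute: "chord2 z w = chord2 w z"
  by (simp add: chord2_def norm_minus_commute mult.commute)

lemma hdist_chord2: "hdist z w = arcosh (1 + 2 * chord2 z w)"
  by (simp add: hdist_def chord2_def)

lemma hdist_commute: "hdist z w = hdist w z"
  by (simp add: hdist_chord2 chord2_commute)

lemma chord2_mob:
  assumes "c \<in> hdisk" "z \<in> hdisk" "w \<in> hdisk"
  shows "chord2 (mob_to0 c z) (mob_to0 c w) = chord2 z w"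
proof -
  define A B where "A = cmod (1 - cnj c * z)" and "B = cmod (1 - cnj c * w)"
  have AB: "A \<noteq> 0" "B \<noteq> 0"
    using mob_denom_nonzero[OF assms(1,2)] mob_denom_nonzero[OF assms(1,3)] by (auto simp: A_def B_def)
  define P Z W where "P = 1 - (cmod c)\<^sup>2" and "Z = 1 - (cmod z)\<^sup>2" and "W = 1 - (cmod w)\<^sup>2"
  have P: "P \<noteq> 0" "Z \<noteq> 0" "W \<noteq> 0"
    using assms[THEN hdisk_one_minus_pos] by (auto simp: P_def Z_def W_def)
  have 1: "(cmod (mob_to0 c z - mob_to0 c w))\<^sup>2 = (1 - (cmod c)\<^sup>2)\<^sup>2 * (cmod (z - w))\<^sup>2 / (A\<^sup>2 * B\<^sup>2)"
    unfolding mob_diff[OF assms] norm_mult norm_divide A_def B_def norm_of_real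
    by (simp add: power_divide power_mult_distrib)
  show ?thesis
    unfolding chord2_def 1 one_minus_mob[OF assms(1,2)] one_minus_mob[OF assms(1,3)] A_def[symmetric] B_def[symmetric]
      P_def[symmetric] Z_def[symmetric] W_def[symmetric]
    using AB P by (simp add: field_simps power2_eq_square)
qed

lemma hdist_mob: "c \<in> hdisk \<Longrightarrow> z \<in> hdisk \<Longrightarrow> w \<in> hdisk \<Longrightarrow> hdist (mob_to0 c z) (mob_to0 c w) = hdist z w"
  by (simp add: hdist_chord2 chord2_mob)

lemma mob_self [simp]: "mob_to0 a a = 0"
  by (simp add: mob_to0_def)

lemma mob_eq_0_iff: "a \<in> hdisk \<Longrightarrow> z \<in> hdisk \<Longrightarrow> mob_to0 a z = 0 \<longleftrightarrow> z = a"
  using mob_denom_nonzero[of a z] by (simp add: mob_to0_def)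

lemma minus_hdisk [simp]: "- a \<in> hdisk \<longleftrightarrow> a \<in> hdisk"
  by (simp add: hdisk_iff)

lemma mob_inverse:
  assumes "a \<in> hdisk" "z \<in> hdisk"
  shows "mob_to0 (- a) (mob_to0 a z) = z"
proof -
  define D where "D = 1 - cnj a * z"
  have nz: "D \<noteq> 0" unfolding D_def by (rule mob_denom_nonzero[OF assms])
  have nz': "1 - cnj a * a \<noteq> 0" by (rule mob_denom_nonzero[OF assms(1,1)])
  have "mob_to0 a z + a = ((z - a) + a * D) / D" "1 + cnj a * mob_to0 a z = (D + cnj a * (z - a)) / D"
    using nz by (simp_all add: mob_to0_def add_divide_distrib D_def[symmetric])
  moreover have "(z - a) + a * D = (1 - cnj a * a) * z" "D + cnj a * (z - a) = 1 - cnj a * a"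
    by (simp_all add: D_def algebra_simps)
  ultimately show ?thesis using nz nz' by (simp add: mob_to0_def[of "- a"])
qed

lemma mob_inverse': "a \<in> hdisk \<Longrightarrow> z \<in> hdisk \<Longrightarrow> mob_to0 a (mob_to0 (- a) z) = z"
  using mob_inverse[of "- a" z] by simp

lemma inj_on_mob: "a \<in> hdisk \<Longrightarrow> inj_on (mob_to0 a) hdisk"
  by (rule inj_on_inverseI[where g = "mob_to0 (- a)"]) (rule mob_inverse)

lemma continuous_on_mob: "a \<in> hdisk \<Longrightarrow> continuous_on hdisk (mob_to0 a)"
  unfolding mob_to0_def by (intro continuous_intros ballI mob_denom_nonzero)

lemma hseg_mob:
  assumes "c \<in> hdisk" "a \<in> hdisk" "b \<in> hdisk"
  shows "mob_to0 c ` hseg a b = hseg (mob_to0 c a) (mob_to0 c b)"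
proof (intro equalityI subsetI)
  fix y assume "y \<in> mob_to0 c ` hseg a b"
  then show "y \<in> hseg (mob_to0 c a) (mob_to0 c b)"
    using assms by (auto simp: hseg_def hdist_mob mob_in_hdisk)
next
  fix y assume y: "y \<in> hseg (mob_to0 c a) (mob_to0 c b)"
  then have "y \<in> hdisk" by (simp add: hseg_def)
  define x where "x = mob_to0 (- c) y"
  have x: "x \<in> hdisk" "mob_to0 c x = y"
    using \<open>y \<in> hdisk\<close> assms by (simp_all add: x_def mob_in_hdisk mob_inverse')
  have "x \<in> hseg a b"
    using y x(1) assms unfolding x(2)[symmetric] by (simp add: hseg_def hdist_mob)
  then show "y \<in> mob_to0 c ` hseg a b" using x by blast
qed

lemma cosh_hdist: "z \<in> hdisk \<Longrightarrow> w \<in> hdisk \<Longrightarrow> cosh (hdist z w) = 1 + 2 * chord2 z w"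
  unfolding hdist_chord2 by (rule cosh_arcosh_real) (use chord2_nonneg[of z w] in simp)

lemma hdist_nonneg: "z \<in> hdisk \<Longrightarrow> w \<in> hdisk \<Longrightarrow> 0 \<le> hdist z w"
  unfolding hdist_chord2 by (rule arcosh_nonneg_real) (use chord2_nonneg[of z w] in simp)

lemma sinh_half_hdist:
  assumes "z \<in> hdisk" "w \<in> hdisk"
  shows "sinh (hdist z w / 2) = sqrt (chord2 z w)"
proof -
  have "cosh (2 * (hdist z w / 2)) = 2 * (cosh (hdist z w / 2))\<^sup>2 - 1" by (rule cosh_double_cosh)
  then have "(sinh (hdist z w / 2))\<^sup>2 = chord2 z w"
    using cosh_hdist[OF assms] by (simp add: cosh_square_eq)
  moreover have "0 \<le> sinh (hdist z w / 2)" using hdist_nonneg[OF assms] by simp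
  ultimately show ?thesis by (metis real_sqrt_unique)
qed

lemma sinh_hdist_pos: "z \<in> hdisk \<Longrightarrow> w \<in> hdisk \<Longrightarrow> z \<noteq> w \<Longrightarrow> 0 < sinh (hdist z w)"
proof -
  assume a: "z \<in> hdisk" "w \<in> hdisk" "z \<noteq> w"
  have "hdist z w \<noteq> 0" using cosh_hdist[OF a(1,2)] chord2_pos[OF a] by force
  then show ?thesis using hdist_nonneg[OF a(1,2)] by simp
qed

lemma chord2_0: "chord2 0 w = (cmod w)\<^sup>2 / (1 - (cmod w)\<^sup>2)"
  by (simp add: chord2_def)

lemma hdist_0:
  assumes "w \<in> hdisk"
  shows "hdist 0 w = ln ((1 + cmod w) / (1 - cmod w))"
proof -
  define m where "m = cmod w"
  have m: "0 \<le> m" "m < 1" using assms by (auto simp: m_def hdisk_iff)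
  have "cosh (ln ((1 + m) / (1 - m))) = ((1 + m) / (1 - m) + (1 - m) / (1 + m)) / 2"
    using m by (simp add: cosh_ln_real)
  also have "\<dots> = 1 + 2 * (m\<^sup>2 / (1 - m\<^sup>2))"
  proof -
    have *: "1 - m\<^sup>2 = (1 - m) * (1 + m)" by (simp add: algebra_simps power2_eq_square)
    have "1 - m \<noteq> 0" "1 + m \<noteq> 0" using m by auto
    then show ?thesis unfolding * by (simp add: divide_simps) (simp add: algebra_simps power2_eq_square)
  qed
  finally have "arcosh (1 + 2 * (m\<^sup>2 / (1 - m\<^sup>2))) = arcosh (cosh (ln ((1 + m) / (1 - m))))" by simp
  also have "\<dots> = ln ((1 + m) / (1 - m))"
    using m by (intro arcosh_cosh_real ln_ge_zero) simp
  finally show ?thesis by (simp add: hdist_chord2 chord2_0 m_def)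
qed

lemma sinh_hdist_0: "w \<in> hdisk \<Longrightarrow> sinh (hdist 0 w) = 2 * cmod w / (1 - (cmod w)\<^sup>2)"
proof -
  assume w: "w \<in> hdisk"
  define m where "m = cmod w"
  have m: "0 \<le> m" "m < 1" using w by (auto simp: m_def hdisk_iff)
  have *: "1 - m\<^sup>2 = (1 - m) * (1 + m)" by (simp add: algebra_simps power2_eq_square)
  have "sinh (ln ((1 + m) / (1 - m))) = ((1 + m) / (1 - m) - (1 - m) / (1 + m)) / 2"
    using m by (simp add: sinh_ln_real)
  also have "\<dots> = 2 * m / (1 - m\<^sup>2)"
  proof -
    have "1 - m \<noteq> 0" "1 + m \<noteq> 0" using m by auto
    then show ?thesis unfolding * by (simp add: divide_simps) (simp add: algebra_simps power2_eq_square)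
  qed
  finally show ?thesis by (simp add: hdist_0[OF w] m_def)
qed

text \<open>\<open>hseg\<close> is defined by equality in the triangle inequality. In terms of the
  exponential \<open>f\<close> of the distance from 0, this equality is polynomial; it says that
  \<open>x\<close> is not farther out than \<open>b\<close> and that Cauchy-Schwarz is sharp for
  \<open>x\<close> and \<open>b\<close>.\<close>

lemma hseg_0:
  assumes b: "b \<in> hdisk"
  shows "hseg 0 b = closed_segment 0 b"
proof -
  define f :: "real \<Rightarrow> real" where "f = (\<lambda>m. (1 + m) / (1 - m))"
  have fpos: "0 < f m" if "0 \<le> m" "m < 1" for m using that by (simp add: f_def)
  have key: "hdist 0 x + hdist x b = hdist 0 b \<longleftrightarrow>
      (cmod x \<le> cmod b \<and> cmod (1 - cnj x * b) = 1 - cmod x * cmod b)" if x: "x \<in> hdisk" for x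
  proof -
    define X B M where "X = cmod x" and "B = cmod b" and "M = cmod (mob_to0 x b)"
    have r: "0 \<le> X" "X < 1" "0 \<le> B" "B < 1" "0 \<le> M" "M < 1"
      using x b mob_in_hdisk[OF x b] by (auto simp: X_def B_def M_def hdisk_iff)
    have XB: "X * B < 1" using mult_strict_mono'[of X 1 B 1] r by simp
    have d: "hdist x b = ln (f M)"
      using hdist_mob[OF x x b] hdist_0[OF mob_in_hdisk[OF x b]] by (simp add: f_def M_def)
    have "hdist 0 x + hdist x b = hdist 0 b \<longleftrightarrow> ln (f X * f M) = ln (f B)"
    proof -
      have "hdist 0 x = ln (f X)" "hdist 0 b = ln (f B)"
        by (simp_all add: hdist_0 x b f_def X_def B_def)
      then show ?thesis using fpos[of X] fpos[of M] r by (simp add: d ln_mult)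
    qed
    also have "\<dots> \<longleftrightarrow> f X * f M = f B"
      using fpos[of X] fpos[of M] fpos[of B] r by simp
    also have "\<dots> \<longleftrightarrow> (1 + X) * (1 + M) * (1 - B) = (1 + B) * ((1 - X) * (1 - M))"
      using r by (simp add: f_def frac_eq_eq)
    also have "\<dots> \<longleftrightarrow> M * (1 - X * B) = B - X"
    proof -
      have "p = q \<longleftrightarrow> u = v" if "p - q = 2 * (u - v)" for p q u v :: real
        using that by auto
      then show ?thesis by this (simp add: algebra_simps)
    qed
    finally have 1: "hdist 0 x + hdist x b = hdist 0 b \<longleftrightarrow> M * (1 - X * B) = B - X" .
    define N where "N = cmod (1 - cnj x * b)"
    have N0: "0 < N" using mob_denom_nonzero[OF x b] by (simp add: N_def)
    have MN: "1 - M\<^sup>2 = (1 - X\<^sup>2) * (1 - B\<^sup>2) / N\<^sup>2"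
      using one_minus_mob[OF x b] by (simp add: M_def X_def B_def N_def)
    have id: "(1 - X * B)\<^sup>2 - (B - X)\<^sup>2 = (1 - X\<^sup>2) * (1 - B\<^sup>2)"
      by (simp add: power2_eq_square algebra_simps)
    have id': "(M * (1 - X * B))\<^sup>2 = (1 - X * B)\<^sup>2 - (1 - M\<^sup>2) * (1 - X * B)\<^sup>2"
      by (simp add: power_mult_distrib left_diff_distrib)
    have pos: "0 < (1 - X\<^sup>2) * (1 - B\<^sup>2)" using r by (simp add: abs_square_less_1)
    \<comment> \<open>The squares are compared by \<open>id\<close> and \<open>id'\<close>; the sign
      of the two sides accounts for the condition \<open>X \<le> B\<close>.\<close>
    have "M * (1 - X * B) = B - X \<longleftrightarrow> X \<le> B \<and> N = 1 - X * B"
    proof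
      assume a: "M * (1 - X * B) = B - X"
      have "0 \<le> M * (1 - X * B)" using r XB by simp
      with a have "X \<le> B" by simp
      moreover have "(1 - M\<^sup>2) * (1 - X * B)\<^sup>2 = (1 - X\<^sup>2) * (1 - B\<^sup>2)"
        using id id' unfolding a by linarith
      then have "(1 - X\<^sup>2) * (1 - B\<^sup>2) * (1 - X * B)\<^sup>2 = (1 - X\<^sup>2) * (1 - B\<^sup>2) * N\<^sup>2"
        using MN N0 by (simp add: field_simps)
      then have "(1 - X * B)\<^sup>2 = N\<^sup>2" using pos by (metis less_irrefl mult_left_cancel)
      then have "N = 1 - X * B" using N0 XB by (simp add: power2_eq_iff)
      ultimately show "X \<le> B \<and> N = 1 - X * B" by simp
    next
      assume a: "X \<le> B \<and> N = 1 - X * B"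
      then have "(1 - M\<^sup>2) * (1 - X * B)\<^sup>2 = (1 - X\<^sup>2) * (1 - B\<^sup>2)" using MN N0 by simp
      then have "(M * (1 - X * B))\<^sup>2 = (B - X)\<^sup>2"
        using id id' by linarith
      moreover have "0 \<le> M * (1 - X * B)" "0 \<le> B - X" using a r XB by auto
      ultimately show "M * (1 - X * B) = B - X" by (simp add: power2_eq_iff_nonneg)
    qed
    then show ?thesis using 1 by (simp add: X_def B_def N_def)
  qed
  show ?thesis
  proof (intro equalityI subsetI)
    fix x assume "x \<in> hseg 0 b"
    then have x: "x \<in> hdisk" and le: "cmod x \<le> cmod b" and eq: "cmod (1 - cnj x * b) = 1 - cmod x * cmod b"
      using key by (auto simp: hseg_def)
    have "(cmod (1 - cnj x * b))\<^sup>2 = 1 - 2 * Re (cnj x * b) + (cmod x)\<^sup>2 * (cmod b)\<^sup>2"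
      unfolding cmod_power2 by (simp add: power2_eq_square algebra_simps)
    then have "Re (cnj x * b) = cmod x * cmod b"
      unfolding eq by (simp add: power2_eq_square algebra_simps)
    then have "x \<bullet> b = norm x * norm b" by (simp add: inner_complex_def)
    then have nb: "norm x *\<^sub>R b = norm b *\<^sub>R x" by (simp add: norm_cauchy_schwarz_eq)
    show "x \<in> closed_segment 0 b"
    proof (cases "b = 0")
      case True then show ?thesis using le by simp
    next
      case False
      then have "(1 / norm b) *\<^sub>R (norm x *\<^sub>R b) = x" unfolding nb by simp
      then have "x = (norm x / norm b) *\<^sub>R b" by simp
      moreover have "norm x / norm b \<le> 1" using le False by (simp add: divide_le_eq_1)
      ultimately show ?thesis unfolding closed_segment_def
        by (intro CollectI exI[of _ "norm x / norm b"]) simp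
    qed
  next
    fix x assume "x \<in> closed_segment 0 b"
    then obtain t where t: "0 \<le> t" "t \<le> 1" "x = of_real t * b"
      by (auto simp: closed_segment_def scaleR_conv_of_real)
    have le: "cmod x \<le> cmod b" using t by (simp add: norm_mult mult_left_le_one_le)
    then have x: "x \<in> hdisk" using b by (simp add: hdisk_iff)
    have "1 - cnj x * b = of_real (1 - t * (cmod b)\<^sup>2)"
      unfolding of_real_diff of_real_1 of_real_mult complex_norm_square t(3) by simp
    moreover have "t * (cmod b)\<^sup>2 \<le> 1 * 1"
      using t b by (intro mult_mono) (auto simp: hdisk_iff abs_square_le_1)
    ultimately have "cmod (1 - cnj x * b) = 1 - t * (cmod b)\<^sup>2"
      by (simp only: norm_of_real)
    then have "cmod (1 - cnj x * b) = 1 - cmod x * cmod b" using t by (simp add: norm_mult power2_eq_square)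
    then show "x \<in> hseg 0 b" using key[OF x] x le by (simp add: hseg_def)
  qed
qed

lemma hseg_eq_image:
  assumes "b \<in> hdisk" "c \<in> hdisk"
  shows "hseg b c = mob_to0 (- b) ` closed_segment 0 (mob_to0 b c)"
proof -
  have "hseg b c = mob_to0 (- b) ` (mob_to0 b ` hseg b c)"
    unfolding image_image using mob_inverse[OF assms(1)] by (auto simp: hseg_def image_iff)
  also have "mob_to0 b ` hseg b c = closed_segment 0 (mob_to0 b c)"
    using assms by (simp add: hseg_mob hseg_0 mob_in_hdisk)
  finally show ?thesis .
qed

lemma closed_segment_0_hdisk: "b \<in> hdisk \<Longrightarrow> closed_segment 0 b \<subseteq> hdisk"
  unfolding hdisk_def by (intro closed_segment_subset) auto

lemma connected_hseg: "b \<in> hdisk \<Longrightarrow> c \<in> hdisk \<Longrightarrow> connected (hseg b c)"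
  unfolding hseg_eq_image
  by (intro connected_continuous_image continuous_on_subset[OF continuous_on_mob] closed_segment_0_hdisk mob_in_hdisk) auto

lemma hseg_ends: "b \<in> hdisk \<Longrightarrow> c \<in> hdisk \<Longrightarrow> b \<in> hseg b c \<and> c \<in> hseg b c"
  by (simp add: hseg_def hdist_chord2) (simp add: chord2_def)

text \<open>A point of the arc, multiplied by the squared modulus of its Moebius denominator, is a
  quadratic polynomial in the parameter of the radial segment, and at parameter 1 it is a positive
  multiple of \<open>c\<close>. Eliminating the vector \<open>w + b\<^sup>2 * cnj w\<close> leaves
  explicit nonnegative coefficients of \<open>b\<close> and \<open>c\<close>.\<close>

lemma hseg_in_cone:
  assumes b: "b \<in> hdisk" and c: "c \<in> hdisk" and x: "x \<in> hseg b c"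
  obtains s t :: real where "0 \<le> s" "0 \<le> t" "0 < s + t" "x = s *\<^sub>R b + t *\<^sub>R c"
proof -
  define w where "w = mob_to0 b c"
  define m where "m = (cmod w)\<^sup>2"
  have mm: "of_real m = w * cnj w" unfolding m_def by (rule complex_norm_square)
  have w: "w \<in> hdisk" using b c by (simp add: w_def mob_in_hdisk)
  have m: "0 \<le> m" "m < 1" using hdisk_one_minus_pos[OF w] by (auto simp: m_def)
  obtain r where r: "0 \<le> r" "r \<le> 1" "x = mob_to0 (- b) (of_real r * w)"
    using x unfolding hseg_eq_image[OF b c] w_def[symmetric]
    by (auto simp: closed_segment_def scaleR_conv_of_real)
  have "of_real r * w \<in> hdisk" using closed_segment_0_hdisk[OF w] r
    by (auto simp: closed_segment_def scaleR_conv_of_real)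
  have key: "of_real ((cmod (1 + cnj b * (of_real q * w)))\<^sup>2) * mob_to0 (- b) (of_real q * w)
       = b * of_real (1 + q\<^sup>2 * m) + of_real q * (w + b\<^sup>2 * cnj w)"
    and nz: "0 < (cmod (1 + cnj b * (of_real q * w)))\<^sup>2"
    if "of_real q * w \<in> hdisk" for q :: real
  proof -
    have *: "1 + cnj b * (of_real q * w) \<noteq> 0" using mob_denom_nonzero[of "- b" "of_real q * w"] b that by simp
    then show "0 < (cmod (1 + cnj b * (of_real q * w)))\<^sup>2" by simp
    have "of_real ((cmod (1 + cnj b * (of_real q * w)))\<^sup>2) * mob_to0 (- b) (of_real q * w)
        = cnj (1 + cnj b * (of_real q * w)) * (of_real q * w + b)"
      using * unfolding complex_norm_square mob_to0_def by simp
    also have "\<dots> = b * of_real (1 + q\<^sup>2 * m) + of_real q * (w + b\<^sup>2 * cnj w)"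
      by (simp add: mm algebra_simps power2_eq_square)
    finally show "of_real ((cmod (1 + cnj b * (of_real q * w)))\<^sup>2) * mob_to0 (- b) (of_real q * w)
       = b * of_real (1 + q\<^sup>2 * m) + of_real q * (w + b\<^sup>2 * cnj w)" .
  qed
  define N where "N = (cmod (1 + cnj b * (of_real r * w)))\<^sup>2"
  define K where "K = (cmod (1 + cnj b * w))\<^sup>2"
  have cw: "mob_to0 (- b) w = c" using b c by (simp add: w_def mob_inverse)
  have K: "of_real K * c = b * of_real (1 + m) + (w + b\<^sup>2 * cnj w)" "0 < K"
    using key[of 1] nz[of 1] w cw by (simp_all add: K_def)
  have N: "of_real N * x = b * of_real (1 + r\<^sup>2 * m) + of_real r * (w + b\<^sup>2 * cnj w)" "0 < N"
    using key[of r] nz[of r] \<open>of_real r * w \<in> hdisk\<close> r by (simp_all add: N_def)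
  have rm: "r * m < 1" using r m mult_left_le_one_le[of m r] by linarith
  have "of_real N * x = of_real ((1 - r) * (1 - r * m)) * b + of_real (r * K) * c"
  proof -
    have "of_real (r * K) * c = of_real r * (b * of_real (1 + m) + (w + b\<^sup>2 * cnj w))"
      by (simp only: of_real_mult mult.assoc K(1))
    then show ?thesis unfolding N(1) by (simp add: algebra_simps power2_eq_square)
  qed
  then have "x = ((1 - r) * (1 - r * m) / N) *\<^sub>R b + (r * K / N) *\<^sub>R c"
    using N(2) by (simp add: scaleR_conv_of_real field_simps)
  moreover have "0 \<le> (1 - r) * (1 - r * m) / N" "0 \<le> r * K / N" using r rm N K by auto
  moreover have "0 < (1 - r) * (1 - r * m) / N + r * K / N"
  proof (cases "r = 0")
    case True then show ?thesis using N by simp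
  next
    case False
    then have "0 < r * K / N" using r K N by simp
    then show ?thesis using calculation(2) by linarith
  qed
  ultimately show ?thesis using that by blast
qed

section \<open>Hyperbolic angles\<close>

definition vangle0 :: "complex \<Rightarrow> complex \<Rightarrow> real" where
  "vangle0 w z = arccos ((w \<bullet> z) / (cmod w * cmod z))"

lemma hangle_mob:
  assumes "c \<in> hdisk" "x \<in> hdisk" "y \<in> hdisk" "z \<in> hdisk"
  shows "hangle (mob_to0 c x) (mob_to0 c y) (mob_to0 c z) = hangle x y z"
  using assms by (simp add: hangle_def hdist_mob)

text \<open>The disk model is conformal and its geodesics through the origin are straight, so at the
  origin the hyperbolic law of cosines returns the Euclidean cosine.\<close>

lemma hangle_0:
  assumes "b \<in> hdisk" "c \<in> hdisk" "b \<noteq> 0" "c \<noteq> 0"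
  shows "(cosh (hdist 0 b) * cosh (hdist 0 c) - cosh (hdist b c)) / (sinh (hdist 0 b) * sinh (hdist 0 c))
       = (b \<bullet> c) / (cmod b * cmod c)"
proof -
  define B C where "B = cmod b" and "C = cmod c"
  have *: "(1 + 2 * (x / (1 - x))) * (1 + 2 * (y / (1 - y))) - (1 + 2 * ((x + y - 2 * d) / ((1 - x) * (1 - y))))
      = 4 * d / ((1 - x) * (1 - y))" if "1 - x \<noteq> 0" "1 - y \<noteq> 0" for x y d :: real
  proof -
    have "1 + 2 * (x / (1 - x)) = (1 + x) / (1 - x)" "1 + 2 * (y / (1 - y)) = (1 + y) / (1 - y)"
      using that by (simp_all add: add_divide_eq_iff)
    moreover have "1 + 2 * ((x + y - 2 * d) / ((1 - x) * (1 - y)))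
        = ((1 - x) * (1 - y) + 2 * (x + y - 2 * d)) / ((1 - x) * (1 - y))"
      using that by (simp add: add_divide_distrib)
    ultimately show ?thesis
      by (simp add: diff_divide_distrib[symmetric]) (simp add: algebra_simps)
  qed
  have B: "0 < 1 - B\<^sup>2" "0 < 1 - C\<^sup>2" "B > 0" "C > 0"
    using assms hdisk_one_minus_pos by (auto simp: B_def C_def)
  have ch: "cosh (hdist 0 b) = 1 + 2 * (B\<^sup>2 / (1 - B\<^sup>2))" "cosh (hdist 0 c) = 1 + 2 * (C\<^sup>2 / (1 - C\<^sup>2))"
    using assms by (simp_all add: cosh_hdist chord2_0 B_def C_def hdisk_iff)
  have n: "(cmod (b - c))\<^sup>2 = B\<^sup>2 + C\<^sup>2 - 2 * (b \<bullet> c)"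
    unfolding B_def C_def power2_norm_eq_inner by (simp add: inner_diff inner_commute algebra_simps)
  have cbc: "cosh (hdist b c) = 1 + 2 * ((B\<^sup>2 + C\<^sup>2 - 2 * (b \<bullet> c)) / ((1 - B\<^sup>2) * (1 - C\<^sup>2)))"
    using assms by (simp add: cosh_hdist chord2_def n) (simp add: B_def C_def)
  have sh: "sinh (hdist 0 b) * sinh (hdist 0 c) = 4 * (B * C) / ((1 - B\<^sup>2) * (1 - C\<^sup>2))"
    using assms by (simp add: sinh_hdist_0 B_def C_def)
  have "cosh (hdist 0 b) * cosh (hdist 0 c) - cosh (hdist b c) = 4 * (b \<bullet> c) / ((1 - B\<^sup>2) * (1 - C\<^sup>2))"
    unfolding ch cbc by (rule *) (use B in auto)
  then show ?thesis unfolding sh using B by (simp add: B_def[symmetric] C_def[symmetric])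
qed

lemma hangle_eq_vangle0:
  assumes "a \<in> hdisk" "b \<in> hdisk" "c \<in> hdisk" "b \<noteq> a" "c \<noteq> a"
  shows "hangle a b c = vangle0 (mob_to0 a b) (mob_to0 a c)"
proof -
  have nz: "mob_to0 a b \<noteq> 0" "mob_to0 a c \<noteq> 0"
    using assms by (simp_all add: mob_eq_0_iff)
  have "hangle a b c = hangle 0 (mob_to0 a b) (mob_to0 a c)"
    using hangle_mob[of a a b c] assms by simp
  then show ?thesis
    using hangle_0[OF _ _ nz] assms by (simp add: hangle_def vangle0_def mob_in_hdisk)
qed

section \<open>Fans of sectors in the plane\<close>

definition cross :: "complex \<Rightarrow> complex \<Rightarrow> real" where
  "cross w z = Im (cnj w * z)"

definition cone2 :: "complex \<Rightarrow> complex \<Rightarrow> complex set" where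
  "cone2 w z = {s *\<^sub>R w + t *\<^sub>R z | s t. 0 \<le> s \<and> 0 \<le> t}"

lemma cross_commute: "cross z w = - cross w z"
  by (simp add: cross_def algebra_simps)

lemma cross_self [simp]: "cross w w = 0"
  by (simp add: cross_def)

lemma cross_zero [simp]: "cross 0 w = 0" "cross w 0 = 0"
  by (simp_all add: cross_def)

lemma cross_add: "cross w (y + z) = cross w y + cross w z" "cross (w + y) z = cross w z + cross y z"
  by (simp_all add: cross_def algebra_simps)

lemma cross_diff: "cross w (y - z) = cross w y - cross w z" "cross (w - y) z = cross w z - cross y z"
  by (simp_all add: cross_def algebra_simps)

lemma cross_minus: "cross w (- z) = - cross w z" "cross (- w) z = - cross w z"
  by (simp_all add: cross_def)

lemma cross_scaleR: "cross w (t *\<^sub>R z) = t * cross w z" "cross (t *\<^sub>R w) z = t * cross w z"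
  by (simp_all add: cross_def algebra_simps)

lemma cross_mult: "cross (c * w) (c * z) = (cmod c)\<^sup>2 * cross w z"
  unfolding cross_def cmod_power2 by (simp add: algebra_simps power2_eq_square)

lemma Im_divide_cross: "Im (z / w) = cross w z / (cmod w)\<^sup>2"
  unfolding cross_def cmod_power2 by (simp add: Im_divide algebra_simps)

text \<open>Cramer's rule, kept free of division so that it also covers parallel vectors.\<close>

lemma cross_swap_coords: "cross w z *\<^sub>R d = cross d z *\<^sub>R w + cross w d *\<^sub>R z"
  by (rule complex_eqI) (simp_all add: cross_def algebra_simps)

lemma cone2_commute: "cone2 w z = cone2 z w"
proof -
  have "cone2 a b \<subseteq> cone2 b a" for a b
    unfolding cone2_def using add.commute by blast
  then show ?thesis by blast
qed

lemma cone2_iff: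
  assumes "cross w z \<noteq> 0"
  shows "d \<in> cone2 w z \<longleftrightarrow> 0 \<le> cross w z * cross w d \<and> 0 \<le> cross w z * cross d z"
proof
  assume "d \<in> cone2 w z"
  then obtain s t where st: "0 \<le> s" "0 \<le> t" "d = s *\<^sub>R w + t *\<^sub>R z" by (auto simp: cone2_def)
  have "cross w z * cross w d = t * (cross w z)\<^sup>2" "cross w z * cross d z = s * (cross w z)\<^sup>2"
    by (simp_all add: st(3) cross_add cross_scaleR power2_eq_square)
  then show "0 \<le> cross w z * cross w d \<and> 0 \<le> cross w z * cross d z" using st by simp
next
  assume a: "0 \<le> cross w z * cross w d \<and> 0 \<le> cross w z * cross d z"
  have "(1 / cross w z) *\<^sub>R (cross w z *\<^sub>R d) = (1 / cross w z) *\<^sub>R (cross d z *\<^sub>R w + cross w d *\<^sub>R z)"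
    by (rule arg_cong[OF cross_swap_coords])
  then have "d = (cross d z / cross w z) *\<^sub>R w + (cross w d / cross w z) *\<^sub>R z"
    using assms by (simp add: scaleR_add_right)
  moreover have "0 \<le> cross d z / cross w z" "0 \<le> cross w d / cross w z"
    using a assms by (auto simp: zero_le_mult_iff zero_le_divide_iff)
  ultimately show "d \<in> cone2 w z" unfolding cone2_def
    by (intro CollectI exI[of _ "cross d z / cross w z"] exI[of _ "cross w d / cross w z"]) simp
qed

lemma cone2_mult:
  assumes "c \<noteq> 0"
  shows "c * d \<in> cone2 (c * w) (c * z) \<longleftrightarrow> d \<in> cone2 w z"
proof -
  have "c * d = s *\<^sub>R (c * w) + t *\<^sub>R (c * z) \<longleftrightarrow> d = s *\<^sub>R w + t *\<^sub>R z" for s t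
  proof -
    have "s *\<^sub>R (c * w) + t *\<^sub>R (c * z) = c * (s *\<^sub>R w + t *\<^sub>R z)"
      by (simp add: algebra_simps)
    then show ?thesis using assms by simp
  qed
  then show ?thesis by (simp add: cone2_def)
qed

lemma Arg_divide_pos_cross:
  assumes "0 < cross w z"
  shows "0 < Arg (z / w)" "Arg (z / w) < pi"
proof -
  have "w \<noteq> 0" using assms by (auto simp: cross_def)
  then have "0 < Im (z / w)" using assms by (simp add: Im_divide_cross)
  then show "0 < Arg (z / w)" "Arg (z / w) < pi" using Arg_lt_pi by auto
qed

lemma Arg_divide_eq_vangle0:
  assumes "0 < cross w z"
  shows "Arg (z / w) = vangle0 w z"
proof -
  have nz: "w \<noteq> 0" "z \<noteq> 0" using assms by (auto simp: cross_def)
  have "cos (Arg (z / w)) = Re (z / w) / cmod (z / w)"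
    using nz by (simp add: cos_Arg)
  also have "Re (z / w) = (w \<bullet> z) / (cmod w)\<^sup>2"
    unfolding cmod_power2 by (simp add: Re_divide inner_complex_def algebra_simps)
  also have "(w \<bullet> z) / (cmod w)\<^sup>2 / cmod (z / w) = (w \<bullet> z) / (cmod w * cmod z)"
    using nz by (simp add: norm_divide power2_eq_square)
  finally show ?thesis
    using Arg_divide_pos_cross[OF assms] unfolding vangle0_def by (metis arccos_cos less_imp_le)
qed

text \<open>A counterclockwise turn by less than \<pi> changes \<open>Arg\<close> by the angle
  itself, unless the sector meets the branch cut on the negative real axis; there \<open>Arg\<close>
  drops by a full turn.\<close>

lemma Arg_divide_crossing:
  assumes c: "0 < cross w z" and w: "w \<notin> \<real>\<^sub>\<le>\<^sub>0" and z: "z \<notin> \<real>\<^sub>\<le>\<^sub>0"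
  shows "Arg (z / w) = Arg z - Arg w + (if -1 \<in> cone2 w z then 2 * pi else 0)"
proof -
  have nz: "w \<noteq> 0" "z \<noteq> 0" using assms by auto
  have cone: "-1 \<in> cone2 w z \<longleftrightarrow> 0 \<le> Im w \<and> Im z \<le> 0"
    using c by (simp add: cone2_iff zero_le_mult_iff) (simp add: cross_def)
  have th: "0 < Arg (z / w)" "Arg (z / w) < pi" by (rule Arg_divide_pos_cross[OF c])+
  have a: "- pi < Arg z" "Arg z < pi" "- pi < Arg w" "Arg w < pi"
    using mpi_less_Arg Arg_le_pi[of z] Arg_le_pi[of w] Arg_eq_pi[of z] Arg_eq_pi[of w] w z
    by (auto simp: less_le complex_nonpos_Reals_iff)
  have "exp (Ln (z / w) - (Ln z - Ln w)) = 1"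
    using nz by (simp add: exp_diff)
  then obtain n :: int where "Im (Ln (z / w) - (Ln z - Ln w)) = of_int (2 * n) * pi"
    unfolding exp_eq_1 by blast
  then have n: "Arg (z / w) = Arg z - Arg w + 2 * pi * of_int n"
    using nz by (simp add: Arg_eq_Im_Ln algebra_simps)
  have nb: "- (2 * pi) < 2 * pi * of_int n" "2 * pi * of_int n < 2 * pi * 2"
    using n th a by linarith+
  have "- 1 < n"
  proof (rule ccontr)
    assume "\<not> - 1 < n"
    then have "2 * pi * of_int n \<le> 2 * pi * (- 1)" by (intro mult_left_mono) auto
    then show False using nb by linarith
  qed
  moreover have "n < 2"
  proof (rule ccontr)
    assume "\<not> n < 2"
    then have "2 * pi * 2 \<le> 2 * pi * of_int n" by (intro mult_left_mono) auto
    then show False using nb by linarith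
  qed
  ultimately consider "n = 0" | "n = 1" by linarith
  then show ?thesis
  proof cases
    case 1
    then have "Arg w < Arg z" using n th by simp
    then have "\<not> (0 \<le> Im w \<and> Im z \<le> 0)"
      using Arg_less_0[of w] Arg_lt_pi[of z] a by linarith
    then show ?thesis using cone n 1 by simp
  next
    case 2
    then have n1: "Arg (z / w) = Arg z - Arg w + 2 * pi" using n by simp
    have "0 < Arg w" "Arg z < 0" using n1 th a by linarith+
    then have "0 \<le> Im w \<and> Im z \<le> 0" using Arg_less_0[of w] Arg_neg_iff[of z] by linarith
    then show ?thesis using cone n 2 by simp
  qed
qed

text \<open>Two sectors on the same side of the spoke \<open>\<zeta> j\<close> would both contain a
  slight rotation of it, although \<open>sep\<close> lets different sectors meet only along common
  spokes. The sign \<open>s\<close> selects the side, so that the lemma gives uniqueness both of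
  successors and of predecessors.\<close>

lemma fan_neighbour_unique:
  fixes \<zeta> :: "'v \<Rightarrow> complex"
  assumes sep: "\<And>j k j' k' d. \<lbrakk>(j, k) \<in> N; (j', k') \<in> N; {j, k} \<noteq> {j', k'}; d \<in> cone2 (\<zeta> j) (\<zeta> k);
        d \<in> cone2 (\<zeta> j') (\<zeta> k'); d \<noteq> 0\<rbrakk> \<Longrightarrow> \<exists>l\<in>{j, k} \<inter> {j', k'}. \<exists>t>0. d = t *\<^sub>R \<zeta> l"
    and N: "(j, k) \<in> N" "(j, k') \<in> N"
    and s: "0 < s * cross (\<zeta> j) (\<zeta> k)" "0 < s * cross (\<zeta> j) (\<zeta> k')" "\<bar>s\<bar> = 1"
  shows "k = k'"
proof (rule ccontr)
  assume ne: "k \<noteq> k'"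
  have jk: "j \<noteq> k" "j \<noteq> k'" using s by auto
  define d where "d = (\<lambda>\<theta>::real. \<zeta> j + (s * \<theta>) *\<^sub>R (\<i> * \<zeta> j))"
  have z0: "\<zeta> j \<noteq> 0" using s by auto
  have cj: "cross (\<zeta> j) (d \<theta>) = s * \<theta> * (cmod (\<zeta> j))\<^sup>2" for \<theta>
    unfolding d_def cmod_power2 by (simp add: cross_def algebra_simps power2_eq_square)
  have ev: "\<forall>\<^sub>F \<theta> in at_right 0. 0 < s * cross (d \<theta>) w" if "0 < s * cross (\<zeta> j) w" for w
  proof (rule order_tendstoD(1))
    have "((\<lambda>\<theta>. s * cross (d \<theta>) w) \<longlongrightarrow> s * cross (d 0) w) (at_right 0)"
      unfolding d_def cross_def by (intro tendsto_intros)
    then show "((\<lambda>\<theta>. s * cross (d \<theta>) w) \<longlongrightarrow> s * cross (\<zeta> j) w) (at_right 0)"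
      by (simp add: d_def)
  qed (use that in simp)
  have "\<forall>\<^sub>F \<theta> in at_right 0. 0 < s * cross (d \<theta>) (\<zeta> k) \<and> 0 < s * cross (d \<theta>) (\<zeta> k') \<and> 0 < (\<theta>::real)"
    using ev[OF s(1)] ev[OF s(2)] by (auto simp: eventually_conj_iff eventually_at_right_less)
  then obtain \<theta> :: real where th: "0 < s * cross (d \<theta>) (\<zeta> k)" "0 < s * cross (d \<theta>) (\<zeta> k')" "0 < \<theta>"
    using eventually_happens'[OF trivial_limit_at_right_real] by blast
  have ss: "s * s = 1" using s(3) by (metis abs_mult_self_eq mult_1)
  have pos: "0 < s * cross (\<zeta> j) (d \<theta>)" using cj ss th(3) z0 by (simp flip: mult.assoc)
  have prod: "0 \<le> x * y" if "0 < s * x" "0 < s * y" for x y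
  proof -
    have "0 < (s * x) * (s * y)" using that by simp
    also have "(s * x) * (s * y) = (s * s) * (x * y)" by (simp only: mult_ac)
    finally show ?thesis using ss by simp
  qed
  have "d \<theta> \<in> cone2 (\<zeta> j) (\<zeta> k)" "d \<theta> \<in> cone2 (\<zeta> j) (\<zeta> k')"
    using s th pos prod by (subst cone2_iff; force)+
  moreover have "d \<theta> \<noteq> 0" using pos by auto
  moreover have "{j, k} \<noteq> {j, k'}" using ne jk by auto
  ultimately obtain l t where l: "l \<in> {j, k} \<inter> {j, k'}" "d \<theta> = t *\<^sub>R \<zeta> l" using sep[OF N] by blast
  then have "l = j" using ne by auto
  then have "cross (\<zeta> j) (d \<theta>) = 0" using l by (simp add: cross_scaleR)
  then show False using pos by simp
qed

text \<open>A slight counterclockwise rotation of \<open>\<zeta> j\<close> lies in some sector. A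
  closed cone that misses \<open>\<zeta> j\<close> misses all directions near it, and there are
  finitely many cones; so for a small rotation the sector found contains \<open>\<zeta> j\<close>
  too and, by \<open>on_ray\<close>, has it as a spoke.\<close>

lemma fan_left_neighbour:
  fixes \<zeta> :: "'v \<Rightarrow> complex"
  assumes fin: "finite N" and sym: "\<And>j k. (j, k) \<in> N \<Longrightarrow> (k, j) \<in> N"
    and nd: "\<And>j k. (j, k) \<in> N \<Longrightarrow> cross (\<zeta> j) (\<zeta> k) \<noteq> 0"
    and cov: "\<And>d. \<exists>(j, k)\<in>N. d \<in> cone2 (\<zeta> j) (\<zeta> k)"
    and on_ray: "\<And>k l. (k, l) \<in> N \<Longrightarrow> \<zeta> j \<in> cone2 (\<zeta> k) (\<zeta> l) \<Longrightarrow> j \<in> {k, l}"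
    and z0: "\<zeta> j \<noteq> 0"
  shows "\<exists>k. (j, k) \<in> N \<and> 0 < cross (\<zeta> j) (\<zeta> k)"
proof -
  define d where "d = (\<lambda>\<theta>::real. \<zeta> j + \<theta> *\<^sub>R (\<i> * \<zeta> j))"
  have cj: "cross (\<zeta> j) (d \<theta>) = \<theta> * (cmod (\<zeta> j))\<^sup>2" for \<theta>
    unfolding d_def cmod_power2 by (simp add: cross_def algebra_simps power2_eq_square)
  have lim: "((\<lambda>\<theta>. c * cross (d \<theta>) w) \<longlongrightarrow> c * cross (\<zeta> j) w) (at_right 0)"
    "((\<lambda>\<theta>. c * cross w (d \<theta>)) \<longlongrightarrow> c * cross w (\<zeta> j)) (at_right 0)" for w and c :: real
  proof -
    have "((\<lambda>\<theta>. c * cross (d \<theta>) w) \<longlongrightarrow> c * cross (d 0) w) (at_right 0)"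
      "((\<lambda>\<theta>. c * cross w (d \<theta>)) \<longlongrightarrow> c * cross w (d 0)) (at_right 0)"
      unfolding d_def cross_def by (intro tendsto_intros)+
    then show "((\<lambda>\<theta>. c * cross (d \<theta>) w) \<longlongrightarrow> c * cross (\<zeta> j) w) (at_right 0)"
      "((\<lambda>\<theta>. c * cross w (d \<theta>)) \<longlongrightarrow> c * cross w (\<zeta> j)) (at_right 0)"
      by (simp_all add: d_def)
  qed
  have "\<forall>\<^sub>F \<theta> in at_right 0. d \<theta> \<in> cone2 (\<zeta> k) (\<zeta> l) \<longrightarrow> \<zeta> j \<in> cone2 (\<zeta> k) (\<zeta> l)"
    if kl: "(k, l) \<in> N" for k l
  proof (cases "\<zeta> j \<in> cone2 (\<zeta> k) (\<zeta> l)")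
    case False
    let ?c = "cross (\<zeta> k) (\<zeta> l)"
    consider "?c * cross (\<zeta> k) (\<zeta> j) < 0" | "?c * cross (\<zeta> j) (\<zeta> l) < 0"
      using False cone2_iff[OF nd[OF kl]] by force
    then show ?thesis
    proof cases
      case 1
      from order_tendstoD(2)[OF lim(2) 1] show ?thesis
        by eventually_elim (use cone2_iff[OF nd[OF kl]] in auto)
    next
      case 2
      from order_tendstoD(2)[OF lim(1) 2] show ?thesis
        by eventually_elim (use cone2_iff[OF nd[OF kl]] in auto)
    qed
  qed (simp add: eventually_mono)
  then have "\<forall>\<^sub>F \<theta> in at_right 0. \<forall>(k, l)\<in>N. d \<theta> \<in> cone2 (\<zeta> k) (\<zeta> l) \<longrightarrow> \<zeta> j \<in> cone2 (\<zeta> k) (\<zeta> l)"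
    using fin by (intro eventually_ball_finite) auto
  moreover have "\<forall>\<^sub>F \<theta> in at_right 0. 0 < (\<theta>::real)" by (rule eventually_at_right_less)
  ultimately have "\<forall>\<^sub>F \<theta> in at_right 0. 0 < \<theta> \<and>
      (\<forall>(k, l)\<in>N. d \<theta> \<in> cone2 (\<zeta> k) (\<zeta> l) \<longrightarrow> \<zeta> j \<in> cone2 (\<zeta> k) (\<zeta> l))"
    by eventually_elim blast
  then obtain \<theta> where th: "0 < \<theta>"
    "\<And>k l. (k, l) \<in> N \<Longrightarrow> d \<theta> \<in> cone2 (\<zeta> k) (\<zeta> l) \<Longrightarrow> \<zeta> j \<in> cone2 (\<zeta> k) (\<zeta> l)"
    using eventually_happens'[OF trivial_limit_at_right_real] by blast
  obtain k l where kl: "(k, l) \<in> N" "d \<theta> \<in> cone2 (\<zeta> k) (\<zeta> l)" using cov[of "d \<theta>"] by blast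
  have "\<exists>m. (j, m) \<in> N \<and> d \<theta> \<in> cone2 (\<zeta> j) (\<zeta> m)"
    using on_ray[OF kl(1) th(2)[OF kl]] kl sym cone2_commute by blast
  then obtain m where m: "(j, m) \<in> N" "d \<theta> \<in> cone2 (\<zeta> j) (\<zeta> m)" by blast
  have "0 \<le> cross (\<zeta> j) (\<zeta> m) * (\<theta> * (cmod (\<zeta> j))\<^sup>2)"
    using m(2) cone2_iff[OF nd[OF m(1)]] cj by auto
  moreover have "0 < \<theta> * (cmod (\<zeta> j))\<^sup>2" using th(1) z0 by simp
  ultimately have "0 \<le> cross (\<zeta> j) (\<zeta> m)" by (metis mult.commute mult_le_cancel_left_pos mult_zero_right)
  then show ?thesis using m nd[OF m(1)] by force
qed

text \<open>Sectors that cover the plane and overlap only along spokes wind around the origin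
  exactly once. The successor \<open>\<sigma>\<close> is injective because predecessors are unique
  as well, and the total angle is obtained by counting how often the sectors cross one generic
  direction.\<close>

lemma fan_permutation:
  fixes \<zeta> :: "'v \<Rightarrow> complex"
  assumes fin: "finite N" and sym: "\<And>j k. (j, k) \<in> N \<Longrightarrow> (k, j) \<in> N"
    and nd: "\<And>j k. (j, k) \<in> N \<Longrightarrow> cross (\<zeta> j) (\<zeta> k) \<noteq> 0"
    and cov: "\<And>d. \<exists>(j, k)\<in>N. d \<in> cone2 (\<zeta> j) (\<zeta> k)"
    and sep: "\<And>j k j' k' d. \<lbrakk>(j, k) \<in> N; (j', k') \<in> N; {j, k} \<noteq> {j', k'}; d \<in> cone2 (\<zeta> j) (\<zeta> k);
        d \<in> cone2 (\<zeta> j') (\<zeta> k'); d \<noteq> 0\<rbrakk> \<Longrightarrow> \<exists>l\<in>{j, k} \<inter> {j', k'}. \<exists>t>0. d = t *\<^sub>R \<zeta> l"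
  obtains \<sigma> where "bij_betw \<sigma> (fst ` N) (fst ` N)"
    "\<And>j. j \<in> fst ` N \<Longrightarrow> (j, \<sigma> j) \<in> N \<and> 0 < cross (\<zeta> j) (\<zeta> (\<sigma> j))"
    "\<And>j k. (j, k) \<in> N \<Longrightarrow> 0 < cross (\<zeta> j) (\<zeta> k) \<Longrightarrow> k = \<sigma> j"
    "(\<Sum>j\<in>fst ` N. Arg (\<zeta> (\<sigma> j) / \<zeta> j)) = 2 * pi"
proof -
  let ?J = "fst ` N"
  have nz: "\<zeta> j \<noteq> 0" if "j \<in> ?J" for j using that nd by force
  have in_J: "j \<in> ?J" "k \<in> ?J" if "(j, k) \<in> N" for j k using that sym by force+
  have on_ray: "j \<in> {k, l}" if kl: "(k, l) \<in> N" and c: "\<zeta> j \<in> cone2 (\<zeta> k) (\<zeta> l)" and j: "j \<in> ?J" for j k l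
  proof (rule ccontr)
    assume n: "j \<notin> {k, l}"
    obtain m where m: "(j, m) \<in> N" using j by force
    have "\<zeta> j \<in> cone2 (\<zeta> j) (\<zeta> m)" using cone2_iff[OF nd[OF m]] by simp
    moreover have "{j, m} \<noteq> {k, l}" using n by auto
    ultimately obtain i t where i: "i \<in> {j, m} \<inter> {k, l}" "\<zeta> j = t *\<^sub>R \<zeta> i" "t > 0"
      using sep[OF m kl _ _ c] nz[OF j] by blast
    then have "i = m" using n by auto
    then have "cross (\<zeta> j) (\<zeta> m) = 0" using i by (simp add: cross_scaleR)
    then show False using nd[OF m] by simp
  qed
  have "\<exists>k. (j, k) \<in> N \<and> 0 < cross (\<zeta> j) (\<zeta> k)" if "j \<in> ?J" for j
    by (rule fan_left_neighbour[OF fin sym nd cov on_ray nz]) (use that in auto)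
  then obtain \<sigma> where \<sigma>: "\<And>j. j \<in> ?J \<Longrightarrow> (j, \<sigma> j) \<in> N \<and> 0 < cross (\<zeta> j) (\<zeta> (\<sigma> j))" by metis
  have uniq: "k = \<sigma> j" if "(j, k) \<in> N" "0 < cross (\<zeta> j) (\<zeta> k)" for j k
    by (rule fan_neighbour_unique[OF sep, where s = 1 and N = N]) (use that \<sigma> in_J in auto)
  have maps: "\<sigma> ` ?J \<subseteq> ?J" using \<sigma> in_J by blast
  have "inj_on \<sigma> ?J"
  proof (rule inj_onI)
    fix j k assume jk: "j \<in> ?J" "k \<in> ?J" "\<sigma> j = \<sigma> k"
    show "j = k"
    proof (rule fan_neighbour_unique[OF sep, where s = "-1" and N = N])
      show "(\<sigma> j, j) \<in> N" "(\<sigma> j, k) \<in> N" using \<sigma>[OF jk(1)] \<sigma>[OF jk(2)] sym jk(3) by auto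
      show "0 < - 1 * cross (\<zeta> (\<sigma> j)) (\<zeta> j)" "0 < - 1 * cross (\<zeta> (\<sigma> j)) (\<zeta> k)"
        using \<sigma>[OF jk(1)] \<sigma>[OF jk(2)] jk(3) cross_commute by (metis mult_minus1)+
    qed auto
  qed
  then have bij: "bij_betw \<sigma> ?J ?J"
    using maps fin by (simp add: bij_betw_def endo_inj_surj)
  obtain j0 where j0: "j0 \<in> ?J" using cov[of 0] in_J by blast
  note s0 = \<sigma>[OF j0]
  define e where "e = \<zeta> j0 + \<zeta> (\<sigma> j0)"
  have e1: "0 < cross (\<zeta> j0) e" "0 < cross e (\<zeta> (\<sigma> j0))" using s0 by (simp_all add: e_def cross_add)
  then have e0: "e \<noteq> 0" by auto
  have econe: "e \<in> cone2 (\<zeta> j0) (\<zeta> (\<sigma> j0))" using e1 s0 by (simp add: cone2_iff)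
  define \<xi> where "\<xi> = (\<lambda>j. (- 1 / e) * \<zeta> j)"
  have c0: "- 1 / e \<noteq> 0" using e0 by simp
  \<comment> \<open>The rotation puts a direction from the interior of exactly one sector on the branch cut of Arg, so that the sum telescopes up to a single jump.\<close>
  have only: "e \<in> cone2 (\<zeta> j) (\<zeta> (\<sigma> j)) \<longleftrightarrow> j = j0" if j: "j \<in> ?J" for j
  proof
    assume c: "e \<in> cone2 (\<zeta> j) (\<zeta> (\<sigma> j))"
    have eq: "{j, \<sigma> j} = {j0, \<sigma> j0}"
    proof (rule ccontr)
      assume "{j, \<sigma> j} \<noteq> {j0, \<sigma> j0}"
      then obtain l t where l: "l \<in> {j0, \<sigma> j0}" "e = t *\<^sub>R \<zeta> l"
        using sep[OF conjunct1[OF \<sigma>[OF j]] conjunct1[OF s0] _ c econe e0] by blast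
      then show False using e1 by (auto simp: cross_scaleR)
    qed
    show "j = j0"
    proof (rule ccontr)
      assume "j \<noteq> j0"
      then have "j = \<sigma> j0" "\<sigma> j = j0" using eq by (auto simp: doubleton_eq_iff)
      then have "0 < cross (\<zeta> (\<sigma> j0)) (\<zeta> j0)" using \<sigma>[OF j] by simp
      then show False using s0 cross_commute[of "\<zeta> j0"] by simp
    qed
  qed (use econe in simp)
  have nonpos: "\<xi> j \<notin> \<real>\<^sub>\<le>\<^sub>0" if j: "j \<in> ?J" for j
  proof
    assume "\<xi> j \<in> \<real>\<^sub>\<le>\<^sub>0"
    then obtain r where r: "r \<le> 0" "\<xi> j = of_real r" by (auto simp: nonpos_Reals_def)
    then have "e * (- 1 / e * \<zeta> j) = e * of_real r" by (simp add: \<xi>_def)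
    then have "- \<zeta> j = e * of_real r" using e0 by simp
    then have ze: "\<zeta> j = (- r) *\<^sub>R e" by (simp add: scaleR_conv_of_real minus_equation_iff[of "\<zeta> j"] mult.commute)
    then have "\<zeta> j \<in> cone2 (\<zeta> j0) (\<zeta> (\<sigma> j0))"
      using r e1 s0 by (simp add: cone2_iff cross_scaleR cross_minus mult_nonneg_nonpos mult_nonpos_nonneg mult_nonneg_nonneg)
    then have "j \<in> {j0, \<sigma> j0}" using on_ray[OF conjunct1[OF s0] _ j] by blast
    then have "cross (\<zeta> j) e \<noteq> 0" using e1 cross_commute[of e] by auto
    then show False unfolding ze by (simp add: cross_scaleR cross_minus)
  qed
  have summand: "Arg (\<zeta> (\<sigma> j) / \<zeta> j) = Arg (\<xi> (\<sigma> j)) - Arg (\<xi> j) + (if j = j0 then 2 * pi else 0)"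
    if j: "j \<in> ?J" for j
  proof -
    have "- 1 = (- 1 / e) * e" using e0 by simp
    then have "- 1 \<in> cone2 (\<xi> j) (\<xi> (\<sigma> j)) \<longleftrightarrow> j = j0"
      unfolding \<xi>_def using cone2_mult[OF c0] only[OF j] by metis
    moreover have pos: "0 < cross (\<xi> j) (\<xi> (\<sigma> j))"
      unfolding \<xi>_def cross_mult using \<sigma>[OF j] c0 by simp
    moreover have "\<zeta> (\<sigma> j) / \<zeta> j = \<xi> (\<sigma> j) / \<xi> j" using e0 by (simp add: \<xi>_def)
    moreover have "\<sigma> j \<in> ?J" using maps j by blast
    ultimately show ?thesis using Arg_divide_crossing[OF pos nonpos[OF j] nonpos] by simp
  qed
  have "(\<Sum>j\<in>?J. Arg (\<zeta> (\<sigma> j) / \<zeta> j))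
      = (\<Sum>j\<in>?J. Arg (\<xi> (\<sigma> j))) - (\<Sum>j\<in>?J. Arg (\<xi> j)) + (\<Sum>j\<in>?J. if j = j0 then 2 * pi else 0)"
    by (simp add: summand sum.distrib sum_subtractf cong: sum.cong)
  also have "\<dots> = 2 * pi"
    using fin j0 sum.reindex_bij_betw[OF bij, of "\<lambda>j. Arg (\<xi> j)"] by simp
  finally show ?thesis using that[OF bij \<sigma> uniq] by blast
qed

text \<open>Each orientation is affine in the position of the apex, so it stays positive along the
  whole segment from 0 to \<open>h\<close>. There the sum of the logarithms is continuous, and since
  the product of the quotients telescopes to 1, it takes values in the integer multiples of 2 \<pi>
  i; hence it is constant.\<close>

lemma angle_sum_move_apex:
  fixes p :: "'v \<Rightarrow> complex"
  assumes fin: "finite J" and bij: "bij_betw \<sigma> J J"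
    and c0: "\<And>j. j \<in> J \<Longrightarrow> 0 < cross (p j) (p (\<sigma> j))"
    and c1: "\<And>j. j \<in> J \<Longrightarrow> 0 < cross (p j - h) (p (\<sigma> j) - h)"
  shows "(\<Sum>j\<in>J. Arg ((p (\<sigma> j) - h) / (p j - h))) = (\<Sum>j\<in>J. Arg (p (\<sigma> j) / p j))"
proof -
  define q where "q = (\<lambda>t j. p j - t *\<^sub>R h)"
  have affine: "cross (q t j) (q t (\<sigma> j)) = (1 - t) * cross (p j) (p (\<sigma> j)) + t * cross (p j - h) (p (\<sigma> j) - h)" for t j
    by (simp add: q_def cross_diff cross_scaleR algebra_simps)
  have pos: "0 < cross (q t j) (q t (\<sigma> j))" if "j \<in> J" "t \<in> {0..1}" for t j
  proof (cases "t = 0")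
    case True then show ?thesis using c0[OF that(1)] by (simp add: q_def)
  next
    case False
    then have "0 < t * cross (p j - h) (p (\<sigma> j) - h)" "0 \<le> (1 - t) * cross (p j) (p (\<sigma> j))"
      using that c0[OF that(1)] c1[OF that(1)] by auto
    then show ?thesis unfolding affine by linarith
  qed
  have nz: "q t j \<noteq> 0" if "j \<in> J" "t \<in> {0..1}" for t j using pos[OF that] by auto
  have sJ: "\<sigma> j \<in> J" if "j \<in> J" for j using bij that by (auto simp: bij_betw_def)
  define f where "f = (\<lambda>t. \<Sum>j\<in>J. Ln (q t (\<sigma> j) / q t j))"
  have expf: "exp (f t) = 1" if t: "t \<in> {0..1}" for t
  proof -
    have "exp (f t) = (\<Prod>j\<in>J. q t (\<sigma> j) / q t j)"
      unfolding f_def exp_sum[OF fin] using nz sJ t by (intro prod.cong refl exp_Ln) auto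
    also have "\<dots> = (\<Prod>j\<in>J. q t j) / (\<Prod>j\<in>J. q t j)"
      by (simp add: prod_dividef prod.reindex_bij_betw[OF bij, of "q t"])
    also have "\<dots> = 1" using nz t fin by simp
    finally show ?thesis .
  qed
  have cont: "continuous_on {0..1} f"
    unfolding f_def
  proof (intro continuous_intros)
    show "continuous_on {0..1} (\<lambda>t. q t (\<sigma> j))" "continuous_on {0..1} (\<lambda>t. q t j)" for j
      unfolding q_def by (intro continuous_intros)+
    show "\<forall>t\<in>{0..1}. q t j \<noteq> 0" if "j \<in> J" for j using nz that by blast
    show "q t (\<sigma> j) / q t j \<notin> \<real>\<^sub>\<le>\<^sub>0" if "j \<in> J" "t \<in> {0..1}" for j t
      using pos[OF that] nz[OF that] Im_divide_cross[of "q t (\<sigma> j)" "q t j"]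
      by (auto simp: complex_nonpos_Reals_iff)
  qed
  have int: "\<exists>n::int. f t = of_int n * (2 * of_real pi * \<i>)" if "t \<in> {0..1}" for t
    using expf[OF that] unfolding exp_eq_1 by (auto simp: complex_eq_iff)
  have "f constant_on {0..1}"
  proof (rule continuous_discrete_range_constant[OF _ cont])
    show "connected {0..1::real}" by simp
    fix t :: real assume t: "t \<in> {0..1}"
    show "\<exists>e>0. \<forall>u. u \<in> {0..1} \<and> f u \<noteq> f t \<longrightarrow> e \<le> norm (f u - f t)"
    proof (intro exI[of _ "2 * pi"] conjI allI impI)
      fix u assume u: "u \<in> {0..1} \<and> f u \<noteq> f t"
      obtain m n :: int where mn: "f u = of_int m * (2 * of_real pi * \<i>)" "f t = of_int n * (2 * of_real pi * \<i>)"
        using int t u by metis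
      then have "m \<noteq> n" using u by auto
      then have "1 \<le> \<bar>real_of_int (m - n)\<bar>" by linarith
      moreover have "norm (f u - f t) = \<bar>real_of_int (m - n)\<bar> * (2 * pi)"
      proof -
        have "f u - f t = of_real (real_of_int (m - n)) * (2 * of_real pi * \<i>)"
          unfolding mn by (simp add: algebra_simps)
        then show ?thesis by (simp only: norm_mult norm_of_real norm_ii) simp
      qed
      ultimately show "2 * pi \<le> norm (f u - f t)" by simp
    qed simp
  qed
  then have "f 0 = f 1" unfolding constant_on_def by force
  moreover have "Im (f t) = (\<Sum>j\<in>J. Arg (q t (\<sigma> j) / q t j))" if "t \<in> {0..1}" for t
    unfolding f_def Im_sum using nz sJ that by (intro sum.cong refl) (simp add: Arg_eq_Im_Ln)
  ultimately show ?thesis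
    by (metis (no_types, lifting) atLeastAtMost_iff order_refl q_def zero_le_one scaleR_zero_left scaleR_one diff_zero sum.cong)
qed

section \<open>Vertex stars of geodesic triangulations\<close>

lemma cone2_scaleR:
  assumes "0 \<le> r" "d \<in> cone2 w z"
  shows "r *\<^sub>R d \<in> cone2 w z"
proof -
  obtain s t where "0 \<le> s" "0 \<le> t" "d = s *\<^sub>R w + t *\<^sub>R z" using assms by (auto simp: cone2_def)
  then have "0 \<le> r * s \<and> 0 \<le> r * t \<and> r *\<^sub>R d = (r * s) *\<^sub>R w + (r * t) *\<^sub>R z"
    using assms by (simp add: scaleR_add_right)
  then show ?thesis unfolding cone2_def by blast
qed

lemma cross_inner_Pythagoras: "(w \<bullet> z)\<^sup>2 + (cross w z)\<^sup>2 = (cmod w * cmod z)\<^sup>2"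
  unfolding power_mult_distrib cmod_power2 cross_def inner_complex_def
  by (simp add: algebra_simps power2_eq_square)

lemma law_of_cosines_hdist:
  assumes "a \<in> hdisk" "b \<in> hdisk" "c \<in> hdisk" "b \<noteq> a" "c \<noteq> a"
  shows "cosh (hdist a b) * cosh (hdist a c) - cosh (hdist b c)
       = sinh (hdist a b) * sinh (hdist a c) * ((mob_to0 a b \<bullet> mob_to0 a c) / (cmod (mob_to0 a b) * cmod (mob_to0 a c)))"
proof -
  have nz: "mob_to0 a b \<noteq> 0" "mob_to0 a c \<noteq> 0"
    using assms by (simp_all add: mob_eq_0_iff)
  have d: "hdist 0 (mob_to0 a b) = hdist a b" "hdist 0 (mob_to0 a c) = hdist a c"
    "hdist (mob_to0 a b) (mob_to0 a c) = hdist b c"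
    using assms hdist_mob[of a a b] hdist_mob[of a a c] hdist_mob[of a b c] by simp_all
  have "sinh (hdist a b) \<noteq> 0" "sinh (hdist a c) \<noteq> 0"
    using sinh_hdist_pos[of a b] sinh_hdist_pos[of a c] assms by auto
  then show ?thesis
    using hangle_0[OF mob_in_hdisk mob_in_hdisk nz] assms unfolding d by (simp add: field_simps)
qed

text \<open>In a collinear triangle the cosine at \<open>a\<close> is 1 or -1. In the first case the
  angle at \<open>a\<close> vanishes; in the second \<open>a\<close> lies between \<open>b\<close>
  and \<open>c\<close>, the distances add, and the angle at \<open>b\<close> vanishes.\<close>

lemma cross_nonzero_of_hangle_pos:
  assumes d: "a \<in> hdisk" "b \<in> hdisk" "c \<in> hdisk" and ne: "b \<noteq> a" "c \<noteq> a" "b \<noteq> c"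
    and A: "0 < hangle a b c" and B: "0 < hangle b a c"
  shows "cross (mob_to0 a b) (mob_to0 a c) \<noteq> 0"
proof
  assume z: "cross (mob_to0 a b) (mob_to0 a c) = 0"
  define w z where "w = mob_to0 a b" and "z = mob_to0 a c"
  have nz: "w \<noteq> 0" "z \<noteq> 0" using d ne by (simp_all add: mob_eq_0_iff w_def z_def)
  have "(w \<bullet> z)\<^sup>2 = (cmod w * cmod z)\<^sup>2" using cross_inner_Pythagoras[of w z] z by (simp add: w_def z_def)
  then have "w \<bullet> z = cmod w * cmod z \<or> w \<bullet> z = - (cmod w * cmod z)" by (rule power2_eq_iff[THEN iffD1])
  then consider "(w \<bullet> z) / (cmod w * cmod z) = 1" | "(w \<bullet> z) / (cmod w * cmod z) = -1"
    using nz by auto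
  then show False
  proof cases
    case 1
    then have "hangle a b c = 0"
      unfolding hangle_eq_vangle0[OF d ne(1,2)] vangle0_def w_def z_def by (simp only: arccos_1)
    then show False using A by simp
  next
    case 2
    have s: "0 < sinh (hdist a b)" "0 < sinh (hdist b c)" 
      using sinh_hdist_pos[OF d(1,2) ne(1)[symmetric]] sinh_hdist_pos[OF d(2,3) ne(3)] by auto
    have "cosh (hdist b c) = cosh (hdist a b + hdist a c)"
      using law_of_cosines_hdist[OF d ne(1,2), folded w_def z_def] unfolding 2 by (simp add: cosh_add)
    then have "hdist b c = hdist a b + hdist a c"
      using hdist_nonneg d by (metis add_nonneg_nonneg arcosh_cosh_real)
    then have "hdist a c = hdist b c - hdist a b" by simp
    then have "cosh (hdist a c) = cosh (hdist b c) * cosh (hdist a b) - sinh (hdist b c) * sinh (hdist a b)"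
      by (simp only: cosh_diff)
    then have "hangle b a c = arccos 1"
      using s unfolding hangle_def hdist_commute[of b a] by (simp add: mult.commute)
    then show False using B by simp
  qed
qed

text \<open>With its apex at 0 the triangle is a union of radial segments ending on the opposite
  side. The function \<open>?g\<close> changes sign along that connected side, so some point of the
  side is parallel to \<open>d\<close>; the cone coordinates then show that it is a positive
  multiple of \<open>d\<close>.\<close>

lemma hyperbolic_triangle_near_apex:
  assumes b: "b \<in> hdisk" and c: "c \<in> hdisk" and nd: "cross b c \<noteq> 0"
    and d: "d \<in> cone2 b c"
  shows "\<exists>t>0. \<forall>s\<in>{0..t}. s *\<^sub>R d \<in> (\<Union>x\<in>hseg b c. closed_segment 0 x)"
proof (cases "d = 0")
  case True
  then show ?thesis using hseg_ends[OF b c] by (intro exI[of _ 1]) auto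
next
  case False
  let ?g = "\<lambda>x. cross b c * cross d x"
  have "connected (?g ` hseg b c)"
    unfolding cross_def by (intro connected_continuous_image connected_hseg b c continuous_intros)
  moreover have "?g b \<in> ?g ` hseg b c" "?g c \<in> ?g ` hseg b c" using hseg_ends[OF b c] by auto
  moreover have "?g b \<le> 0" "0 \<le> ?g c"
    using d cone2_iff[OF nd] cross_commute[of d b] by auto
  ultimately have "0 \<in> ?g ` hseg b c" by (meson connectedD_interval)
  then obtain x where x: "x \<in> hseg b c" "cross d x = 0" using nd by auto
  have "Im (x / d) = 0" using x by (simp add: Im_divide_cross)
  define r where "r = Re (x / d)"
  have "x / d = of_real r" using \<open>Im (x / d) = 0\<close> by (simp add: complex_eq_iff r_def)
  then have xr: "x = r *\<^sub>R d" using False by (simp add: scaleR_conv_of_real field_simps)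
  obtain s t where st: "0 \<le> s" "0 \<le> t" "0 < s + t" "x = s *\<^sub>R b + t *\<^sub>R c"
    using hseg_in_cone[OF b c x(1)] .
  obtain s' t' where st': "0 \<le> s'" "0 \<le> t'" "d = s' *\<^sub>R b + t' *\<^sub>R c"
    using d by (auto simp: cone2_def)
  have "cross b x = t * cross b c" "cross b x = r * t' * cross b c"
    "cross x c = s * cross b c" "cross x c = r * s' * cross b c"
    by (simp add: st(4) cross_add cross_scaleR, simp add: xr st'(3) cross_add cross_scaleR,
        simp add: st(4) cross_add cross_scaleR, simp add: xr st'(3) cross_add cross_scaleR)
  then have "t = r * t'" "s = r * s'" using nd by auto
  then have "0 < r" using st st' by (metis add_nonneg_nonneg distrib_left mult_nonpos_nonneg not_le)
  moreover have "q *\<^sub>R d \<in> closed_segment 0 x" if "q \<in> {0..r}" for q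
    unfolding closed_segment_def using that \<open>0 < r\<close>
    by (intro CollectI exI[of _ "q / r"]) (simp add: xr)
  ultimately show ?thesis using x by blast
qed

lemma hyperbolic_triangle_in_cone:
  assumes "b \<in> hdisk" "c \<in> hdisk" "y \<in> (\<Union>x\<in>hseg b c. closed_segment 0 x)"
  shows "y \<in> cone2 b c"
proof -
  obtain x where x: "x \<in> hseg b c" "y \<in> closed_segment 0 x" using assms by blast
  obtain s t where st: "0 \<le> s" "0 \<le> t" "x = s *\<^sub>R b + t *\<^sub>R c"
    using hseg_in_cone[OF assms(1,2) x(1)] by metis
  obtain u where u: "0 \<le> u" "y = u *\<^sub>R x" using x(2) by (auto simp: closed_segment_def)
  have "y = (u * s) *\<^sub>R b + (u * t) *\<^sub>R c" by (simp add: u st(3) scaleR_add_right)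
  moreover have "0 \<le> u * s" "0 \<le> u * t" using st u by auto
  ultimately show ?thesis unfolding cone2_def by blast
qed

lemma csimplex_Int:
  assumes "finite f" "finite g" "x \<in> csimplex f" "x \<in> csimplex g"
  shows "x \<in> csimplex (f \<inter> g)"
proof -
  have "sum x (f \<inter> g) = sum x f"
    by (rule sum.mono_neutral_left) (use assms in \<open>auto simp: csimplex_def\<close>)
  then show ?thesis using assms by (auto simp: csimplex_def)
qed

lemma vpt_in_csimplex: "finite s \<Longrightarrow> i \<in> s \<Longrightarrow> vpt i \<in> csimplex s"
  by (auto simp: csimplex_def vpt_def)

lemma csimplex_singleton: "csimplex {i} = {vpt i}"
  by (force simp: csimplex_def vpt_def)

text \<open>Ordered pairs: every face at \<open>i\<close> occurs twice, as (j, k) and as (k, j). An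
  orientation is chosen only later, through the sign of \<open>cross\<close>.\<close>

definition link :: "'v set set \<Rightarrow> 'v \<Rightarrow> ('v \<times> 'v) set" where
  "link F i = {(j, k). {i, j, k} \<in> F}"

locale geodesic_triangulation =
  fixes F :: "'v set set" and \<phi> :: "('v \<Rightarrow> real) \<Rightarrow> complex"
  assumes card3: "\<And>f. f \<in> F \<Longrightarrow> card f = 3"
    and finite_star: "\<And>v. finite {f\<in>F. v \<in> f}"
    and geo: "geodesic_mapping F \<phi>"
    and homeo: "\<exists>g. homeomorphism (polyhedron F) hdisk \<phi> g"
    and hangle_pos: "\<And>i j k. {i, j, k} \<in> F \<Longrightarrow>
          0 < hangle (\<phi> (vpt i)) (\<phi> (vpt j)) (\<phi> (vpt k))"
begin

abbreviation pos :: "'v \<Rightarrow> complex" where "pos i \<equiv> \<phi> (vpt i)"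

lemma finite_face: "f \<in> F \<Longrightarrow> finite f"
  using card3[of f] by (metis card.infinite zero_neq_numeral)

lemma face_distinct: "{i, j, k} \<in> F \<Longrightarrow> i \<noteq> j \<and> i \<noteq> k \<and> j \<noteq> k"
  using card3[of "{i, j, k}"] by (auto simp: card_insert_if split: if_splits)

lemma face_edge: "{i, j, k} \<in> F \<Longrightarrow> {i, j} \<in> edges F"
  using face_distinct[of i j k] by (auto simp: edges_def card_insert_if)

lemma face_through: "f \<in> F \<Longrightarrow> i \<in> f \<Longrightarrow> \<exists>j k. f = {i, j, k}"
proof -
  assume f: "f \<in> F" "i \<in> f"
  then have "card (f - {i}) = 2" using card3[OF f(1)] finite_face[OF f(1)] by simp
  then obtain j k where "f - {i} = {j, k}" by (auto simp: card_2_iff)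
  then have "f = {i, j, k}" using f by blast
  then show ?thesis by blast
qed

lemma edge_face: "{i, j} \<in> edges F \<Longrightarrow> \<exists>k. {i, j, k} \<in> F"
proof -
  assume "{i, j} \<in> edges F"
  then obtain f where f: "card {i, j} = 2" "f \<in> F" "i \<in> f" "j \<in> f" by (auto simp: edges_def)
  obtain a b where ab: "f = {i, a, b}" using face_through[OF f(2,3)] by blast
  have "i \<noteq> j" using f(1) by auto
  then have "f = {i, j, b} \<or> f = {i, j, a}" using f ab by auto
  then show ?thesis using f(2) by blast
qed

lemma fst_link: "fst ` link F i = {j. {i, j} \<in> edges F}"
proof (intro equalityI subsetI)
  fix j assume "j \<in> fst ` link F i"
  then obtain k where "{i, j, k} \<in> F" by (auto simp: link_def)
  then show "j \<in> {j. {i, j} \<in> edges F}" using face_edge by simp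
next
  fix j assume "j \<in> {j. {i, j} \<in> edges F}"
  then obtain k where "{i, j, k} \<in> F" using edge_face by auto
  then have "(j, k) \<in> link F i" by (simp add: link_def)
  then show "j \<in> fst ` link F i" by (rule rev_image_eqI) simp
qed

lemma finite_link: "finite (link F i)"
proof -
  have "link F i \<subseteq> \<Union> {f \<in> F. i \<in> f} \<times> \<Union> {f \<in> F. i \<in> f}"
    by (auto simp: link_def)
  moreover have "finite (\<Union> {f \<in> F. i \<in> f})" using finite_star[of i] finite_face by auto
  ultimately show ?thesis by (meson finite_SigmaI finite_subset)
qed

lemma vpt_polyhedron: "f \<in> F \<Longrightarrow> i \<in> f \<Longrightarrow> vpt i \<in> polyhedron F"
  unfolding polyhedron_def by (rule UN_I, assumption, rule vpt_in_csimplex[OF finite_face])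

lemma image_polyhedron: "\<phi> ` polyhedron F = hdisk"
  using homeo by (auto simp: homeomorphism_def)

lemma inj_phi: "inj_on \<phi> (polyhedron F)"
  using homeo by (auto simp: homeomorphism_def intro: inj_on_inverseI)

lemma pos_hdisk: "f \<in> F \<Longrightarrow> i \<in> f \<Longrightarrow> pos i \<in> hdisk"
  using vpt_polyhedron image_polyhedron by blast

lemma vpt_eq_iff: "vpt i = vpt j \<longleftrightarrow> i = j"
  by (auto simp: vpt_def fun_eq_iff)

lemma pos_eq_iff:
  assumes "i \<in> \<Union> F" "j \<in> \<Union> F"
  shows "pos i = pos j \<longleftrightarrow> i = j"
proof -
  have "vpt i \<in> polyhedron F" "vpt j \<in> polyhedron F" using assms vpt_polyhedron by auto
  then have "pos i = pos j \<longleftrightarrow> (vpt i :: 'v \<Rightarrow> real) = vpt j" by (rule inj_on_eq_iff[OF inj_phi])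
  then show ?thesis by (simp add: vpt_eq_iff)
qed

lemma cross_link_nonzero:
  assumes "(j, k) \<in> link F i"
  shows "cross (mob_to0 (pos i) (pos j)) (mob_to0 (pos i) (pos k)) \<noteq> 0"
proof (rule cross_nonzero_of_hangle_pos)
  have f: "{i, j, k} \<in> F" using assms by (simp add: link_def)
  have inF: "i \<in> \<Union> F" "j \<in> \<Union> F" "k \<in> \<Union> F" using f by blast+
  show "pos i \<in> hdisk" "pos j \<in> hdisk" "pos k \<in> hdisk" using pos_hdisk[OF f] by auto
  show "pos j \<noteq> pos i" "pos k \<noteq> pos i" "pos j \<noteq> pos k"
    using face_distinct[OF f] pos_eq_iff[OF inF(2,1)] pos_eq_iff[OF inF(3,1)] pos_eq_iff[OF inF(2,3)] by auto
  show "0 < hangle (pos i) (pos j) (pos k)" using hangle_pos[OF f] .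
  have "{j, i, k} \<in> F" using f by (simp add: insert_commute)
  then show "0 < hangle (pos j) (pos i) (pos k)" by (rule hangle_pos)
qed

text \<open>The images of the faces at \<open>i\<close>, moved to the origin, form a fan. They cover
  all directions because the homeomorphism maps the open star of \<open>i\<close> to an open set;
  they overlap only along spokes because it is injective and two faces meet in a common
  face.\<close>

lemma star_permutation:
  fixes i :: 'v
  assumes iF: "i \<in> \<Union> F"
  obtains \<sigma> where "bij_betw \<sigma> (fst ` link F i) (fst ` link F i)"
    "\<And>j. j \<in> fst ` link F i \<Longrightarrow> (j, \<sigma> j) \<in> link F i
       \<and> 0 < cross (mob_to0 (pos i) (pos j)) (mob_to0 (pos i) (pos (\<sigma> j)))"
    "\<And>j k. (j, k) \<in> link F i \<Longrightarrow> 0 < cross (mob_to0 (pos i) (pos j)) (mob_to0 (pos i) (pos k)) \<Longrightarrow> k = \<sigma> j"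
    "(\<Sum>j\<in>fst ` link F i. Arg (mob_to0 (pos i) (pos (\<sigma> j)) / mob_to0 (pos i) (pos j))) = 2 * pi"
proof -
  define a where "a = pos i"
  define \<zeta> where "\<zeta> = (\<lambda>j. mob_to0 a (pos j))"
  define m where "m = (\<lambda>x. mob_to0 a (\<phi> x))"
  let ?N = "link F i"
  have a: "a \<in> hdisk" using iF pos_hdisk by (auto simp: a_def)
  have sym: "(k, j) \<in> ?N" if "(j, k) \<in> ?N" for j k
    using that by (simp add: link_def insert_commute)
  have nd: "cross (\<zeta> j) (\<zeta> k) \<noteq> 0" if "(j, k) \<in> ?N" for j k
    using cross_link_nonzero[OF that] by (simp add: \<zeta>_def a_def)
  have zd: "\<zeta> j \<in> hdisk" "\<zeta> k \<in> hdisk" if "(j, k) \<in> ?N" for j k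
    using that a pos_hdisk[of "{i, j, k}"] by (auto simp: \<zeta>_def link_def intro!: mob_in_hdisk)
  have inj_m: "inj_on m (polyhedron F)"
    using comp_inj_on[OF inj_phi] inj_on_mob[OF a] image_polyhedron by (simp add: m_def comp_def)
  have seg: "m ` csimplex {i, j} = closed_segment 0 (\<zeta> j)" if jk: "(j, k) \<in> ?N" for j k
  proof -
    have f: "{i, j, k} \<in> F" using jk by (simp add: link_def)
    have "m ` csimplex {i, j} = mob_to0 a ` hseg a (pos j)"
      using geo face_edge[OF f] unfolding geodesic_mapping_def m_def a_def image_image[symmetric, of "mob_to0 (pos i)" \<phi>] by simp
    also have "\<dots> = closed_segment 0 (\<zeta> j)"
      using a pos_hdisk[OF f] zd[OF jk] by (simp add: hseg_mob hseg_0 \<zeta>_def)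
    finally show ?thesis .
  qed
  have tri: "m ` csimplex {i, j, k} = (\<Union>x\<in>hseg (\<zeta> j) (\<zeta> k). closed_segment 0 x)" if jk: "(j, k) \<in> ?N" for j k
  proof -
    have f: "{i, j, k} \<in> F" using jk by (simp add: link_def)
    have "m ` csimplex {i, j, k} = mob_to0 a ` htri a (pos j) (pos k)"
      using geo f unfolding geodesic_mapping_def m_def a_def image_image[symmetric, of "mob_to0 (pos i)" \<phi>] by simp
    also have "\<dots> = (\<Union>x\<in>hseg (pos j) (pos k). mob_to0 a ` hseg a x)"
      by (simp add: htri_def image_UN)
    also have "\<dots> = (\<Union>x\<in>hseg (pos j) (pos k). closed_segment 0 (mob_to0 a x))"
      using a by (intro SUP_cong refl) (auto simp: hseg_mob hseg_0 mob_in_hdisk hseg_def[of "pos j"])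
    also have "\<dots> = (\<Union>x\<in>mob_to0 a ` hseg (pos j) (pos k). closed_segment 0 x)" by simp
    also have "mob_to0 a ` hseg (pos j) (pos k) = hseg (\<zeta> j) (\<zeta> k)"
      using a pos_hdisk[OF f] by (simp add: hseg_mob \<zeta>_def)
    finally show ?thesis .
  qed
  have m0: "m (vpt i) = 0" by (simp add: m_def a_def)
  have cov: "\<exists>(j, k)\<in>?N. d \<in> cone2 (\<zeta> j) (\<zeta> k)" for d
  proof -
    \<comment> \<open>The open star of vertex \<open>i\<close>, described by a positive barycentric
      coordinate; its image contains a ball around the origin.\<close>
    define U where "U = {x \<in> polyhedron F. 0 < x i}"
    have "open {x :: 'v \<Rightarrow> real. 0 < x i}" by (intro open_Collect_less continuous_intros) auto
    moreover have "U = polyhedron F \<inter> {x. 0 < x i}" by (auto simp: U_def)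
    ultimately have "openin (top_of_set (polyhedron F)) U" by (simp only: openin_open_Int)
    then have "openin (top_of_set hdisk) (\<phi> ` U)"
      using homeo homeomorphism_imp_open_map by blast
    then have oU: "open (\<phi> ` U)" by (simp add: hdisk_def openin_open_eq)
    have "m ` U = mob_to0 (- a) -` (\<phi> ` U) \<inter> hdisk"
    proof (intro equalityI subsetI)
      fix y assume "y \<in> m ` U"
      then obtain x where x: "x \<in> U" "y = mob_to0 a (\<phi> x)" by (auto simp: m_def)
      then have "\<phi> x \<in> hdisk" using image_polyhedron by (auto simp: U_def)
      then show "y \<in> mob_to0 (- a) -` (\<phi> ` U) \<inter> hdisk"
        using x a by (auto simp: mob_inverse mob_in_hdisk)
    next
      fix y assume y: "y \<in> mob_to0 (- a) -` (\<phi> ` U) \<inter> hdisk"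
      then obtain x where x: "x \<in> U" "mob_to0 (- a) y = \<phi> x" by auto
      then have "y = m x" using mob_inverse'[OF a, of y] y by (simp add: m_def)
      then show "y \<in> m ` U" using x by blast
    qed
    moreover have "open (mob_to0 (- a) -` (\<phi> ` U) \<inter> hdisk)"
      using continuous_on_open_vimage[of hdisk "mob_to0 (- a)"] continuous_on_mob[of "- a"] oU a
      by (simp add: hdisk_def)
    ultimately have "open (m ` U)" by simp
    moreover have "vpt i \<in> U" using iF vpt_polyhedron by (auto simp: U_def vpt_def)
    then have "0 \<in> m ` U" using m0 by force
    ultimately obtain \<eta> where \<eta>: "\<eta> > 0" "ball 0 \<eta> \<subseteq> m ` U" by (auto simp: open_contains_ball)
    define t where "t = \<eta> / (norm d + 1)"
    have t: "0 < t" "norm (t *\<^sub>R d) < \<eta>" using \<eta>(1)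
      by (auto simp: t_def field_simps add_pos_nonneg)
    then have "t *\<^sub>R d \<in> m ` U" using \<eta>(2) by (simp add: subset_iff)
    then obtain x where x: "x \<in> U" "t *\<^sub>R d = m x" by (rule imageE)
    then obtain f where f: "f \<in> F" "x \<in> csimplex f" "0 < x i" by (auto simp: U_def polyhedron_def)
    then have "i \<in> f" by (force simp: csimplex_def)
    then obtain j k where jk: "f = {i, j, k}" using face_through[OF f(1)] by blast
    then have N: "(j, k) \<in> ?N" using f by (simp add: link_def)
    then have "t *\<^sub>R d \<in> cone2 (\<zeta> j) (\<zeta> k)"
      using tri[OF N] x f jk hyperbolic_triangle_in_cone[OF zd[OF N]] by blast
    then have "d \<in> cone2 (\<zeta> j) (\<zeta> k)"
      using cone2_scaleR[of "1 / t" "t *\<^sub>R d"] t(1) by simp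
    then show ?thesis using N by blast
  qed
  have sep: "\<exists>l\<in>{j, k} \<inter> {j', k'}. \<exists>t>0. d = t *\<^sub>R \<zeta> l"
    if N: "(j, k) \<in> ?N" "(j', k') \<in> ?N" and ne: "{j, k} \<noteq> {j', k'}"
      and d: "d \<in> cone2 (\<zeta> j) (\<zeta> k)" "d \<in> cone2 (\<zeta> j') (\<zeta> k')" "d \<noteq> 0" for j k j' k' d
  proof -
    have f: "{i, j, k} \<in> F" "{i, j', k'} \<in> F" using N by (auto simp: link_def)
    \<comment> \<open>Near the apex a geodesic triangle fills its whole cone, so a small multiple of
      \<open>d\<close> lies in the images of both faces.\<close>
    obtain t t' where t: "0 < t" "\<forall>s\<in>{0..t}. s *\<^sub>R d \<in> m ` csimplex {i, j, k}"
      "0 < t'" "\<forall>s\<in>{0..t'}. s *\<^sub>R d \<in> m ` csimplex {i, j', k'}"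
      using hyperbolic_triangle_near_apex[OF zd[OF N(1)] nd[OF N(1)] d(1)]
        hyperbolic_triangle_near_apex[OF zd[OF N(2)] nd[OF N(2)] d(2)] tri N by metis
    define s where "s = min t t'"
    have s: "0 < s" using t by (simp add: s_def)
    have "s *\<^sub>R d \<in> m ` csimplex {i, j, k}" "s *\<^sub>R d \<in> m ` csimplex {i, j', k'}"
      using t by (auto simp: s_def)
    then obtain x x' where x: "x \<in> csimplex {i, j, k}" "s *\<^sub>R d = m x"
      "x' \<in> csimplex {i, j', k'}" "s *\<^sub>R d = m x'" by auto
    moreover have "x \<in> polyhedron F" "x' \<in> polyhedron F"
      using x f by (auto simp: polyhedron_def)
    ultimately have "x = x'" using inj_onD[OF inj_m] by metis
    then have xI: "x \<in> csimplex ({i, j, k} \<inter> {i, j', k'})"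
      using x by (intro csimplex_Int) auto
    have "{j, k} \<inter> {j', k'} \<noteq> {}"
    proof
      assume "{j, k} \<inter> {j', k'} = {}"
      then have "{i, j, k} \<inter> {i, j', k'} = {i}" by auto
      then have "x \<in> csimplex {i}" using xI by (simp only:)
      then have "x = vpt i" by (simp add: csimplex_singleton)
      then show False using x m0 s d by simp
    qed
    then obtain l where l: "l \<in> {j, k} \<inter> {j', k'}" by auto
    have "{j, k} \<inter> {j', k'} = {l}"
      using l ne face_distinct[OF f(1)] face_distinct[OF f(2)] by auto
    then have "{i, j, k} \<inter> {i, j', k'} = {i, l}" by auto
    then have "x \<in> csimplex {i, l}" using xI by (simp only:)
    then have "s *\<^sub>R d \<in> m ` csimplex {i, l}" unfolding x(2) by (rule imageI)
    moreover have "\<exists>n. (l, n) \<in> ?N" using l N sym by blast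
    ultimately have "s *\<^sub>R d \<in> closed_segment 0 (\<zeta> l)" using seg by blast
    then obtain u where u: "0 \<le> u" "s *\<^sub>R d = u *\<^sub>R \<zeta> l" by (auto simp: closed_segment_def)
    then have "(1 / s) *\<^sub>R (s *\<^sub>R d) = (1 / s) *\<^sub>R (u *\<^sub>R \<zeta> l)" by simp
    then have "d = (u / s) *\<^sub>R \<zeta> l" using s by simp
    moreover have "u \<noteq> 0" using u s d by auto
    then have "0 < u / s" using u s by simp
    ultimately show ?thesis using l by blast
  qed
  show ?thesis
    by (rule fan_permutation[of ?N \<zeta>, OF finite_link sym nd cov sep])
      (use that in \<open>auto simp: \<zeta>_def a_def\<close>)
qed

end

section \<open>Convex links and inversion\<close>

text \<open>The two terms are \<open>cmod q\<close> times the cosines of the angles at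
  \<open>q\<close> between the direction to the origin and the two sides. At a convex corner the
  direction to the origin is a combination of the unit side vectors \<open>\<alpha>\<close> and
  \<open>\<beta>\<close> with positive coefficients, so its inner product with
  \<open>\<alpha> + \<beta>\<close> is nonnegative.\<close>

lemma convex_corner:
  assumes "0 < cross p q" "0 < cross q s" "0 \<le> cross (q - p) (s - q)"
  shows "0 \<le> (q \<bullet> (q - p)) / cmod (q - p) + (q \<bullet> (q - s)) / cmod (q - s)"
proof -
  have ne: "q - p \<noteq> 0" "q - s \<noteq> 0" using assms by auto
  define \<alpha> \<beta> where "\<alpha> = (1 / cmod (q - p)) *\<^sub>R (p - q)" and "\<beta> = (1 / cmod (q - s)) *\<^sub>R (s - q)"
  have unit: "cmod \<alpha> = 1" "cmod \<beta> = 1"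
    using ne by (simp_all add: \<alpha>_def \<beta>_def norm_minus_commute)
  have goal: "(q \<bullet> (q - p)) / cmod (q - p) + (q \<bullet> (q - s)) / cmod (q - s) = - q \<bullet> (\<alpha> + \<beta>)"
    by (simp add: \<alpha>_def \<beta>_def inner_add_right inner_diff_right diff_divide_distrib)
  have c: "0 < cross (- q) \<alpha>" "0 < cross \<beta> (- q)" "0 \<le> cross \<beta> \<alpha>"
  proof -
    have "cross (- q) \<alpha> = cross p q / cmod (q - p)" "cross \<beta> (- q) = cross q s / cmod (q - s)"
      using cross_commute[of p q] cross_commute[of s q]
      by (simp_all add: \<alpha>_def \<beta>_def cross_scaleR cross_minus cross_diff)
    then show "0 < cross (- q) \<alpha>" "0 < cross \<beta> (- q)" using ne assms by simp_all
    have "cross (s - q) (p - q) = cross (q - p) (s - q)"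
      using cross_commute[of p s] cross_commute[of p q] cross_commute[of q s] by (simp add: cross_diff)
    then show "0 \<le> cross \<beta> \<alpha>" using assms by (simp add: \<alpha>_def \<beta>_def cross_scaleR)
  qed
  have ab: "-1 \<le> \<alpha> \<bullet> \<beta>" using Cauchy_Schwarz_ineq2[of \<alpha> \<beta>] unit by simp
  have aa: "\<alpha> \<bullet> \<alpha> = 1" "\<beta> \<bullet> \<beta> = 1" using unit by (simp_all add: dot_square_norm)
  have "cross \<beta> \<alpha> * (- q \<bullet> (\<alpha> + \<beta>)) = (cross \<beta> \<alpha> *\<^sub>R - q) \<bullet> (\<alpha> + \<beta>)" by simp
  also have "cross \<beta> \<alpha> *\<^sub>R - q = cross (- q) \<alpha> *\<^sub>R \<beta> + cross \<beta> (- q) *\<^sub>R \<alpha>" by (rule cross_swap_coords)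
  also have "\<dots> \<bullet> (\<alpha> + \<beta>) = (cross (- q) \<alpha> + cross \<beta> (- q)) * (1 + \<alpha> \<bullet> \<beta>)"
    by (simp add: inner_add aa inner_commute algebra_simps)
  finally have prod: "cross \<beta> \<alpha> * (- q \<bullet> (\<alpha> + \<beta>)) = (cross (- q) \<alpha> + cross \<beta> (- q)) * (1 + \<alpha> \<bullet> \<beta>)" .
  show ?thesis
  proof (cases "cross \<beta> \<alpha> = 0")
    case False
    then have "0 < cross \<beta> \<alpha>" using c by simp
    moreover have "0 \<le> cross \<beta> \<alpha> * (- q \<bullet> (\<alpha> + \<beta>))" unfolding prod using c ab by simp
    ultimately show ?thesis unfolding goal by (meson mult_pos_neg not_le)
  next
    \<comment> \<open>Parallel unit vectors: \<open>\<alpha> = \<beta>\<close> contradicts the signs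
      in \<open>c\<close>, so the corner is straight and the two cosines cancel.\<close>
    case True
    have "(\<beta> \<bullet> \<alpha>)\<^sup>2 = 1" using cross_inner_Pythagoras[of \<beta> \<alpha>] True unit by simp
    then have "\<beta> \<bullet> \<alpha> = 1 \<or> \<beta> \<bullet> \<alpha> = -1" by (simp add: power2_eq_1_iff)
    moreover have "\<beta> \<bullet> \<alpha> \<noteq> 1"
    proof
      assume "\<beta> \<bullet> \<alpha> = 1"
      then have "(\<beta> - \<alpha>) \<bullet> (\<beta> - \<alpha>) = 0" by (simp add: inner_diff aa inner_commute)
      then have "\<beta> = \<alpha>" by simp
      then show False using c cross_commute[of \<alpha> "- q"] by simp
    qed
    ultimately have "(\<beta> + \<alpha>) \<bullet> (\<beta> + \<alpha>) = 0" by (auto simp: inner_add aa inner_commute)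
    then have "\<alpha> + \<beta> = 0" by (simp add: add.commute)
    then show ?thesis unfolding goal by simp
  qed
qed

lemma inner_diff_norm: "(cmod q)\<^sup>2 - (cmod p)\<^sup>2 + (cmod (q - p))\<^sup>2 = 2 * (q \<bullet> (q - p))"
  unfolding power2_norm_eq_inner by (simp add: inner_diff inner_commute)

lemma inner_add_norm: "(cmod p)\<^sup>2 + (cmod q)\<^sup>2 - (cmod (q - p))\<^sup>2 = 2 * (p \<bullet> q)"
  unfolding power2_norm_eq_inner by (simp add: inner_diff inner_commute)

lemma inner_sq_less:
  assumes "cross p q \<noteq> 0"
  shows "(p \<bullet> q)\<^sup>2 < (cmod p)\<^sup>2 * (cmod q)\<^sup>2"
proof -
  have "0 < (cross p q)\<^sup>2" using assms by simp
  then show ?thesis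
    using cross_inner_Pythagoras[of p q] unfolding power_mult_distrib by linarith
qed

text \<open>The vector form of \<open>link_angle_sum_decreasing\<close>. The polygon
  \<open>Q\<close> may run in either direction, so its convexity is assumed as a condition on
  cosines, which does not see orientation; for \<open>P\<close> it follows from
  \<open>convex_corner\<close>.\<close>

lemma convex_link_not_expandable:
  fixes J :: "'v set" and P Q :: "'v \<Rightarrow> complex"
  assumes fin: "finite J" and ne: "J \<noteq> {}" and bij: "bij_betw \<sigma> J J"
    and P: "\<And>j. j \<in> J \<Longrightarrow> 0 < cross (P j) (P (\<sigma> j))"
    and delP: "\<And>j. j \<in> J \<Longrightarrow> 0 \<le> cross (P (\<sigma> j) - P j) (P (\<sigma> (\<sigma> j)) - P (\<sigma> j))"
    and Q: "\<And>j. j \<in> J \<Longrightarrow> cross (Q j) (Q (\<sigma> j)) \<noteq> 0"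
    and delQ: "\<And>j. j \<in> J \<Longrightarrow> 0 \<le> (Q (\<sigma> j) \<bullet> (Q (\<sigma> j) - Q j)) / cmod (Q (\<sigma> j) - Q j)
          + (Q (\<sigma> j) \<bullet> (Q (\<sigma> j) - Q (\<sigma> (\<sigma> j)))) / cmod (Q (\<sigma> j) - Q (\<sigma> (\<sigma> j)))"
    and \<rho>: "0 < \<rho>"
    and len: "\<And>j. j \<in> J \<Longrightarrow> cmod (Q (\<sigma> j) - Q j) = \<rho> * cmod (P (\<sigma> j) - P j)"
    and exp: "\<And>j. j \<in> J \<Longrightarrow> \<rho> * cmod (P j) < cmod (Q j)"
  shows "(\<Sum>j\<in>J. vangle0 (Q j) (Q (\<sigma> j))) < (\<Sum>j\<in>J. vangle0 (P j) (P (\<sigma> j)))"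
proof -
  define S where "S = (\<lambda>j. (\<rho> * cmod (P j))\<^sup>2)"
  define T where "T = (\<lambda>j. (cmod (Q j))\<^sup>2)"
  define e where "e = (\<lambda>j. cmod (Q (\<sigma> j) - Q j))"
  have sJ: "\<sigma> j \<in> J" if "j \<in> J" for j using bij that by (auto simp: bij_betw_def)
  have e0: "0 < e j" if "j \<in> J" for j using Q[OF that] by (auto simp: e_def)
  have P0: "0 < cmod (P j)" if "j \<in> J" for j using P[OF that] by auto
  have Se: "S j + S (\<sigma> j) - (e j)\<^sup>2 = 2 * (\<rho>\<^sup>2 * (P j \<bullet> P (\<sigma> j)))"
    "S (\<sigma> j) - S j + (e j)\<^sup>2 = 2 * (\<rho>\<^sup>2 * (P (\<sigma> j) \<bullet> (P (\<sigma> j) - P j)))"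
    "S j - S (\<sigma> j) + (e j)\<^sup>2 = 2 * (\<rho>\<^sup>2 * (P j \<bullet> (P j - P (\<sigma> j))))" if "j \<in> J" for j
    using inner_add_norm[of "P j" "P (\<sigma> j)"] inner_diff_norm[of "P (\<sigma> j)" "P j"]
      inner_diff_norm[of "P j" "P (\<sigma> j)"] norm_minus_commute[of "P j" "P (\<sigma> j)"]
    unfolding S_def e_def len[OF that] power_mult_distrib
    by (simp_all add: distrib_left[symmetric] right_diff_distrib[symmetric])
  have Te: "T j + T (\<sigma> j) - (e j)\<^sup>2 = 2 * (Q j \<bullet> Q (\<sigma> j))"
    "T (\<sigma> j) - T j + (e j)\<^sup>2 = 2 * (Q (\<sigma> j) \<bullet> (Q (\<sigma> j) - Q j))"
    "T j - T (\<sigma> j) + (e j)\<^sup>2 = 2 * (Q j \<bullet> (Q j - Q (\<sigma> j)))" for j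
    using inner_add_norm[of "Q j" "Q (\<sigma> j)"] inner_diff_norm[of "Q (\<sigma> j)" "Q j"]
      inner_diff_norm[of "Q j" "Q (\<sigma> j)"] norm_minus_commute[of "Q j" "Q (\<sigma> j)"]
    by (simp_all add: T_def e_def)
  have sS: "2 * sqrt (S j * S (\<sigma> j)) = 2 * (\<rho>\<^sup>2 * (cmod (P j) * cmod (P (\<sigma> j))))" for j
    using \<rho> by (simp add: S_def real_sqrt_mult power2_eq_square)
  have sT: "2 * sqrt (T j * T (\<sigma> j)) = 2 * (cmod (Q j) * cmod (Q (\<sigma> j)))" for j
    by (simp add: T_def real_sqrt_mult)
  have "(\<Sum>j\<in>J. arccos ((T j + T (\<sigma> j) - (e j)\<^sup>2) / (2 * sqrt (T j * T (\<sigma> j)))))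
       < (\<Sum>j\<in>J. arccos ((S j + S (\<sigma> j) - (e j)\<^sup>2) / (2 * sqrt (S j * S (\<sigma> j)))))"
  proof (rule link_angle_sum_decreasing[OF fin ne bij e0])
    show "0 < S j" if "j \<in> J" for j using P0[OF that] \<rho> by (simp add: S_def)
    show "S j < T j" if "j \<in> J" for j
      unfolding S_def T_def using exp[OF that] \<rho> by (intro power_strict_mono) auto
    show "(S j + S (\<sigma> j) - (e j)\<^sup>2)\<^sup>2 < 4 * S j * S (\<sigma> j)" if "j \<in> J" for j
    proof -
      have "(P j \<bullet> P (\<sigma> j))\<^sup>2 < (cmod (P j))\<^sup>2 * (cmod (P (\<sigma> j)))\<^sup>2"
        using P[OF that] by (intro inner_sq_less) simp
      then have "(4 * (\<rho>\<^sup>2 * \<rho>\<^sup>2)) * (P j \<bullet> P (\<sigma> j))\<^sup>2 < (4 * (\<rho>\<^sup>2 * \<rho>\<^sup>2)) * ((cmod (P j))\<^sup>2 * (cmod (P (\<sigma> j)))\<^sup>2)"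
        using \<rho> by (intro mult_strict_left_mono) auto
      then show ?thesis unfolding Se[OF that] unfolding S_def by (simp add: power2_eq_square mult_ac)
    qed
    show "(T j + T (\<sigma> j) - (e j)\<^sup>2)\<^sup>2 < 4 * T j * T (\<sigma> j)" if "j \<in> J" for j
      unfolding Te using inner_sq_less[OF Q[OF that]] by (simp add: T_def power_mult_distrib)
    show "0 \<le> (S (\<sigma> j) - S j + (e j)\<^sup>2) / e j + (S (\<sigma> j) - S (\<sigma> (\<sigma> j)) + (e (\<sigma> j))\<^sup>2) / e (\<sigma> j)"
      if j: "j \<in> J" for j
    proof -
      have c: "0 \<le> (P (\<sigma> j) \<bullet> (P (\<sigma> j) - P j)) / cmod (P (\<sigma> j) - P j)
          + (P (\<sigma> j) \<bullet> (P (\<sigma> j) - P (\<sigma> (\<sigma> j)))) / cmod (P (\<sigma> j) - P (\<sigma> (\<sigma> j)))"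
        by (rule convex_corner[OF P[OF j] P[OF sJ[OF j]] delP[OF j]])
      have "(S (\<sigma> j) - S j + (e j)\<^sup>2) / e j + (S (\<sigma> j) - S (\<sigma> (\<sigma> j)) + (e (\<sigma> j))\<^sup>2) / e (\<sigma> j)
        = 2 * \<rho> * ((P (\<sigma> j) \<bullet> (P (\<sigma> j) - P j)) / cmod (P (\<sigma> j) - P j)
          + (P (\<sigma> j) \<bullet> (P (\<sigma> j) - P (\<sigma> (\<sigma> j)))) / cmod (P (\<sigma> j) - P (\<sigma> (\<sigma> j))))"
        unfolding Se(2)[OF j] Se(3)[OF sJ[OF j]] unfolding e_def len[OF j] len[OF sJ[OF j]]
          norm_minus_commute[of "P (\<sigma> (\<sigma> j))"] using \<rho>
        by (simp add: power2_eq_square distrib_left)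
      also have "\<dots> \<ge> 0" using c \<rho> by simp
      finally show ?thesis .
    qed
    show "0 \<le> (T (\<sigma> j) - T j + (e j)\<^sup>2) / e j + (T (\<sigma> j) - T (\<sigma> (\<sigma> j)) + (e (\<sigma> j))\<^sup>2) / e (\<sigma> j)"
      if j: "j \<in> J" for j
      unfolding Te using delQ[OF j] by (simp add: e_def norm_minus_commute[of "Q (\<sigma> (\<sigma> j))"] add_divide_distrib[symmetric])
  qed
  moreover have "(T j + T (\<sigma> j) - (e j)\<^sup>2) / (2 * sqrt (T j * T (\<sigma> j))) = (Q j \<bullet> Q (\<sigma> j)) / (cmod (Q j) * cmod (Q (\<sigma> j)))" for j
    unfolding Te sT by simp
  moreover have "(S j + S (\<sigma> j) - (e j)\<^sup>2) / (2 * sqrt (S j * S (\<sigma> j))) = (P j \<bullet> P (\<sigma> j)) / (cmod (P j) * cmod (P (\<sigma> j)))" if "j \<in> J" for j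
    unfolding Se[OF that] sS using \<rho> by simp
  ultimately show ?thesis by (simp add: vangle0_def)
qed

section \<open>Inversion at a vertex\<close>

definition inversion :: "complex \<Rightarrow> complex" where
  "inversion z = (1 / (cmod z)\<^sup>2) *\<^sub>R z"

lemma cross_inversion: "cross (inversion w) (inversion z) = cross w z / ((cmod w)\<^sup>2 * (cmod z)\<^sup>2)"
  by (simp add: inversion_def cross_scaleR)

lemma norm_inversion: "cmod (inversion z) = 1 / cmod z"
  by (simp add: inversion_def power2_eq_square)

lemma inversion_eq: "inversion z = 1 / cnj z"
proof (cases "z = 0")
  case False
  have "inversion z = z / (z * cnj z)"
    unfolding inversion_def complex_norm_square[symmetric] by (simp add: scaleR_conv_of_real)
  then show ?thesis using False by simp
qed (simp add: inversion_def)

lemma norm_inversion_diff: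
  assumes "w \<noteq> 0" "z \<noteq> 0"
  shows "cmod (inversion w - inversion z) = cmod (w - z) / (cmod w * cmod z)"
proof -
  have "inversion w - inversion z = cnj (z - w) / (cnj w * cnj z)"
    using assms by (simp add: inversion_eq diff_frac_eq)
  then show ?thesis by (simp add: norm_divide norm_mult norm_minus_commute del: complex_cnj_diff)
qed

lemma vangle0_inversion: "w \<noteq> 0 \<Longrightarrow> z \<noteq> 0 \<Longrightarrow> vangle0 (inversion w) (inversion z) = vangle0 w z"
  by (simp add: vangle0_def norm_inversion) (simp add: inversion_def power2_eq_square mult.commute)

text \<open>Inversion at the first vertex turns the circumcircle into the line through the images of the two others.\<close>

lemma circumdisk_inversion:
  assumes c: "cross (mob_to0 a x) (mob_to0 a y) \<noteq> 0" and q0: "mob_to0 a q \<noteq> 0"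
    and nd: "\<not> in_open_circumdisk a x y q"
  defines "X \<equiv> inversion (mob_to0 a x)" and "Y \<equiv> inversion (mob_to0 a y)" and "Z \<equiv> inversion (mob_to0 a q)"
  shows "0 \<le> cross (Y - X) (Z - X) * cross X Y"
proof -
  define \<xi> \<eta> \<zeta> where "\<xi> = mob_to0 a x" and "\<eta> = mob_to0 a y" and "\<zeta> = mob_to0 a q"
  have nz: "\<xi> \<noteq> 0" "\<eta> \<noteq> 0" "\<zeta> \<noteq> 0" using c q0 by (auto simp: \<xi>_def \<eta>_def \<zeta>_def)
  have cXY: "cross X Y \<noteq> 0" using c nz by (simp add: X_def Y_def cross_inversion \<xi>_def \<eta>_def)
  \<comment> \<open>The centre of the circle through 0 and the two vertices. In the inverted picture
    this circle is the line of vectors with inner product 1 / 2 with \<open>ctr\<close>, and its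
    open disk is the open half plane beyond that line, which gives the two equations
    \<open>XY\<close> and the criterion \<open>on\<close>.\<close>
  define ctr where "ctr = (1 / (2 * cross X Y)) *\<^sub>R (\<i> * (X - Y))"
  have inner_i: "p \<bullet> (\<i> * w) = - cross p w" for p w
    by (simp add: inner_complex_def cross_def)
  have XY: "2 * (X \<bullet> ctr) = 1" "2 * (Y \<bullet> ctr) = 1"
    using cXY cross_commute[of X Y] by (simp_all add: ctr_def inner_i cross_diff)
  have on: "cmod (w - ctr) \<le> cmod ctr \<longleftrightarrow> 1 \<le> 2 * (inversion w \<bullet> ctr)"
    "cmod (w - ctr) < cmod ctr \<longleftrightarrow> 1 < 2 * (inversion w \<bullet> ctr)" if "w \<noteq> 0" for w
  proof -
    have "(cmod (w - ctr))\<^sup>2 = (cmod ctr)\<^sup>2 + (cmod w)\<^sup>2 * (1 - 2 * (inversion w \<bullet> ctr))"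
      using that unfolding power2_norm_eq_inner inversion_def by (simp add: inner_diff inner_commute algebra_simps)
    then have "(cmod (w - ctr))\<^sup>2 \<le> (cmod ctr)\<^sup>2 \<longleftrightarrow> 1 \<le> 2 * (inversion w \<bullet> ctr)"
      "(cmod (w - ctr))\<^sup>2 < (cmod ctr)\<^sup>2 \<longleftrightarrow> 1 < 2 * (inversion w \<bullet> ctr)"
      using that by (simp_all add: mult_le_0_iff mult_less_0_iff)
    then show "cmod (w - ctr) \<le> cmod ctr \<longleftrightarrow> 1 \<le> 2 * (inversion w \<bullet> ctr)"
      "cmod (w - ctr) < cmod ctr \<longleftrightarrow> 1 < 2 * (inversion w \<bullet> ctr)"
      using abs_le_square_iff[of "cmod (w - ctr)" "cmod ctr"] abs_le_square_iff[of "cmod ctr" "cmod (w - ctr)"]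
      by (simp_all add: not_le[symmetric])
  qed
  have "cmod (\<xi> - ctr) = cmod ctr" "cmod (\<eta> - ctr) = cmod ctr"
    using on[OF nz(1)] on[OF nz(2)] XY by (auto simp: X_def Y_def \<xi>_def \<eta>_def)
  then have "\<not> cmod (\<zeta> - ctr) < cmod ctr"
    using nd unfolding in_open_circumdisk_def \<xi>_def \<eta>_def \<zeta>_def by blast
  then have Z: "0 \<le> 1 - 2 * (Z \<bullet> ctr)" using on(2)[OF nz(3)] by (simp add: Z_def \<zeta>_def)
  have "cross X Y * (2 * (Z \<bullet> ctr)) = 2 * ((cross X Y *\<^sub>R Z) \<bullet> ctr)" by simp
  also have "cross X Y *\<^sub>R Z = cross Z Y *\<^sub>R X + cross X Z *\<^sub>R Y" by (rule cross_swap_coords)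
  also have "2 * (\<dots> \<bullet> ctr) = cross Z Y * (2 * (X \<bullet> ctr)) + cross X Z * (2 * (Y \<bullet> ctr))"
    by (simp add: inner_add_left algebra_simps)
  finally have "cross X Y * (2 * (Z \<bullet> ctr)) = cross Z Y + cross X Z" by (simp add: XY)
  then have "cross (Y - X) (Z - X) = cross X Y * (1 - 2 * (Z \<bullet> ctr))"
    using cross_commute[of Y Z] cross_commute[of Y X] by (simp add: cross_diff algebra_simps)
  then have "cross (Y - X) (Z - X) * cross X Y = (cross X Y)\<^sup>2 * (1 - 2 * (Z \<bullet> ctr))"
    by (simp add: power2_eq_square)
  then show ?thesis using Z by simp
qed

section \<open>Hyperbolic trigonometry of fat triangles\<close>

definition hcos :: "complex \<Rightarrow> complex \<Rightarrow> complex \<Rightarrow> real" where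
  "hcos a b c = (mob_to0 a b \<bullet> mob_to0 a c) / (cmod (mob_to0 a b) * cmod (mob_to0 a c))"

lemma hcos_bound: "\<bar>hcos a b c\<bar> \<le> 1"
proof -
  have "\<bar>mob_to0 a b \<bullet> mob_to0 a c\<bar> \<le> cmod (mob_to0 a b) * cmod (mob_to0 a c)"
    by (rule Cauchy_Schwarz_ineq2)
  then show ?thesis unfolding hcos_def abs_divide abs_mult abs_norm_cancel
    by (simp add: divide_le_eq)
qed

lemma hangle_eq_arccos_hcos:
  "a \<in> hdisk \<Longrightarrow> b \<in> hdisk \<Longrightarrow> c \<in> hdisk \<Longrightarrow> b \<noteq> a \<Longrightarrow> c \<noteq> a \<Longrightarrow> hangle a b c = arccos (hcos a b c)"
  by (simp add: hangle_eq_vangle0 vangle0_def hcos_def)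

text \<open>Two angles of a nondegenerate hyperbolic triangle add up to less than \<pi>. The proof
  uses the identity sinh(x + y)(cosh l - cosh(x - y)) = sinh l sinh x sinh y (cos \<alpha> + cos
  \<beta>), whose left side is positive because the third angle is.\<close>

lemma hcos_sum_pos:
  assumes d: "a \<in> hdisk" "b \<in> hdisk" "c \<in> hdisk" and ne: "a \<noteq> b" "a \<noteq> c" "b \<noteq> c"
    and pos: "0 < hangle c a b"
  shows "0 < hcos a b c + hcos b a c"
proof -
  define l x y where "l = hdist a b" and "x = hdist a c" and "y = hdist b c"
  have sp: "0 < sinh l" "0 < sinh x" "0 < sinh y"
    using sinh_hdist_pos[OF d(1,2) ne(1)] sinh_hdist_pos[OF d(1,3) ne(2)] sinh_hdist_pos[OF d(2,3) ne(3)]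
    by (simp_all only: l_def x_def y_def)
  have A: "cosh l * cosh x - cosh y = sinh l * sinh x * hcos a b c"
    using law_of_cosines_hdist[OF d(1,2,3)] ne by (simp add: l_def x_def y_def hcos_def)
  have B: "cosh l * cosh y - cosh x = sinh l * sinh y * hcos b a c"
    using law_of_cosines_hdist[OF d(2,1,3)] ne by (simp add: l_def x_def y_def hcos_def hdist_commute[of b a])
  have C: "cosh x * cosh y - cosh l = sinh x * sinh y * hcos c a b"
    using law_of_cosines_hdist[OF d(3,1,2)] ne
    by (simp add: l_def x_def y_def hcos_def hdist_commute[of c])
  have "hcos c a b \<noteq> 1"
    using pos hangle_eq_arccos_hcos[OF d(3,1,2)] ne by auto
  then have "hcos c a b < 1" using hcos_bound[of c a b] by linarith
  then have "sinh x * sinh y * hcos c a b < sinh x * sinh y * 1"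
    using sp by (intro mult_strict_left_mono) auto
  then have "cosh (x - y) < cosh l" using C by (simp add: cosh_diff)
  then have "0 < sinh (x + y) * (cosh l - cosh (x - y))"
    using sp by (intro mult_pos_pos) auto
  also have "\<dots> = (cosh l * cosh x - cosh y) * sinh y + (cosh l * cosh y - cosh x) * sinh x"
  proof -
    have "sinh (x + y) * cosh (x - y) = cosh x * sinh x * ((cosh y)\<^sup>2 - (sinh y)\<^sup>2) + cosh y * sinh y * ((cosh x)\<^sup>2 - (sinh x)\<^sup>2)"
      unfolding sinh_add cosh_diff by (simp add: algebra_simps power2_eq_square)
    then have "sinh (x + y) * cosh (x - y) = cosh x * sinh x + cosh y * sinh y"
      by (simp add: hyperbolic_pythagoras)
    then show ?thesis by (simp add: right_diff_distrib) (simp add: sinh_add algebra_simps)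
  qed
  also have "\<dots> = sinh l * sinh x * sinh y * (hcos a b c + hcos b a c)"
    unfolding A B by (simp add: algebra_simps)
  finally show ?thesis
    by (rule zero_less_mult_pos) (intro mult_pos_pos sp)
qed

locale fat_triangle =
  fixes a b c :: complex and \<epsilon> :: real
  assumes d: "a \<in> hdisk" "b \<in> hdisk" "c \<in> hdisk" and ne: "a \<noteq> b" "a \<noteq> c" "b \<noteq> c"
    and eps: "0 < \<epsilon>"
    and angles: "\<epsilon> \<le> hangle a b c" "\<epsilon> \<le> hangle b a c" "\<epsilon> \<le> hangle c a b"
begin

lemma eps_le_pi: "\<epsilon> \<le> pi"
proof -
  have "hangle a b c \<le> pi" using hangle_eq_arccos_hcos[OF d] ne hcos_bound[of a b c]
    by (metis arccos_ubound abs_le_iff minus_le_iff)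
  then show ?thesis using angles by simp
qed

lemma hcos_le: "hcos a b c \<le> cos \<epsilon>" "hcos b a c \<le> cos \<epsilon>"
proof -
  have *: "h \<le> cos \<epsilon>" if "\<epsilon> \<le> arccos h" "\<bar>h\<bar> \<le> 1" for h
  proof -
    have "cos (arccos h) \<le> cos \<epsilon>"
      using that eps eps_le_pi arccos_bounded[of h] by (intro cos_monotone_0_pi_le) auto
    then show ?thesis using that by (simp add: cos_arccos_abs)
  qed
  show "hcos a b c \<le> cos \<epsilon>" "hcos b a c \<le> cos \<epsilon>"
    using angles hangle_eq_arccos_hcos[OF d(1,2,3)] hangle_eq_arccos_hcos[OF d(2,1,3)] ne hcos_bound
    by (auto intro!: *)
qed

lemma eps_less_half_pi: "\<epsilon> < pi / 2"
proof (rule ccontr)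
  assume "\<not> \<epsilon> < pi / 2"
  then have "cos \<epsilon> \<le> cos (pi / 2)" using eps_le_pi by (intro cos_monotone_0_pi_le) auto
  then show False using hcos_le hcos_sum_pos[OF d ne] angles eps by simp
qed

text \<open>The sine of the angle at \<open>a\<close> is at least sin \<epsilon> even if that angle
  is obtuse: by \<open>hcos_sum_pos\<close> its cosine exceeds minus the cosine at \<open>b\<close>,
  and the latter is at most cos \<epsilon>.\<close>

lemma cross_ge: "sin \<epsilon> * (cmod (mob_to0 a b) * cmod (mob_to0 a c)) \<le> \<bar>cross (mob_to0 a b) (mob_to0 a c)\<bar>"
proof -
  define w z where "w = mob_to0 a b" and "z = mob_to0 a c"
  have nz: "w \<noteq> 0" "z \<noteq> 0" using d ne by (auto simp: w_def z_def mob_eq_0_iff)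
  have "\<bar>hcos a b c\<bar> \<le> cos \<epsilon>" using hcos_le hcos_sum_pos[OF d ne] angles eps by linarith
  then have "(hcos a b c)\<^sup>2 \<le> (cos \<epsilon>)\<^sup>2" by (simp add: abs_le_square_iff[symmetric])
  then have 1: "(sin \<epsilon>)\<^sup>2 \<le> 1 - (hcos a b c)\<^sup>2" by (simp add: cos_squared_eq)
  have "w \<bullet> z = hcos a b c * (cmod w * cmod z)" using nz by (simp add: hcos_def w_def z_def)
  then have "(cross w z)\<^sup>2 = (1 - (hcos a b c)\<^sup>2) * (cmod w * cmod z)\<^sup>2"
    using cross_inner_Pythagoras[of w z] by (simp add: power_mult_distrib algebra_simps)
  moreover have "(sin \<epsilon>)\<^sup>2 * (cmod w * cmod z)\<^sup>2 \<le> (1 - (hcos a b c)\<^sup>2) * (cmod w * cmod z)\<^sup>2"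
    using 1 by (intro mult_right_mono) auto
  ultimately have "(sin \<epsilon> * (cmod w * cmod z))\<^sup>2 \<le> (cross w z)\<^sup>2"
    by (simp add: power_mult_distrib)
  then show ?thesis unfolding w_def z_def by (metis abs_le_D1 abs_le_square_iff)
qed

lemma sin_eps_pos: "0 < sin \<epsilon>"
  using eps eps_less_half_pi by (intro sin_gt_zero) auto

text \<open>With \<open>a\<close> at the origin, the distance from \<open>z\<close> to the line
  through 0 and \<open>w\<close> is at least \<open>sin \<epsilon> * cmod z\<close>, and it bounds
  \<open>cmod (w - z)\<close> from below. The extra factor \<open>1 - (cmod w)\<^sup>2\<close> in
  the denominator of the right side only helps.\<close>

lemma chord2_ge: "(sin \<epsilon>)\<^sup>2 * chord2 a c \<le> chord2 b c"
proof -
  define w z where "w = mob_to0 a b" and "z = mob_to0 a c"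
  have nz: "w \<noteq> 0" "z \<noteq> 0" using d ne by (auto simp: w_def z_def mob_eq_0_iff)
  have wz: "w \<in> hdisk" "z \<in> hdisk" using d by (simp_all add: w_def z_def mob_in_hdisk)
  have "sin \<epsilon> * (cmod w * cmod z) \<le> \<bar>cross w z\<bar>" using cross_ge by (simp add: w_def z_def)
  also have "cross w z = cross w (z - w)" by (simp add: cross_diff)
  also have "\<bar>\<dots>\<bar> \<le> cmod w * cmod (w - z)"
  proof -
    have "(cross w (z - w))\<^sup>2 \<le> (cmod w * cmod (z - w))\<^sup>2"
      using cross_inner_Pythagoras[of w "z - w"] zero_le_power2[of "w \<bullet> (z - w)"] by linarith
    then show ?thesis using abs_le_square_iff[of "cross w (z - w)" "cmod w * cmod (z - w)"]
      by (simp add: norm_minus_commute)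
  qed
  finally have "cmod w * (sin \<epsilon> * cmod z) \<le> cmod w * cmod (w - z)" by (simp add: mult_ac)
  then have "sin \<epsilon> * cmod z \<le> cmod (w - z)" using nz by simp
  then have le: "(sin \<epsilon>)\<^sup>2 * (cmod z)\<^sup>2 \<le> (cmod (w - z))\<^sup>2"
    unfolding power_mult_distrib[symmetric] using sin_eps_pos by (intro power_mono) auto
  have W: "0 < 1 - (cmod w)\<^sup>2" "1 - (cmod w)\<^sup>2 \<le> 1" "0 < 1 - (cmod z)\<^sup>2"
    using wz hdisk_one_minus_pos by auto
  have "chord2 a c = (cmod z)\<^sup>2 / (1 - (cmod z)\<^sup>2)"
    using chord2_mob[OF d(1,1,3)] by (simp add: chord2_0 z_def)
  then have "(sin \<epsilon>)\<^sup>2 * chord2 a c = (sin \<epsilon>)\<^sup>2 * (cmod z)\<^sup>2 / (1 - (cmod z)\<^sup>2)" by simp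
  also have "\<dots> \<le> (cmod (w - z))\<^sup>2 / (1 - (cmod z)\<^sup>2)"
    using le W by (intro divide_right_mono) auto
  also have "\<dots> \<le> (cmod (w - z))\<^sup>2 / ((1 - (cmod w)\<^sup>2) * (1 - (cmod z)\<^sup>2))"
    using W by (intro divide_left_mono) (auto intro: mult_left_le_one_le)
  also have "\<dots> = chord2 b c" using chord2_mob[OF d(1,2,3)] by (simp add: chord2_def w_def z_def)
  finally show ?thesis .
qed

end

section \<open>Elementary estimates and the metric of the inverted link\<close>

lemma sin_ge_half:
  fixes x :: real
  assumes "0 \<le> x" "x \<le> pi / 2"
  shows "x / 2 \<le> sin x"
proof (cases "x \<le> pi / 3")
  case True
  have "sin 0 - 0 / 2 \<le> sin x - x / 2"
  proof (rule DERIV_nonneg_imp_nondecreasing[OF assms(1)])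
    fix t assume t: "0 \<le> t" "t \<le> x"
    have "cos (pi / 3) \<le> cos t" using t True by (intro cos_monotone_0_pi_le) auto
    then have "0 \<le> cos t - 1 / 2" by (simp add: cos_60)
    moreover have "((\<lambda>t. sin t - t / 2) has_real_derivative cos t - 1 / 2) (at t)"
      by (auto intro!: derivative_eq_intros)
    ultimately show "\<exists>y. ((\<lambda>t. sin t - t / 2) has_real_derivative y) (at t) \<and> 0 \<le> y" by blast
  qed
  then show ?thesis by simp
next
  case False
  have "sin (pi / 3) \<le> sin x" using False assms by (intro sin_monotone_2pi_le) auto
  moreover have "(4 / 5 :: real) \<le> sin (pi / 3)"
  proof -
    have "8 / 5 \<le> sqrt 3" by (rule real_le_rsqrt) (simp add: power2_eq_square)
    then show ?thesis by (simp add: sin_60)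
  qed
  moreover have "x / 2 \<le> 4 / 5" using assms pi_less_4 pi_approx(2) by (simp add: field_simps)
  ultimately show ?thesis by linarith
qed

lemma sinh_half_le:
  fixes x :: real
  assumes "0 \<le> x" "x \<le> 1"
  shows "sinh (x / 2) \<le> x"
proof -
  have "exp (x / 2) \<le> 1 + x / 2 + (x / 2)\<^sup>2" using assms by (intro exp_bound) auto
  moreover have "1 - x / 2 \<le> exp (- (x / 2))" using exp_ge_add_one_self[of "- (x / 2)"] by simp
  moreover have "(x / 2)\<^sup>2 \<le> x / 2"
    unfolding power2_eq_square using assms by (intro mult_left_le) auto
  ultimately show ?thesis unfolding sinh_field_def using assms by simp
qed

text \<open>The identity coth^2 = 1 + 1 / sinh^2 at half the distance. The summand 1 does not scale
  with the conformal factor; this is what makes the comparison of radii in the maximum principle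
  strict.\<close>

lemma inverse_norm_mob:
  assumes "a \<in> hdisk" "z \<in> hdisk" "z \<noteq> a"
  shows "(1 / cmod (mob_to0 a z))\<^sup>2 = 1 + 1 / chord2 a z"
proof -
  define m where "m = (cmod (mob_to0 a z))\<^sup>2"
  have m: "0 < m" "m < 1"
    using assms hdisk_one_minus_pos[OF mob_in_hdisk[OF assms(1,2)]] by (auto simp: m_def mob_eq_0_iff)
  have "chord2 a z = m / (1 - m)"
    using chord2_mob[OF assms(1,1,2)] by (simp add: chord2_0 m_def)
  then show ?thesis using m by (simp add: power_divide m_def[symmetric]) (simp add: field_simps)
qed

text \<open>Under a conformal change the vertex factors of \<open>b\<close> and \<open>c\<close>
  cancel in this quotient. All sides of the inverted link are therefore scaled by one constant that
  depends only on the factor at the apex \<open>a\<close>.\<close>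

lemma norm_inversion_diff_chord2:
  assumes "a \<in> hdisk" "b \<in> hdisk" "c \<in> hdisk" "b \<noteq> a" "c \<noteq> a"
  shows "(cmod (inversion (mob_to0 a b) - inversion (mob_to0 a c)))\<^sup>2 = chord2 b c / (chord2 a b * chord2 a c)"
proof -
  define w z where "w = mob_to0 a b" and "z = mob_to0 a c"
  have nz: "w \<noteq> 0" "z \<noteq> 0" using assms by (auto simp: w_def z_def mob_eq_0_iff)
  have wz: "0 < 1 - (cmod w)\<^sup>2" "0 < 1 - (cmod z)\<^sup>2"
    using assms by (simp_all only: w_def z_def hdisk_one_minus_pos mob_in_hdisk)
  have c: "chord2 a b = (cmod w)\<^sup>2 / (1 - (cmod w)\<^sup>2)" "chord2 a c = (cmod z)\<^sup>2 / (1 - (cmod z)\<^sup>2)"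
    "chord2 b c = (cmod (w - z))\<^sup>2 / ((1 - (cmod w)\<^sup>2) * (1 - (cmod z)\<^sup>2))"
    using chord2_mob[OF assms(1,1,2)] chord2_mob[OF assms(1,1,3)] chord2_mob[OF assms(1,2,3)]
    by (simp_all add: chord2_0 w_def z_def) (simp_all add: chord2_def)
  show ?thesis
    unfolding c w_def[symmetric] z_def[symmetric] norm_inversion_diff[OF nz]
    using nz wz by (simp add: power_divide power_mult_distrib)
qed

text \<open>Rescaling the disk by \<open>r\<close> moves the apex of the inverted link to \<open>a (r\<^sup>2 - 1) / (1 - r\<^sup>2 |a|\<^sup>2)\<close>.\<close>

lemma norm_inversion_minus_apex:
  assumes a: "a \<in> hdisk" and z: "z \<in> hdisk" and ne: "z \<noteq> a" and r: "0 < r"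
    and ra: "of_real r * a \<in> hdisk" and rz: "of_real r * z \<in> hdisk"
  shows "cmod (inversion (mob_to0 a z) - ((r\<^sup>2 - 1) / (1 - r\<^sup>2 * (cmod a)\<^sup>2)) *\<^sub>R a)
       = r * (1 - (cmod a)\<^sup>2) / (1 - r\<^sup>2 * (cmod a)\<^sup>2) * (1 / cmod (mob_to0 (of_real r * a) (of_real r * z)))"
proof -
  define D where "D = 1 - r\<^sup>2 * (cmod a)\<^sup>2"
  define \<alpha> where "\<alpha> = cnj a"
  have D: "0 < D" using hdisk_one_minus_pos[OF ra] r by (simp add: D_def norm_mult power_mult_distrib)
  have Dc: "of_real D = 1 - of_real r ^ 2 * (a * \<alpha>)"
    unfolding D_def \<alpha>_def complex_norm_square[symmetric] by simp
  have Ac: "of_real (1 - (cmod a)\<^sup>2) = 1 - a * \<alpha>"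
    unfolding \<alpha>_def complex_norm_square[symmetric] by simp
  have dz: "1 - \<alpha> * z \<noteq> 0" unfolding \<alpha>_def by (rule mob_denom_nonzero[OF a z])
  have inv: "cnj (inversion (mob_to0 a z)) = (1 - \<alpha> * z) / (z - a)"
    by (simp add: inversion_eq mob_to0_def \<alpha>_def)
  have "cnj (inversion (mob_to0 a z) - ((r\<^sup>2 - 1) / D) *\<^sub>R a)
      = (1 - \<alpha> * z) / (z - a) - (of_real r ^ 2 - 1) * \<alpha> / of_real D"
    by (simp add: inv) (simp add: \<alpha>_def scaleR_conv_of_real)
  also have "\<dots> = ((1 - \<alpha> * z) * of_real D - (of_real r ^ 2 - 1) * \<alpha> * (z - a)) / ((z - a) * of_real D)"
    using ne D by (simp add: diff_frac_eq)
  also have "(1 - \<alpha> * z) * of_real D - (of_real r ^ 2 - 1) * \<alpha> * (z - a)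
      = of_real (1 - (cmod a)\<^sup>2) * (1 - of_real r ^ 2 * \<alpha> * z)"
    unfolding Dc Ac by (simp add: algebra_simps)
  finally have "cmod (inversion (mob_to0 a z) - ((r\<^sup>2 - 1) / D) *\<^sub>R a)
      = cmod (of_real (1 - (cmod a)\<^sup>2) * (1 - of_real r ^ 2 * \<alpha> * z) / ((z - a) * of_real D))"
    by (metis complex_mod_cnj)
  also have "\<dots> = (1 - (cmod a)\<^sup>2) * cmod (1 - of_real r ^ 2 * \<alpha> * z) / (cmod (z - a) * D)"
    unfolding norm_mult norm_divide norm_of_real using D hdisk_one_minus_pos[OF a] by simp
  also have "\<dots> = r * (1 - (cmod a)\<^sup>2) / D * (1 / cmod (mob_to0 (of_real r * a) (of_real r * z)))"
  proof -
    have "mob_to0 (of_real r * a) (of_real r * z) = of_real r * (z - a) / (1 - of_real r ^ 2 * \<alpha> * z)"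
      by (simp add: mob_to0_def \<alpha>_def power2_eq_square algebra_simps)
    then have "cmod (mob_to0 (of_real r * a) (of_real r * z)) = r * cmod (z - a) / cmod (1 - of_real r ^ 2 * \<alpha> * z)"
      using r by (simp add: norm_mult norm_divide)
    moreover have "r * y / D * (1 / (r * k / X)) = y * X / (k * D)" for y X k using r by simp
    ultimately show ?thesis by (simp only:)
  qed
  finally show ?thesis unfolding D_def .
qed

section \<open>The maximum principle\<close>

context geodesic_triangulation
begin

text \<open>The last clause is the gain over \<open>star_permutation\<close>: each ordered pair of
  the link is (j, \<sigma> j) or its reverse, never both, so a symmetric sum along \<sigma> is half
  a sum over the link. It thus agrees for the permutations coming from two different maps.\<close>

lemma star_permutation_sum:
  fixes i :: 'v
  assumes iF: "i \<in> \<Union> F"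
  shows "\<exists>\<sigma>. bij_betw \<sigma> (fst ` link F i) (fst ` link F i) \<and>
    (\<forall>j\<in>fst ` link F i. (j, \<sigma> j) \<in> link F i
       \<and> 0 < cross (mob_to0 (pos i) (pos j)) (mob_to0 (pos i) (pos (\<sigma> j)))) \<and>
    (\<forall>j k. (j, k) \<in> link F i \<longrightarrow> 0 < cross (mob_to0 (pos i) (pos j)) (mob_to0 (pos i) (pos k)) \<longrightarrow> k = \<sigma> j) \<and>
    (\<Sum>j\<in>fst ` link F i. Arg (mob_to0 (pos i) (pos (\<sigma> j)) / mob_to0 (pos i) (pos j))) = 2 * pi \<and>
    (\<forall>g :: 'v \<Rightarrow> 'v \<Rightarrow> real. (\<forall>j k. g j k = g k j) \<longrightarrow>
       (\<Sum>(j, k)\<in>link F i. g j k) = 2 * (\<Sum>j\<in>fst ` link F i. g j (\<sigma> j)))"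
proof (rule star_permutation[OF iF])
  fix \<sigma>
  define c where "c = (\<lambda>j k. cross (mob_to0 (pos i) (pos j)) (mob_to0 (pos i) (pos k)))"
  assume bij: "bij_betw \<sigma> (fst ` link F i) (fst ` link F i)"
    and \<sigma>0: "\<And>j. j \<in> fst ` link F i \<Longrightarrow> (j, \<sigma> j) \<in> link F i
       \<and> 0 < cross (mob_to0 (pos i) (pos j)) (mob_to0 (pos i) (pos (\<sigma> j)))"
    and uniq0: "\<And>j k. (j, k) \<in> link F i \<Longrightarrow> 0 < cross (mob_to0 (pos i) (pos j)) (mob_to0 (pos i) (pos k)) \<Longrightarrow> k = \<sigma> j"
    and sum: "(\<Sum>j\<in>fst ` link F i. Arg (mob_to0 (pos i) (pos (\<sigma> j)) / mob_to0 (pos i) (pos j))) = 2 * pi"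
  have \<sigma>: "(j, \<sigma> j) \<in> link F i \<and> 0 < c j (\<sigma> j)" if "j \<in> fst ` link F i" for j
    using \<sigma>0[OF that] by (simp only: c_def)
  have uniq: "k = \<sigma> j" if "(j, k) \<in> link F i" "0 < c j k" for j k
    using uniq0 that by (simp only: c_def)
  let ?J = "fst ` link F i"
  have sym: "(k, j) \<in> link F i" if "(j, k) \<in> link F i" for j k
    using that by (simp add: link_def insert_commute)
  have c_swap: "c k j = - c j k" for j k by (simp add: c_def cross_commute[of "mob_to0 (pos i) (pos k)"])
  let ?A = "(\<lambda>j. (j, \<sigma> j)) ` ?J" and ?B = "(\<lambda>j. (\<sigma> j, j)) ` ?J"
  have "(j, k) \<in> ?A \<union> ?B" if jk: "(j, k) \<in> link F i" for j k
  proof (cases "0 < c j k")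
    case True
    then have "k = \<sigma> j" using uniq jk by blast
    then show ?thesis using jk by force
  next
    case False
    have "c j k \<noteq> 0" using cross_link_nonzero[OF jk] by (simp add: c_def)
    then have "j = \<sigma> k" using uniq[OF sym[OF jk]] False c_swap[of k j] by simp
    then show ?thesis using sym[OF jk] by force
  qed
  then have "link F i \<subseteq> ?A \<union> ?B" by auto
  moreover have "?A \<subseteq> link F i" "?B \<subseteq> link F i" using \<sigma> sym by blast+
  ultimately have un: "link F i = ?A \<union> ?B" by blast
  have "?A \<inter> ?B = {}"
  proof (rule ccontr)
    assume "?A \<inter> ?B \<noteq> {}"
    then obtain x where x: "x \<in> ?A" "x \<in> ?B" by blast
    from x(1) obtain j where j: "x = (j, \<sigma> j)" "j \<in> ?J" by (rule imageE)
    from x(2) obtain k where k: "x = (\<sigma> k, k)" "k \<in> ?J" by (rule imageE)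
    have "(j, \<sigma> j) = (\<sigma> k, k)" by (rule trans[OF j(1)[symmetric] k(1)])
    then have jk: "j \<in> ?J" "k \<in> ?J" "j = \<sigma> k" "\<sigma> j = k" using j(2) k(2) unfolding prod.inject by blast+
    then show False using \<sigma>[OF jk(1)] \<sigma>[OF jk(2)] c_swap[of j k] by simp
  qed
  then have "(\<Sum>x\<in>?A \<union> ?B. h x) = (\<Sum>x\<in>?A. h x) + (\<Sum>x\<in>?B. h x)" for h :: "'v \<times> 'v \<Rightarrow> real"
    by (intro sum.union_disjoint finite_imageI finite_link)
  then have "(\<Sum>(j, k)\<in>link F i. g j k) = (\<Sum>(j, k)\<in>?A. g j k) + (\<Sum>(j, k)\<in>?B. g j k)" for g :: "'v \<Rightarrow> 'v \<Rightarrow> real"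
    by (simp only: un[symmetric])
  moreover have "(\<Sum>(j, k)\<in>?A. g j k) = (\<Sum>j\<in>?J. g j (\<sigma> j))" "(\<Sum>(j, k)\<in>?B. g j k) = (\<Sum>j\<in>?J. g (\<sigma> j) j)" for g :: "'v \<Rightarrow> 'v \<Rightarrow> real"
    by (simp_all add: sum.reindex inj_on_def)
  ultimately have "(\<Sum>(j, k)\<in>link F i. g j k) = 2 * (\<Sum>j\<in>?J. g j (\<sigma> j))" if "\<And>j k. g j k = g k j" for g :: "'v \<Rightarrow> 'v \<Rightarrow> real"
    using that by (metis (no_types, lifting) mult_2 sum.cong)
  then show ?thesis using bij sum \<sigma>0 uniq0 by (intro exI[of _ \<sigma>] conjI) (blast | assumption)+
qed

text \<open>The preimage of the closed ball is compact and covered by open stars. The point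
  \<open>vpt i\<close> lies in the open star of \<open>i\<close> only, so a finite subcover must
  contain the star of every vertex in the ball.\<close>

lemma finite_vertices_in_cball:
  assumes "s < 1"
  shows "finite {i \<in> \<Union> F. cmod (pos i) \<le> s}"
proof -
  obtain g where g: "homeomorphism (polyhedron F) hdisk \<phi> g" using homeo by blast
  have sub: "cball 0 s \<subseteq> hdisk" using assms by (auto simp: hdisk_def)
  have "compact (g ` cball 0 s)"
    using g sub by (intro compact_continuous_image) (auto simp: homeomorphism_def intro: continuous_on_subset)
  moreover have "g ` cball 0 s \<subseteq> (\<Union>i\<in>\<Union> F. {x :: 'v \<Rightarrow> real. 0 < x i})"
  proof
    fix x assume "x \<in> g ` cball 0 s"
    then have "x \<in> g ` hdisk" using sub by blast
    then have "x \<in> polyhedron F" using g by (simp add: homeomorphism_def)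
    then obtain f where f: "f \<in> F" "x \<in> csimplex f" by (auto simp: polyhedron_def)
    have "\<exists>i\<in>f. 0 < x i"
    proof (rule ccontr)
      assume "\<not> ?thesis"
      then have "sum x f \<le> 0" by (intro sum_nonpos) (auto simp: not_less)
      then show False using f by (simp add: csimplex_def)
    qed
    then show "x \<in> (\<Union>i\<in>\<Union> F. {x. 0 < x i})" using f by blast
  qed
  moreover have "open {x :: 'v \<Rightarrow> real. 0 < x i}" for i
    by (intro open_Collect_less continuous_intros) auto
  ultimately obtain I where I: "finite I" "g ` cball 0 s \<subseteq> (\<Union>i\<in>I. {x. 0 < x i})"
    by (metis (no_types, lifting) compactE_image)
  have "{i \<in> \<Union> F. cmod (pos i) \<le> s} \<subseteq> I"
  proof
    fix i assume "i \<in> {i \<in> \<Union> F. cmod (pos i) \<le> s}"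
    then have i: "i \<in> \<Union> F" "pos i \<in> cball 0 s" by auto
    then have "vpt i \<in> polyhedron F" using vpt_polyhedron by blast
    then have "vpt i = g (pos i)" using g by (simp add: homeomorphism_def)
    then have "vpt i \<in> (\<Union>i\<in>I. {x. 0 < x i})" using I i by blast
    then show "i \<in> I" by (auto simp: vpt_def split: if_splits)
  qed
  then show ?thesis using I(1) by (rule finite_subset)
qed

lemma face_vertices: "{i, j, k} \<in> F \<Longrightarrow> i \<in> \<Union> F \<and> j \<in> \<Union> F \<and> k \<in> \<Union> F"
  by blast

lemma vertex_hdisk: "i \<in> \<Union> F \<Longrightarrow> pos i \<in> hdisk"
  using pos_hdisk by blast

text \<open>The Delaunay condition across the edge from \<open>i\<close> to \<open>l\<close>, after
  inversion at \<open>i\<close>: the link polygon is convex at \<open>Q l\<close>. The last factor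
  makes the statement independent of orientation.\<close>

lemma inner_corner:
  assumes del: "delaunay F \<phi>" and f: "{i, l, j} \<in> F" "{i, l, k} \<in> F" and ne: "j \<noteq> k"
  defines "Q \<equiv> (\<lambda>j. inversion (mob_to0 (pos i) (pos j)))"
  shows "0 \<le> cross (Q j - Q l) (Q k - Q l) * cross (Q l) (Q j)"
  unfolding Q_def
proof (rule circumdisk_inversion)
  show "cross (mob_to0 (pos i) (pos l)) (mob_to0 (pos i) (pos j)) \<noteq> 0"
    by (rule cross_link_nonzero) (use f in \<open>simp add: link_def\<close>)
  have "pos k \<noteq> pos i"
    using face_distinct[OF f(2)] face_vertices[OF f(2)] pos_eq_iff by blast
  then show "mob_to0 (pos i) (pos k) \<noteq> 0"
    using face_vertices[OF f(2)] vertex_hdisk by (simp add: mob_eq_0_iff)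
  show "\<not> in_open_circumdisk (pos i) (pos l) (pos j) (pos k)"
    using del f ne unfolding delaunay_def by blast
qed

end

text \<open>The smallness conditions are asymmetric: for \<phi> a coarse bound controls how the
  conformal density varies along an edge, while the sharp bound on \<psi> makes the factor small
  near the boundary. The theorem uses the locale twice, the second time with the maps exchanged and
  \<open>u\<close> negated.\<close>

locale delaunay_conformal_pair =
  A: geodesic_triangulation F \<phi> + B: geodesic_triangulation F \<psi>
  for F :: "'v set set" and \<phi> \<psi> :: "('v \<Rightarrow> real) \<Rightarrow> complex" +
  fixes u :: "'v \<Rightarrow> real" and \<epsilon> :: real
  assumes eps: "0 < \<epsilon>"
    and delA: "delaunay F \<phi>" and delB: "delaunay F \<psi>"
    and angleA: "\<And>i j k. {i, j, k} \<in> F \<Longrightarrow> \<epsilon> \<le> hangle (\<phi> (vpt i)) (\<phi> (vpt j)) (\<phi> (vpt k))"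
    and angleB: "\<And>i j k. {i, j, k} \<in> F \<Longrightarrow> \<epsilon> \<le> hangle (\<psi> (vpt i)) (\<psi> (vpt j)) (\<psi> (vpt k))"
    and conf: "\<And>i j. {i, j} \<in> edges F \<Longrightarrow>
        chord2 (\<psi> (vpt i)) (\<psi> (vpt j)) = exp (u i + u j) * chord2 (\<phi> (vpt i)) (\<phi> (vpt j))"
    and smallA: "\<And>i j. {i, j} \<in> edges F \<Longrightarrow> chord2 (\<phi> (vpt i)) (\<phi> (vpt j)) \<le> 1 / 4"
    and smallB: "\<And>i j. {i, j} \<in> edges F \<Longrightarrow> chord2 (\<psi> (vpt i)) (\<psi> (vpt j)) < (\<epsilon> ^ 3 / 8192)\<^sup>2"
begin

lemma fatA: "{i, j, k} \<in> F \<Longrightarrow> fat_triangle (A.pos i) (A.pos j) (A.pos k) \<epsilon>"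
proof -
  assume f: "{i, j, k} \<in> F"
  have f': "{j, i, k} \<in> F" "{k, i, j} \<in> F" using f by (simp_all add: insert_commute)
  show ?thesis
    using A.face_vertices[OF f] A.face_distinct[OF f] A.vertex_hdisk A.pos_eq_iff eps
      angleA[OF f] angleA[OF f'(1)] angleA[OF f'(2)]
    by unfold_locales blast+
qed

lemma fatB: "{i, j, k} \<in> F \<Longrightarrow> fat_triangle (B.pos i) (B.pos j) (B.pos k) \<epsilon>"
proof -
  assume f: "{i, j, k} \<in> F"
  have f': "{j, i, k} \<in> F" "{k, i, j} \<in> F" using f by (simp_all add: insert_commute)
  show ?thesis
    using B.face_vertices[OF f] B.face_distinct[OF f] B.vertex_hdisk B.pos_eq_iff eps
      angleB[OF f] angleB[OF f'(1)] angleB[OF f'(2)]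
    by unfold_locales blast+
qed

text \<open>The exponential of the conformal factor of \<open>\<psi>\<close> relative to the rescaled map \<open>r \<phi>\<close>.\<close>

definition scaled_factor :: "real \<Rightarrow> 'v \<Rightarrow> real" where
  "scaled_factor r i = exp (u i) * ((1 - r\<^sup>2 * (cmod (A.pos i))\<^sup>2) / (r * (1 - (cmod (A.pos i))\<^sup>2)))"

text \<open>\<open>P\<close> and \<open>Q\<close> are the inverted links of \<phi> and \<psi>. Seen
  from \<open>H\<close>, the link \<open>P\<close> is up to scale that of the dilated map, and
  \<rho> = exp (- u i) matches its sides with those of \<open>Q\<close>. The conditions on
  \<open>scaled_factor\<close> make every vertex of \<open>Q\<close> farther from its apex, which
  contradicts the equality of the two angle sums.\<close>

lemma no_interior_maximum:
  assumes iF: "i \<in> \<Union> F" and r: "1 < r" and ri: "r * cmod (A.pos i) < 1"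
    and near: "\<And>j. {i, j} \<in> edges F \<Longrightarrow>
        r * cmod (A.pos i - A.pos j) < sin \<epsilon> / 3 * (1 - r\<^sup>2 * (cmod (A.pos i))\<^sup>2)"
    and b1: "1 < scaled_factor r i"
    and bmax: "\<And>j. {i, j} \<in> edges F \<Longrightarrow> r * cmod (A.pos j) < 1 \<Longrightarrow> scaled_factor r j \<le> scaled_factor r i"
  shows False
proof -
  define a where "a = A.pos i"
  define z where "z = A.pos"
  define w where "w = B.pos"
  define s where "s = sin \<epsilon>"
  let ?J = "fst ` link F i"
  define \<zeta> where "\<zeta> = (\<lambda>j. mob_to0 a (z j))"
  define P where "P = (\<lambda>j. inversion (\<zeta> j))"
  define H where "H = ((r\<^sup>2 - 1) / (1 - r\<^sup>2 * (cmod a)\<^sup>2)) *\<^sub>R a"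
  define Q where "Q = (\<lambda>j. inversion (mob_to0 (w i) (w j)))"
  define m where "m = 1 - r\<^sup>2 * (cmod a)\<^sup>2"
  define n where "n = 1 - (cmod a)\<^sup>2"
  have "\<exists>\<sigma>. bij_betw \<sigma> ?J ?J \<and> (\<forall>j\<in>?J. (j, \<sigma> j) \<in> link F i \<and> 0 < cross (\<zeta> j) (\<zeta> (\<sigma> j))) \<and>
      (\<forall>j k. (j, k) \<in> link F i \<longrightarrow> 0 < cross (\<zeta> j) (\<zeta> k) \<longrightarrow> k = \<sigma> j) \<and>
      (\<Sum>j\<in>?J. Arg (\<zeta> (\<sigma> j) / \<zeta> j)) = 2 * pi \<and>
      (\<forall>g :: 'v \<Rightarrow> 'v \<Rightarrow> real. (\<forall>j k. g j k = g k j) \<longrightarrow> (\<Sum>(j, k)\<in>link F i. g j k) = 2 * (\<Sum>j\<in>?J. g j (\<sigma> j)))"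
    unfolding \<zeta>_def a_def z_def by (rule A.star_permutation_sum[OF iF])
  then obtain \<sigma> where bij: "bij_betw \<sigma> ?J ?J"
    and \<sigma>': "\<forall>j\<in>?J. (j, \<sigma> j) \<in> link F i \<and> 0 < cross (\<zeta> j) (\<zeta> (\<sigma> j))"
    and sumA: "(\<Sum>j\<in>?J. Arg (\<zeta> (\<sigma> j) / \<zeta> j)) = 2 * pi"
    and symA: "\<forall>g :: 'v \<Rightarrow> 'v \<Rightarrow> real. (\<forall>j k. g j k = g k j) \<longrightarrow> (\<Sum>(j, k)\<in>link F i. g j k) = 2 * (\<Sum>j\<in>?J. g j (\<sigma> j))"
    by (elim exE conjE)
  note \<sigma> = bspec[OF \<sigma>']
  define \<omega> where "\<omega> = (\<lambda>j. mob_to0 (w i) (w j))"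
  have "\<exists>\<tau>. bij_betw \<tau> ?J ?J \<and> (\<forall>j\<in>?J. (j, \<tau> j) \<in> link F i \<and> 0 < cross (\<omega> j) (\<omega> (\<tau> j))) \<and>
      (\<forall>j k. (j, k) \<in> link F i \<longrightarrow> 0 < cross (\<omega> j) (\<omega> k) \<longrightarrow> k = \<tau> j) \<and>
      (\<Sum>j\<in>?J. Arg (\<omega> (\<tau> j) / \<omega> j)) = 2 * pi \<and>
      (\<forall>g :: 'v \<Rightarrow> 'v \<Rightarrow> real. (\<forall>j k. g j k = g k j) \<longrightarrow> (\<Sum>(j, k)\<in>link F i. g j k) = 2 * (\<Sum>j\<in>?J. g j (\<tau> j)))"
    unfolding \<omega>_def w_def by (rule B.star_permutation_sum[OF iF])
  then obtain \<tau> where bijB: "bij_betw \<tau> ?J ?J"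
    and \<tau>': "\<forall>j\<in>?J. (j, \<tau> j) \<in> link F i \<and> 0 < cross (\<omega> j) (\<omega> (\<tau> j))"
    and uniqB': "\<forall>j k. (j, k) \<in> link F i \<longrightarrow> 0 < cross (\<omega> j) (\<omega> k) \<longrightarrow> k = \<tau> j"
    and sumB: "(\<Sum>j\<in>?J. Arg (\<omega> (\<tau> j) / \<omega> j)) = 2 * pi"
    and symB: "\<forall>g :: 'v \<Rightarrow> 'v \<Rightarrow> real. (\<forall>j k. g j k = g k j) \<longrightarrow> (\<Sum>(j, k)\<in>link F i. g j k) = 2 * (\<Sum>j\<in>?J. g j (\<tau> j))"
    by (elim exE conjE)
  note \<tau> = bspec[OF \<tau>'] and uniqB = uniqB'[rule_format]
  have sJ: "\<sigma> j \<in> ?J" if "j \<in> ?J" for j using bij that by (auto simp: bij_betw_def)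
  have edge: "{i, j} \<in> edges F" if "j \<in> ?J" for j using that A.fst_link[of i] by blast
  have face: "{i, j, \<sigma> j} \<in> F" if "j \<in> ?J" for j using \<sigma>[OF that] by (simp add: link_def)
  have link_sym: "(k, j) \<in> link F i" if "(j, k) \<in> link F i" for j k
    using that by (simp add: link_def insert_commute)
  have finJ: "finite ?J" using A.finite_link by simp
  have neJ: "?J \<noteq> {}"
  proof -
    obtain f where "f \<in> F" "i \<in> f" using iF by blast
    then obtain j k where "{i, j, k} \<in> F" using A.face_through by blast
    then have "(j, k) \<in> link F i" by (simp add: link_def)
    then show ?thesis by blast
  qed
  have ad: "a \<in> hdisk" using A.vertex_hdisk[OF iF] by (simp add: a_def)
  have wd: "w i \<in> hdisk" using B.vertex_hdisk[OF iF] by (simp add: w_def)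
  have verts: "z j \<in> hdisk" "z j \<noteq> a" "w j \<in> hdisk" "w j \<noteq> w i" if j: "j \<in> ?J" for j
  proof -
    have v: "j \<in> \<Union> F" "j \<noteq> i" using A.face_vertices[OF face[OF j]] A.face_distinct[OF face[OF j]] by auto
    then show "z j \<in> hdisk" "w j \<in> hdisk" using A.vertex_hdisk B.vertex_hdisk by (auto simp: z_def w_def)
    show "z j \<noteq> a" "w j \<noteq> w i" using v iF A.pos_eq_iff B.pos_eq_iff by (auto simp: z_def w_def a_def)
  qed
  have z0: "\<zeta> j \<noteq> 0" "\<omega> j \<noteq> 0" if "j \<in> ?J" for j
    using verts[OF that] ad wd by (simp_all add: \<zeta>_def \<omega>_def mob_eq_0_iff)
  obtain j0 where j0: "j0 \<in> ?J" using neJ by blast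
  interpret T0: fat_triangle "A.pos i" "A.pos j0" "A.pos (\<sigma> j0)" \<epsilon> by (rule fatA[OF face[OF j0]])
  have s: "0 < s" "s \<le> 1" using T0.sin_eps_pos by (auto simp: s_def)
  have n: "0 < n" using hdisk_one_minus_pos[OF ad] by (simp add: n_def)
  have ra1: "r * cmod a < 1" using ri by (simp add: a_def)
  have m: "0 < m"
  proof -
    have "(r * cmod a)\<^sup>2 < 1" using ra1 r by (simp add: abs_square_less_1)
    then show ?thesis by (simp add: m_def power_mult_distrib)
  qed
  have mn: "m \<le> n"
  proof -
    have "1 * (cmod a)\<^sup>2 \<le> r\<^sup>2 * (cmod a)\<^sup>2" using r by (intro mult_right_mono) (auto simp: one_le_power)
    then show ?thesis by (simp add: m_def n_def)
  qed
  have rd: "of_real r * a \<in> hdisk" using ra1 r by (simp add: hdisk_iff norm_mult)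
  have near': "r * cmod (a - z j) < s / 3 * m" if "j \<in> ?J" for j
    using near[OF edge[OF that]] by (simp add: a_def z_def s_def m_def)
  \<comment> \<open>Short edges keep all neighbours inside the dilated disk, so the maximality of
    the factor at \<open>i\<close> applies to every one of them.\<close>
  have rz1: "r * cmod (z j) < 1" if j: "j \<in> ?J" for j
  proof -
    have "m = (1 - r * cmod a) * (1 + r * cmod a)" by (simp add: m_def algebra_simps power2_eq_square)
    also have "\<dots> \<le> (1 - r * cmod a) * 2" using ra1 by (intro mult_left_mono) auto
    finally have m2: "m \<le> 2 * (1 - r * cmod a)" by simp
    have "cmod (z j) \<le> cmod a + cmod (a - z j)"
      using norm_triangle_ineq4[of a "a - z j"] by simp
    then have "r * cmod (z j) \<le> r * cmod a + r * cmod (a - z j)"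
      using r by (simp flip: distrib_left)
    moreover have "s / 3 * m \<le> 1 / 3 * m" using s m by (intro mult_right_mono) auto
    then have "s / 3 * m \<le> 1 / 3 * (2 * (1 - r * cmod a))" using m2 by linarith
    with near'[OF j] have "r * cmod (a - z j) < 2 / 3 - 2 / 3 * (r * cmod a)" by (simp add: algebra_simps)
    ultimately show ?thesis using ra1 by simp
  qed
  have rzd: "of_real r * z j \<in> hdisk" if "j \<in> ?J" for j using rz1[OF that] r by (simp add: hdisk_iff norm_mult)
  have bj: "scaled_factor r j \<le> scaled_factor r i" if "j \<in> ?J" for j
    using bmax[OF edge[OF that]] rz1[OF that] by (simp add: z_def)
  \<comment> \<open>The origin of the 1 / 3 in \<open>near\<close>: the Moebius denominator is at
    least (2 / 3) n, so a spoke is at most s / 2 times \<open>m / (r * n)\<close>, and two spokes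
    together are at most s times it, as \<open>Hcross\<close> requires.\<close>
  have zeta_le: "cmod (\<zeta> j) \<le> s / 2 * (m / (r * n))" if j: "j \<in> ?J" for j
  proof -
    have "cmod (1 - cnj a * z j) \<ge> 2 / 3 * n"
    proof -
      have "1 - cnj a * z j = of_real n + cnj a * (a - z j)"
        by (simp only: n_def of_real_diff of_real_1 complex_norm_square) (simp add: algebra_simps)
      then have "cmod (1 - cnj a * z j) \<ge> cmod (of_real n) - cmod (cnj a * (a - z j))"
        using norm_diff_ineq[of "of_real n" "cnj a * (a - z j)"] by simp
      moreover have "cmod (cnj a * (a - z j)) \<le> r * cmod (a - z j)"
        unfolding norm_mult using ad r by (intro mult_right_mono) (auto simp: hdisk_iff)
      moreover have "s / 3 * m \<le> 1 / 3 * n" using s mn m by (intro mult_mono) auto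
      moreover have "cmod (of_real n) = n" using n by simp
      ultimately show ?thesis using near'[OF j] by linarith
    qed
    then have "cmod (z j - a) / cmod (1 - cnj a * z j) \<le> (s / 3 * m / r) / (2 / 3 * n)"
      using near'[OF j] n r s m by (intro frac_le) (auto simp: field_simps norm_minus_commute)
    also have "\<dots> = s / 2 * (m / (r * n))" by simp
    finally show ?thesis by (simp add: \<zeta>_def mob_to0_def norm_divide)
  qed
  \<comment> \<open>After clearing denominators this is (1 - r |a|)(r + |a|) > 0.\<close>
  have Hn: "cmod H * (m / (r * n)) < 1"
  proof -
    have "cmod H = (r\<^sup>2 - 1) / m * cmod a"
      using r m one_le_power[of r 2] by (simp add: H_def m_def[symmetric])
    then have "cmod H * (m / (r * n)) = (r\<^sup>2 - 1) * cmod a / (r * n)" using m by simp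
    moreover have "(r\<^sup>2 - 1) * cmod a < r * n"
    proof -
      have "(r * cmod a) * (r + cmod a) < 1 * (r + cmod a)"
        using ra1 r by (intro mult_strict_right_mono) (auto simp: add_pos_nonneg)
      then show ?thesis by (simp add: n_def algebra_simps power2_eq_square)
    qed
    ultimately show ?thesis using r n by simp
  qed
  have Pcross: "0 < cross (P j) (P (\<sigma> j))" if j: "j \<in> ?J" for j
    using \<sigma>[OF j] z0[OF j] z0[OF sJ[OF j]] by (simp add: P_def cross_inversion)
  \<comment> \<open>The distance from 0 to the line through a side of \<open>P\<close> is
    \<open>cross (P j) (P (\<sigma> j))\<close> over the side length. By fatness it is at least
    \<open>s / cmod (?b - ?c)\<close>, which exceeds \<open>cmod H\<close>; so \<open>H\<close> lies
    on the same side of that line as 0.\<close>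
  have Hcross: "0 < cross (P j - H) (P (\<sigma> j) - H)" if j: "j \<in> ?J" for j
  proof -
    let ?b = "\<zeta> j" and ?c = "\<zeta> (\<sigma> j)"
    interpret T: fat_triangle "A.pos i" "A.pos j" "A.pos (\<sigma> j)" \<epsilon> by (rule fatA[OF face[OF j]])
    have sc: "s * (cmod ?b * cmod ?c) \<le> cross ?b ?c"
      using T.cross_ge \<sigma>[OF j] by (simp add: s_def \<zeta>_def a_def z_def)
    have nz: "?b \<noteq> 0" "?c \<noteq> 0" using z0[OF j] z0[OF sJ[OF j]] by auto
    have "cmod (?b - ?c) \<le> s * (m / (r * n))"
    proof -
      have "cmod (?b - ?c) \<le> s / 2 * (m / (r * n)) + s / 2 * (m / (r * n))"
        by (rule order_trans[OF norm_triangle_ineq4 add_mono[OF zeta_le[OF j] zeta_le[OF sJ[OF j]]]])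
      also have "\<dots> = s * (m / (r * n))" by (simp add: mult.commute)
      finally show ?thesis .
    qed
    then have "cmod H * cmod (?b - ?c) \<le> cmod H * (s * (m / (r * n)))"
      by (intro mult_left_mono) auto
    also have "\<dots> = s * (cmod H * (m / (r * n)))" by simp
    also have "\<dots> < s * 1" using Hn s by (intro mult_strict_left_mono) auto
    finally have "cmod H * cmod (?b - ?c) < s" by simp
    moreover have "\<bar>cross H (P (\<sigma> j) - P j)\<bar> \<le> cmod H * cmod (P (\<sigma> j) - P j)"
    proof -
      have "(cross H (P (\<sigma> j) - P j))\<^sup>2 \<le> (cmod H * cmod (P (\<sigma> j) - P j))\<^sup>2"
        using cross_inner_Pythagoras[of H "P (\<sigma> j) - P j"] zero_le_power2[of "H \<bullet> (P (\<sigma> j) - P j)"] by linarith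
      then show ?thesis
        using abs_le_square_iff[of "cross H (P (\<sigma> j) - P j)" "cmod H * cmod (P (\<sigma> j) - P j)"] by simp
    qed
    moreover have "cmod (P (\<sigma> j) - P j) = cmod (?b - ?c) / (cmod ?b * cmod ?c)"
      unfolding P_def norm_inversion_diff[OF nz(2,1)] by (simp add: norm_minus_commute mult.commute)
    moreover have "s / (cmod ?b * cmod ?c) \<le> cross (P j) (P (\<sigma> j))"
      using sc nz by (simp add: P_def cross_inversion field_simps power2_eq_square)
    ultimately have "\<bar>cross H (P (\<sigma> j) - P j)\<bar> < cross (P j) (P (\<sigma> j))"
      using nz divide_strict_right_mono[of "cmod H * cmod (?b - ?c)" s "cmod ?b * cmod ?c"] by simp
    then show ?thesis using cross_commute[of H "P j"] by (simp add: cross_diff)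
  qed
  have next_ne: "j \<noteq> \<sigma> (\<sigma> j)" if j: "j \<in> ?J" for j
  proof
    assume "j = \<sigma> (\<sigma> j)"
    then have "0 < cross (\<zeta> (\<sigma> j)) (\<zeta> j)" using \<sigma>[OF sJ[OF j]] by simp
    then show False using \<sigma>[OF j] cross_commute[of "\<zeta> j"] by simp
  qed
  have faces2: "{i, \<sigma> j, j} \<in> F" "{i, \<sigma> j, \<sigma> (\<sigma> j)} \<in> F" if j: "j \<in> ?J" for j
    using face[OF j] face[OF sJ[OF j]] by (simp_all add: insert_commute)
  have delP: "0 \<le> cross (P (\<sigma> j) - P j) (P (\<sigma> (\<sigma> j)) - P (\<sigma> j))" if j: "j \<in> ?J" for j
  proof -
    have "0 \<le> cross (P j - P (\<sigma> j)) (P (\<sigma> (\<sigma> j)) - P (\<sigma> j)) * cross (P (\<sigma> j)) (P j)"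
      using A.inner_corner[OF delA faces2[OF j] next_ne[OF j]]
      by (simp add: P_def \<zeta>_def a_def z_def)
    moreover have "cross (P (\<sigma> j)) (P j) < 0" using Pcross[OF j] cross_commute[of "P j"] by simp
    ultimately have "cross (P j - P (\<sigma> j)) (P (\<sigma> (\<sigma> j)) - P (\<sigma> j)) \<le> 0"
      by (simp add: zero_le_mult_iff)
    moreover have "P j - P (\<sigma> j) = - (P (\<sigma> j) - P j)" by simp
    ultimately show ?thesis by (simp only: cross_minus)
  qed
  have Qcross: "cross (Q j) (Q k) \<noteq> 0" if jk: "(j, k) \<in> link F i" for j k
  proof -
    have "j \<in> ?J" "k \<in> ?J" using jk link_sym[OF jk] by force+
    then show ?thesis
      using B.cross_link_nonzero[OF jk] z0 by (simp add: Q_def \<omega>_def w_def cross_inversion)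
  qed
  have sign: "0 < cross (Q j) (Q k) \<longleftrightarrow> 0 < cross (\<omega> j) (\<omega> k)" if "j \<in> ?J" "k \<in> ?J" for j k
  proof -
    have y: "0 < (cmod (\<omega> j))\<^sup>2 * (cmod (\<omega> k))\<^sup>2" using z0[OF that(1)] z0[OF that(2)] by simp
    have "cross (Q j) (Q k) = cross (\<omega> j) (\<omega> k) / ((cmod (\<omega> j))\<^sup>2 * (cmod (\<omega> k))\<^sup>2)"
      unfolding cross_inversion[symmetric] Q_def \<omega>_def ..
    then show ?thesis by (simp only: pos_less_divide_eq[OF y] mult_zero_left)
  qed
  \<comment> \<open>Consecutive sectors of \<psi> have the same orientation along \<sigma>: a change
    would give two vertices the same successor under \<tau>, or one vertex two successors. The two
    cases are the two possible orientations.\<close>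
  have delQ: "0 \<le> (Q (\<sigma> j) \<bullet> (Q (\<sigma> j) - Q j)) / cmod (Q (\<sigma> j) - Q j)
          + (Q (\<sigma> j) \<bullet> (Q (\<sigma> j) - Q (\<sigma> (\<sigma> j)))) / cmod (Q (\<sigma> j) - Q (\<sigma> (\<sigma> j)))" if j: "j \<in> ?J" for j
  proof -
    let ?p = "Q j" and ?q = "Q (\<sigma> j)" and ?t = "Q (\<sigma> (\<sigma> j))"
    note jJ = j sJ[OF j] sJ[OF sJ[OF j]]
    note l1 = conjunct1[OF \<sigma>[OF j]] and l2 = conjunct1[OF \<sigma>[OF sJ[OF j]]]
    have del: "0 \<le> cross (?p - ?q) (?t - ?q) * cross ?q ?p"
      using B.inner_corner[OF delB faces2[OF j] next_ne[OF j]] by (simp add: Q_def w_def)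
    show ?thesis
    proof (cases "0 < cross ?p ?q")
      case True
      have "0 < cross ?q ?t"
      proof (rule ccontr)
        assume "\<not> 0 < cross ?q ?t"
        then have "0 < cross ?t ?q" using Qcross[OF l2] cross_commute[of ?t ?q] by simp
        then have "\<tau> j = \<sigma> j" "\<tau> (\<sigma> (\<sigma> j)) = \<sigma> j"
          using uniqB[OF l1] uniqB[OF link_sym[OF l2]] True sign jJ by auto
        then have "j = \<sigma> (\<sigma> j)"
          by (intro inj_onD[OF bij_betw_imp_inj_on[OF bijB] _ jJ(1,3)]) simp
        then show False using next_ne[OF j] by simp
      qed
      moreover have "cross (?p - ?q) (?t - ?q) \<le> 0"
        using del True cross_commute[of ?p ?q] by (simp add: zero_le_mult_iff)
      then have "0 \<le> cross (?q - ?p) (?t - ?q)"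
        using cross_minus(2)[of "?p - ?q" "?t - ?q"] by simp
      ultimately show ?thesis using convex_corner[OF True] by blast
    next
      case False
      then have c1: "0 < cross ?q ?p" using Qcross[OF l1] cross_commute[of ?p ?q] by simp
      have c2: "0 < cross ?t ?q"
      proof (rule ccontr)
        assume "\<not> 0 < cross ?t ?q"
        then have "0 < cross ?q ?t" using Qcross[OF l2] cross_commute[of ?t ?q] by simp
        then have "\<tau> (\<sigma> j) = j" "\<tau> (\<sigma> j) = \<sigma> (\<sigma> j)"
          using uniqB[OF link_sym[OF l1]] uniqB[OF l2] c1 sign jJ by auto
        then show False using next_ne[OF j] by simp
      qed
      have "0 \<le> cross (?p - ?q) (?t - ?q)" using del c1 by (simp add: zero_le_mult_iff)
      then have "0 \<le> cross (?q - ?t) (?p - ?q)"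
        using cross_minus(2)[of "?t - ?q" "?p - ?q"] cross_commute[of "?t - ?q" "?p - ?q"] by simp
      then show ?thesis using convex_corner[OF c2 c1] by (simp add: add.commute)
    qed
  qed
  have edge2: "{j, \<sigma> j} \<in> edges F" if j: "j \<in> ?J" for j
  proof -
    have "{j, \<sigma> j, i} \<in> F" using face[OF j] by (simp add: insert_commute)
    then show ?thesis by (rule A.face_edge)
  qed
  \<comment> \<open>The factors at \<open>j\<close> and \<open>\<sigma> j\<close> cancel, and the
    translation by \<open>H\<close> does not affect sides.\<close>
  have len: "cmod (Q (\<sigma> j) - Q j) = exp (- u i) * cmod ((P (\<sigma> j) - H) - (P j - H))" if j: "j \<in> ?J" for j
  proof -
    have 1: "(cmod (Q j - Q (\<sigma> j)))\<^sup>2 = chord2 (w j) (w (\<sigma> j)) / (chord2 (w i) (w j) * chord2 (w i) (w (\<sigma> j)))"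
      unfolding Q_def using verts[OF j] verts[OF sJ[OF j]] wd by (intro norm_inversion_diff_chord2) auto
    have 2: "(cmod (P j - P (\<sigma> j)))\<^sup>2 = chord2 (z j) (z (\<sigma> j)) / (chord2 a (z j) * chord2 a (z (\<sigma> j)))"
      unfolding P_def \<zeta>_def using verts[OF j] verts[OF sJ[OF j]] ad by (intro norm_inversion_diff_chord2) auto
    have "(cmod (Q j - Q (\<sigma> j)))\<^sup>2 = (exp (u j + u (\<sigma> j)) / (exp (u i + u j) * exp (u i + u (\<sigma> j)))) * (cmod (P j - P (\<sigma> j)))\<^sup>2"
      unfolding 1 2 w_def z_def a_def conf[OF edge[OF j]] conf[OF edge[OF sJ[OF j]]] conf[OF edge2[OF j]] by simp
    also have "exp (u j + u (\<sigma> j)) / (exp (u i + u j) * exp (u i + u (\<sigma> j))) = (exp (- u i))\<^sup>2"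
      by (simp add: exp_add exp_minus power2_eq_square field_simps)
    finally have "(cmod (Q j - Q (\<sigma> j)))\<^sup>2 = (exp (- u i) * cmod (P j - P (\<sigma> j)))\<^sup>2"
      by (simp add: power_mult_distrib)
    then have "cmod (Q j - Q (\<sigma> j)) = exp (- u i) * cmod (P j - P (\<sigma> j))"
      by (simp add: power2_eq_iff_nonneg)
    then show ?thesis by (simp add: norm_minus_commute)
  qed
  \<comment> \<open>With b and b' the factors at \<open>i\<close> and \<open>j\<close> and c the
    dilated chord, the squared radii are 1 / b^2 + 1 / (b b c) and 1 + 1 / (b b' c). Here b > 1
    gives the strict inequality and maximality b' \<le> b the other one.\<close>
  have expand: "exp (- u i) * cmod (P j - H) < cmod (Q j)" if j: "j \<in> ?J" for j
  proof -
    note v = verts[OF j]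
    define c where "c = chord2 (of_real r * a) (of_real r * z j)"
    have rne: "of_real r * z j \<noteq> of_real r * a" using v r by simp
    have c0: "0 < c" unfolding c_def by (rule chord2_pos[OF rd rzd[OF j] rne[symmetric]])
    define b where "b = scaled_factor r i"
    define b' where "b' = scaled_factor r j"
    have zn: "0 < 1 - (cmod (z j))\<^sup>2" using hdisk_one_minus_pos[OF v(1)] .
    have rzn: "0 < 1 - r\<^sup>2 * (cmod (z j))\<^sup>2"
      using hdisk_one_minus_pos[OF rzd[OF j]] r by (simp add: norm_mult power_mult_distrib)
    have b: "b = exp (u i) * (m / (r * n))" by (simp add: b_def scaled_factor_def m_def n_def a_def)
    have b': "b' = exp (u j) * ((1 - r\<^sup>2 * (cmod (z j))\<^sup>2) / (r * (1 - (cmod (z j))\<^sup>2)))"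
      by (simp add: b'_def scaled_factor_def z_def)
    have b'0: "0 < b'" unfolding b' using zn rzn r by simp
    have bb: "1 < b" "b' \<le> b" using b1 bj[OF j] by (simp_all add: b_def b'_def)
    have "c = r\<^sup>2 * (cmod (a - z j))\<^sup>2 / (m * (1 - r\<^sup>2 * (cmod (z j))\<^sup>2))"
      using r by (simp add: c_def chord2_def m_def norm_mult power_mult_distrib right_diff_distrib[symmetric])
    moreover have "chord2 (A.pos i) (A.pos j) = (cmod (a - z j))\<^sup>2 / (n * (1 - (cmod (z j))\<^sup>2))"
      by (simp add: chord2_def a_def z_def n_def)
    moreover have "eu * ev * (d / (n * y)) = eu * (m / (r * n)) * (ev * (x / (r * y))) * (r\<^sup>2 * d / (m * x))"
      if "0 < x" "0 < y" for eu ev d x y :: real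
      using that r m n by (simp add: power2_eq_square)
    ultimately have cw: "chord2 (w i) (w j) = b * b' * c"
      unfolding w_def conf[OF edge[OF j]] b b' exp_add using zn rzn by simp
    have "cmod (P j - H) = r * n / m * (1 / cmod (mob_to0 (of_real r * a) (of_real r * z j)))"
      unfolding P_def \<zeta>_def H_def m_def n_def using v ad rd rzd[OF j] r
      by (intro norm_inversion_minus_apex) auto
    then have "exp (- u i) * cmod (P j - H) = 1 / b * (1 / cmod (mob_to0 (of_real r * a) (of_real r * z j)))"
      by (simp add: b exp_minus divide_inverse)
    then have "(exp (- u i) * cmod (P j - H))\<^sup>2 = (1 / b)\<^sup>2 * (1 + 1 / c)"
      using inverse_norm_mob[OF rd rzd[OF j] rne] by (simp only: power_mult_distrib c_def)
    also have "\<dots> = 1 / b\<^sup>2 + 1 / (b * b * c)" by (simp add: power2_eq_square distrib_left)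
    also have "\<dots> < 1 + 1 / (b * b' * c)"
    proof -
      have "1 / b\<^sup>2 < 1" using bb by simp
      moreover have "1 / (b * b * c) \<le> 1 / (b * b' * c)"
        using bb b'0 c0 by (intro divide_left_mono mult_right_mono mult_left_mono) auto
      ultimately show ?thesis by linarith
    qed
    also have "\<dots> = (cmod (Q j))\<^sup>2"
      using inverse_norm_mob[OF wd v(3,4)] by (simp add: cw Q_def norm_inversion)
    finally show ?thesis by (rule power_less_imp_less_base) simp
  qed
  have "(\<Sum>j\<in>?J. vangle0 (Q j) (Q (\<sigma> j))) < (\<Sum>j\<in>?J. vangle0 (P j - H) (P (\<sigma> j) - H))"
  proof (rule convex_link_not_expandable[where P = "\<lambda>j. P j - H" and Q = Q and \<rho> = "exp (- u i)", OF finJ neJ bij])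
    show "0 \<le> cross (P (\<sigma> j) - H - (P j - H)) (P (\<sigma> (\<sigma> j)) - H - (P (\<sigma> j) - H))" if "j \<in> ?J" for j
      using delP[OF that] by simp
    show "cross (Q j) (Q (\<sigma> j)) \<noteq> 0" if "j \<in> ?J" for j using Qcross \<sigma>[OF that] by blast
  qed (fact Hcross delQ len expand | simp)+
  also have "\<dots> = (\<Sum>j\<in>?J. Arg ((P (\<sigma> j) - H) / (P j - H)))"
    using Hcross by (intro sum.cong refl) (simp add: Arg_divide_eq_vangle0)
  also have "\<dots> = (\<Sum>j\<in>?J. Arg (P (\<sigma> j) / P j))"
    by (rule angle_sum_move_apex[where p = P, OF finJ bij]) (fact Pcross Hcross)+
  also have "\<dots> = (\<Sum>j\<in>?J. Arg (\<zeta> (\<sigma> j) / \<zeta> j))"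
  proof (intro sum.cong refl)
    fix j assume j: "j \<in> ?J"
    show "Arg (P (\<sigma> j) / P j) = Arg (\<zeta> (\<sigma> j) / \<zeta> j)"
      using Arg_divide_eq_vangle0[OF Pcross[OF j]] Arg_divide_eq_vangle0[OF conjunct2[OF \<sigma>[OF j]]]
        vangle0_inversion z0[OF j] z0[OF sJ[OF j]] by (simp add: P_def)
  qed
  also have "\<dots> = (\<Sum>j\<in>?J. vangle0 (Q j) (Q (\<sigma> j)))"
  proof -
    \<comment> \<open>The order \<sigma> comes from \<phi>, but the angle sum of \<psi> is known
      along \<tau>. Unoriented angles are symmetric, so both sums are half the sum over the
      link.\<close>
    have sym: "vangle0 (\<omega> j) (\<omega> k) = vangle0 (\<omega> k) (\<omega> j)" for j k
      by (simp add: vangle0_def inner_commute mult.commute)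
    have "(\<Sum>j\<in>?J. vangle0 (\<omega> j) (\<omega> (\<sigma> j))) = (\<Sum>j\<in>?J. vangle0 (\<omega> j) (\<omega> (\<tau> j)))"
      using symA[rule_format, of "\<lambda>j k. vangle0 (\<omega> j) (\<omega> k)", OF sym]
        symB[rule_format, of "\<lambda>j k. vangle0 (\<omega> j) (\<omega> k)", OF sym] by simp
    also have "\<dots> = (\<Sum>j\<in>?J. Arg (\<omega> (\<tau> j) / \<omega> j))"
      using \<tau> by (intro sum.cong refl) (simp add: Arg_divide_eq_vangle0)
    finally have "(\<Sum>j\<in>?J. vangle0 (\<omega> j) (\<omega> (\<sigma> j))) = 2 * pi" using sumB by simp
    moreover have "vangle0 (Q j) (Q (\<sigma> j)) = vangle0 (\<omega> j) (\<omega> (\<sigma> j))" if j: "j \<in> ?J" for j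
      using vangle0_inversion z0[OF j] z0[OF sJ[OF j]] by (simp add: Q_def \<omega>_def)
    ultimately show ?thesis using sumA by simp
  qed
  finally show False by simp
qed

end

section \<open>Boundary estimate and rigidity\<close>

text \<open>A Harnack type bound. With \<open>p\<close> and \<open>q\<close> the square roots of the
  two densities, the hypothesis gives \<open>cmod (z - w) \<le> p * q / 2\<close>, hence
  \<open>q\<^sup>2 - p\<^sup>2 \<le> p * q\<close>, which is impossible for
  \<open>q > 2 * p\<close>.\<close>

lemma conformal_density_ratio:
  assumes "z \<in> hdisk" "w \<in> hdisk" "chord2 z w \<le> 1 / 4"
  shows "1 - (cmod w)\<^sup>2 \<le> 4 * (1 - (cmod z)\<^sup>2)"
proof -
  define p q where "p = sqrt (1 - (cmod z)\<^sup>2)" and "q = sqrt (1 - (cmod w)\<^sup>2)"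
  have pq: "0 < p" "0 < q" "p\<^sup>2 = 1 - (cmod z)\<^sup>2" "q\<^sup>2 = 1 - (cmod w)\<^sup>2"
    using hdisk_one_minus_pos[OF assms(1)] hdisk_one_minus_pos[OF assms(2)] by (simp_all add: p_def q_def)
  have "(cmod (z - w))\<^sup>2 = chord2 z w * (p\<^sup>2 * q\<^sup>2)"
    using pq by (simp add: chord2_def flip: pq(3,4))
  also have "\<dots> \<le> 1 / 4 * (p\<^sup>2 * q\<^sup>2)" using assms(3) by (intro mult_right_mono) auto
  also have "\<dots> = (p * q / 2)\<^sup>2" by (simp add: power2_eq_square)
  finally have d: "cmod (z - w) \<le> p * q / 2" by (rule power2_le_imp_le) (use pq in simp)
  have "q\<^sup>2 - p\<^sup>2 = (cmod z - cmod w) * (cmod z + cmod w)"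
    unfolding pq by (simp add: power2_eq_square algebra_simps)
  also have "\<dots> \<le> (p * q / 2) * 2"
  proof (rule order_trans[OF mult_right_mono])
    show "cmod z - cmod w \<le> p * q / 2" using norm_triangle_ineq2[of z w] d by linarith
    show "p * q / 2 * (cmod z + cmod w) \<le> p * q / 2 * 2"
      using assms pq by (intro mult_left_mono) (auto simp: hdisk_iff)
  qed auto
  finally have "q * (q - p) \<le> p * p" by (simp add: power2_eq_square algebra_simps)
  have "q \<le> 2 * p"
  proof (rule ccontr)
    assume "\<not> q \<le> 2 * p"
    then have "p * p < q * (q - p)" using pq by (intro mult_strict_mono) auto
    then show False using \<open>q * (q - p) \<le> p * p\<close> by simp
  qed
  then have "q\<^sup>2 \<le> (2 * p)\<^sup>2" using pq by (intro power_mono) auto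
  then show ?thesis by (simp add: pq power_mult_distrib)
qed

lemma chord2_less:
  assumes "z \<in> hdisk" "w \<in> hdisk" "hdist z w < \<delta>" "\<delta> \<le> 1"
  shows "chord2 z w < \<delta>\<^sup>2"
proof -
  have l: "0 \<le> hdist z w" by (rule hdist_nonneg[OF assms(1,2)])
  have "sqrt (chord2 z w) \<le> hdist z w"
    unfolding sinh_half_hdist[OF assms(1,2), symmetric] using l assms by (intro sinh_half_le) auto
  then have "(sqrt (chord2 z w))\<^sup>2 < \<delta>\<^sup>2"
    using assms chord2_nonneg[OF assms(1,2)] by (intro power_strict_mono) auto
  then show ?thesis using chord2_nonneg[OF assms(1,2)] by simp
qed

context delaunay_conformal_pair
begin

text \<open>On a single triangle conformality determines exp (2 u_i) by the chords in both maps.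
  Fatness bounds it by \<open>c' i j / (s ^ 4 * c i j)\<close>: an edge that is long for \<phi>,
  relative to the distance to the boundary, and short for \<psi> forces a small factor.\<close>

lemma boundary_factor_le:
  assumes f: "{i, j, k} \<in> F" and r: "1 < r" and ri: "r * cmod (A.pos i) < 1"
    and far: "sin \<epsilon> / 3 * (1 - r\<^sup>2 * (cmod (A.pos i))\<^sup>2) \<le> r * cmod (A.pos i - A.pos j)"
  shows "scaled_factor r i \<le> 1"
proof -
  define s where "s = sin \<epsilon>"
  define m where "m = 1 - r\<^sup>2 * (cmod (A.pos i))\<^sup>2"
  define n where "n = 1 - (cmod (A.pos i))\<^sup>2"
  define y where "y = 1 - (cmod (A.pos j))\<^sup>2"
  define E where "E = exp (u i)"
  define c where "c = (\<lambda>i j. chord2 (A.pos i) (A.pos j))"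
  define c' where "c' = (\<lambda>i j. chord2 (B.pos i) (B.pos j))"
  have f': "{j, i, k} \<in> F" "{i, k, j} \<in> F" "{j, k, i} \<in> F" using f by (simp_all add: insert_commute)
  have edges: "{i, j} \<in> edges F" "{i, k} \<in> edges F" "{j, k} \<in> edges F"
    using A.face_edge[OF f] A.face_edge[OF f'(2)] A.face_edge[OF f'(3)] by auto
  interpret TA: fat_triangle "A.pos i" "A.pos j" "A.pos k" \<epsilon> by (rule fatA[OF f])
  interpret TA': fat_triangle "A.pos j" "A.pos i" "A.pos k" \<epsilon> by (rule fatA[OF f'(1)])
  interpret TB: fat_triangle "B.pos i" "B.pos j" "B.pos k" \<epsilon> by (rule fatB[OF f])
  have cpos: "0 < c i j" "0 < c i k" "0 < c j k" "0 < c' i j" "0 < c' i k" "0 < c' j k"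
    unfolding c_def c'_def using TA.d TA.ne TB.d TB.ne by (auto intro!: chord2_pos)
  have s0: "0 < s" using TA.sin_eps_pos by (simp add: s_def)
  have sA: "s\<^sup>2 * c j k \<le> c i k" using TA'.chord2_ge by (simp add: s_def c_def)
  have sB: "s\<^sup>2 * c' i k \<le> c' j k" using TB.chord2_ge by (simp add: s_def c'_def)
  have E0: "0 < E" by (simp add: E_def)
  have n0: "0 < n" using hdisk_one_minus_pos[OF TA.d(1)] by (simp add: n_def)
  have y0: "0 < y" using hdisk_one_minus_pos[OF TA.d(2)] by (simp add: y_def)
  have m0: "0 < m"
  proof -
    have "(r * cmod (A.pos i))\<^sup>2 < 1" using ri r by (simp add: abs_square_less_1)
    then show ?thesis by (simp add: m_def power_mult_distrib)
  qed
  have cc: "c' i j = exp (u i + u j) * c i j" "c' i k = exp (u i + u k) * c i k" "c' j k = exp (u j + u k) * c j k"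
    using conf[OF edges(1)] conf[OF edges(2)] conf[OF edges(3)] by (simp_all add: c_def c'_def)
  \<comment> \<open>The combination \<open>c' i j * c' i k / c' j k\<close> eliminates the conformal
    factors at \<open>j\<close> and \<open>k\<close>.\<close>
  have rel: "E\<^sup>2 * c i j * (c i k * c' j k) = c' i j * (c' i k * c j k)"
    unfolding cc E_def by (simp add: exp_add power2_eq_square)
  have "(E\<^sup>2 * s ^ 4 * c i j) * (c' i k * c j k) = E\<^sup>2 * c i j * ((s\<^sup>2 * c j k) * (s\<^sup>2 * c' i k))"
    by (simp add: power2_eq_square power4_eq_xxxx)
  also have "\<dots> \<le> E\<^sup>2 * c i j * (c i k * c' j k)"
    using sA sB cpos s0 by (intro mult_left_mono mult_mono) auto
  also have "\<dots> = c' i j * (c' i k * c j k)" by (rule rel)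
  finally have key: "E\<^sup>2 * s ^ 4 * c i j \<le> c' i j" using cpos by simp
  have "(s / 3 * m)\<^sup>2 \<le> (r * cmod (A.pos i - A.pos j))\<^sup>2"
    using far s0 m0 by (intro power_mono) (auto simp: s_def m_def)
  also have "\<dots> = r\<^sup>2 * (c i j * (n * y))"
    using n0 y0 by (simp add: c_def chord2_def n_def y_def power_mult_distrib)
  also have "\<dots> \<le> r\<^sup>2 * (c i j * (n * (4 * n)))"
    using conformal_density_ratio[OF TA.d(1,2) smallA[OF edges(1)]] n0 cpos
    by (intro mult_left_mono) (auto simp: n_def y_def)
  \<comment> \<open>36 is 9, from the squared threshold \<open>s / 3\<close>, times 4, from
    \<open>conformal_density_ratio\<close>.\<close>
  finally have sm: "s\<^sup>2 * m\<^sup>2 \<le> 36 * (r\<^sup>2 * c i j * n\<^sup>2)"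
    by (simp add: power_mult_distrib power_divide power2_eq_square mult_ac)
  define b where "b = scaled_factor r i"
  have b: "b = E * (m / (r * n))" by (simp add: b_def scaled_factor_def E_def m_def n_def)
  have "b\<^sup>2 * s ^ 6 = E\<^sup>2 * s ^ 4 * (s\<^sup>2 * m\<^sup>2) / (r\<^sup>2 * n\<^sup>2)"
    unfolding b by (simp add: power_mult_distrib power_divide power2_eq_square eval_nat_numeral mult_ac)
  also have "\<dots> \<le> E\<^sup>2 * s ^ 4 * (36 * (r\<^sup>2 * c i j * n\<^sup>2)) / (r\<^sup>2 * n\<^sup>2)"
    using sm by (intro divide_right_mono mult_left_mono) auto
  also have "\<dots> = 36 * (E\<^sup>2 * s ^ 4 * c i j)" using r n0 by simp
  also have "\<dots> \<le> 36 * c' i j" using key by simp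
  also have "\<dots> \<le> 36 * (\<epsilon> ^ 3 / 8192)\<^sup>2" using smallB[OF edges(1)] by (simp add: c'_def)
  \<comment> \<open>64 is 2^6 and prepares for \<open>\<epsilon> / 2 \<le> sin \<epsilon>\<close>;
    since 36 * 64 is far below 8192^2, the remaining factor is at most 1.\<close>
  also have "\<dots> = (\<epsilon> / 2) ^ 6 * (36 * 64 / 8192\<^sup>2)" by (simp add: power_divide eval_nat_numeral)
  also have "\<dots> \<le> s ^ 6 * (36 * 64 / 8192\<^sup>2)"
    using sin_ge_half[of \<epsilon>] eps TA.eps_less_half_pi
    by (intro mult_right_mono power_mono) (auto simp: s_def)
  also have "\<dots> \<le> s ^ 6 * 1" using s0 by (intro mult_left_mono) auto
  finally have "b\<^sup>2 * s ^ 6 \<le> 1 * s ^ 6" by simp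
  then have "b\<^sup>2 \<le> 1" using s0 by (meson mult_le_cancel_right_pos zero_less_power)
  then have "\<bar>b\<bar> \<le> 1" by (simp add: abs_square_le_1)
  then show ?thesis by (simp add: b_def)
qed

text \<open>\<open>V\<close> is finite since its vertices lie in a closed ball of radius 1 / r. A
  maximal vertex with factor above 1 has no long edge by \<open>boundary_factor_le\<close>, so
  \<open>no_interior_maximum\<close> applies to it.\<close>

lemma scaled_factor_le_one:
  assumes iF: "i \<in> \<Union> F" and r: "1 < r" and ri: "r * cmod (A.pos i) < 1"
  shows "scaled_factor r i \<le> 1"
proof (rule ccontr)
  assume gt: "\<not> scaled_factor r i \<le> 1"
  define V where "V = {i \<in> \<Union> F. r * cmod (A.pos i) < 1}"
  have "V \<subseteq> {i \<in> \<Union> F. cmod (A.pos i) \<le> 1 / r}" using r by (auto simp: V_def field_simps)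
  then have finV: "finite V" using A.finite_vertices_in_cball[of "1 / r"] r by (auto intro: finite_subset)
  have iV: "i \<in> V" using iF ri by (simp add: V_def)
  have "Max (scaled_factor r ` V) \<in> scaled_factor r ` V" using finV iV by (intro Max_in) auto
  then obtain k where k: "k \<in> V" "Max (scaled_factor r ` V) = scaled_factor r k" by (rule imageE)
  have kmax: "scaled_factor r j \<le> scaled_factor r k" if "j \<in> V" for j
    using that finV unfolding k(2)[symmetric] by simp
  have k1: "1 < scaled_factor r k" using kmax[OF iV] gt by simp
  have kF: "k \<in> \<Union> F" and rk: "r * cmod (A.pos k) < 1" using k(1) by (simp_all only: V_def mem_Collect_eq)
  show False
  proof (rule no_interior_maximum[OF kF r rk _ k1])
    fix j assume e: "{k, j} \<in> edges F"
    obtain l where l: "{k, j, l} \<in> F" using A.edge_face[OF e] by blast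
    show "r * cmod (A.pos k - A.pos j) < sin \<epsilon> / 3 * (1 - r\<^sup>2 * (cmod (A.pos k))\<^sup>2)"
    proof (rule ccontr)
      assume "\<not> ?thesis"
      then have "scaled_factor r k \<le> 1" by (intro boundary_factor_le[OF l r rk]) simp
      then show False using k1 by simp
    qed
    assume "r * cmod (A.pos j) < 1"
    then have "j \<in> V" using A.face_vertices[OF l] by (simp add: V_def)
    then show "scaled_factor r j \<le> scaled_factor r k" by (rule kmax)
  qed
qed

lemma conformal_factor_nonpos:
  assumes iF: "i \<in> \<Union> F"
  shows "u i \<le> 0"
proof -
  have i1: "cmod (A.pos i) < 1" using A.vertex_hdisk[OF iF] by (simp add: hdisk_iff)
  have n: "1 - (cmod (A.pos i))\<^sup>2 \<noteq> 0" using hdisk_one_minus_pos[OF A.vertex_hdisk[OF iF]] by simp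
  have "((\<lambda>r. scaled_factor r i) \<longlongrightarrow> exp (u i) * ((1 - 1\<^sup>2 * (cmod (A.pos i))\<^sup>2) / (1 * (1 - (cmod (A.pos i))\<^sup>2)))) (at_right 1)"
    unfolding scaled_factor_def using n by (intro tendsto_intros) auto
  then have lim: "((\<lambda>r. scaled_factor r i) \<longlongrightarrow> exp (u i)) (at_right 1)" using n by simp
  have "((\<lambda>r. r * cmod (A.pos i)) \<longlongrightarrow> 1 * cmod (A.pos i)) (at_right 1)" by (intro tendsto_intros)
  then have "\<forall>\<^sub>F r in at_right 1. r * cmod (A.pos i) < 1" using i1 by (intro order_tendstoD(2)) auto
  moreover have "\<forall>\<^sub>F r in at_right 1. 1 < (r::real)" by (rule eventually_at_right_less)
  ultimately have "\<forall>\<^sub>F r in at_right 1. scaled_factor r i \<le> 1"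
    by eventually_elim (rule scaled_factor_le_one[OF iF])
  then have "exp (u i) \<le> 1" by (rule tendsto_upperbound[OF lim]) simp
  then show ?thesis by simp
qed

end

theorem theorem1p1:
  fixes F :: "'v set set"
    and \<phi> \<psi> :: "('v \<Rightarrow> real) \<Rightarrow> complex"
    and \<epsilon> :: real
  assumes T: "triangulation_H2 F" and inf: "infinite F"
    and eps: "\<epsilon> > 0"
    and geo_phi: "geodesic_mapping F \<phi>" and del_phi: "delaunay F \<phi>"
    and geo_psi: "geodesic_mapping F \<psi>" and del_psi: "delaunay F \<psi>"
    and homeo_phi: "\<exists>g. homeomorphism (polyhedron F) hdisk \<phi> g"
    and homeo_psi: "\<exists>g. homeomorphism (polyhedron F) hdisk \<psi> g"
    and conf: "discretely_conformal F (edge_length \<phi>) (edge_length \<psi>)"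
    and ang_phi: "\<forall>i j k. {i, j, k} \<in> F \<and> card {i, j, k} = 3 \<longrightarrow>
                    hangle (\<phi> (vpt i)) (\<phi> (vpt j)) (\<phi> (vpt k)) \<ge> \<epsilon>"
    and ang_psi: "\<forall>i j k. {i, j, k} \<in> F \<and> card {i, j, k} = 3 \<longrightarrow>
                    hangle (\<psi> (vpt i)) (\<psi> (vpt j)) (\<psi> (vpt k)) \<ge> \<epsilon>"
    and sup_phi: "\<exists>M. M < \<epsilon>^3 / 8192 \<and> (\<forall>i j. {i, j} \<in> edges F \<longrightarrow> edge_length \<phi> i j \<le> M)"
    and sup_psi: "\<exists>M. M < \<epsilon>^3 / 8192 \<and> (\<forall>i j. {i, j} \<in> edges F \<longrightarrow> edge_length \<psi> i j \<le> M)"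
  shows "\<forall>i j. {i, j} \<in> edges F \<longrightarrow> edge_length \<phi> i j = edge_length \<psi> i j"
proof -
  have card3: "card f = 3" if "f \<in> F" for f using T that by (simp add: triangulation_H2_def)
  have fin: "finite {f \<in> F. v \<in> f}" for v using T by (simp add: triangulation_H2_def)
  have angA: "\<epsilon> \<le> hangle (\<phi> (vpt i)) (\<phi> (vpt j)) (\<phi> (vpt k))" if "{i, j, k} \<in> F" for i j k
    using ang_phi card3[OF that] that by blast
  have angB: "\<epsilon> \<le> hangle (\<psi> (vpt i)) (\<psi> (vpt j)) (\<psi> (vpt k))" if "{i, j, k} \<in> F" for i j k
    using ang_psi card3[OF that] that by blast
  interpret A: geodesic_triangulation F \<phi>
    by unfold_locales (use card3 fin geo_phi homeo_phi angA eps in \<open>auto intro: less_le_trans\<close>)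
  interpret B: geodesic_triangulation F \<psi>
    by unfold_locales (use card3 fin geo_psi homeo_psi angB eps in \<open>auto intro: less_le_trans\<close>)
  \<comment> \<open>Any single face bounds \<epsilon>, since a triangle cannot have all its angles
    at least \<pi> / 2. This makes the edge bound at most 1 / 2, from which \<open>quarter\<close>
    follows.\<close>
  obtain f i0 j0 k0 where f: "f \<in> F" "f = {i0, j0, k0}"
  proof -
    obtain f where f: "f \<in> F" using inf by (metis finite.emptyI ex_in_conv)
    then have "f \<noteq> {}" using card3[OF f] by auto
    then obtain i where "i \<in> f" by blast
    then obtain j k where "f = {i, j, k}" using A.face_through[OF f] by blast
    then show thesis by (rule that[OF f])
  qed
  have f0: "{i0, j0, k0} \<in> F" "{j0, i0, k0} \<in> F" "{k0, i0, j0} \<in> F"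
    using f by (simp_all add: insert_commute)
  interpret T: fat_triangle "A.pos i0" "A.pos j0" "A.pos k0" \<epsilon>
    using A.face_vertices[OF f0(1)] A.face_distinct[OF f0(1)] A.vertex_hdisk A.pos_eq_iff eps
      angA[OF f0(1)] angA[OF f0(2)] angA[OF f0(3)]
    by unfold_locales blast+
  have "\<epsilon> < 2" using T.eps_less_half_pi pi_less_4 by simp
  then have "\<epsilon> ^ 3 \<le> 2 ^ 3" using eps by (intro power_mono) auto
  then have \<delta>: "\<epsilon> ^ 3 / 8192 \<le> 1 / 2" by simp
  have ends: "i \<in> \<Union> F" "j \<in> \<Union> F" if "{i, j} \<in> edges F" for i j
    using A.edge_face[OF that] by blast+
  have lenA: "hdist (A.pos i) (A.pos j) < \<epsilon> ^ 3 / 8192" if "{i, j} \<in> edges F" for i j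
    using sup_phi that unfolding edge_length_def by (meson le_less_trans)
  have lenB: "hdist (B.pos i) (B.pos j) < \<epsilon> ^ 3 / 8192" if "{i, j} \<in> edges F" for i j
    using sup_psi that unfolding edge_length_def by (meson le_less_trans)
  have smallA: "chord2 (A.pos i) (A.pos j) < (\<epsilon> ^ 3 / 8192)\<^sup>2" if "{i, j} \<in> edges F" for i j
    using lenA[OF that] \<delta> ends[OF that] A.vertex_hdisk by (intro chord2_less) auto
  have smallB: "chord2 (B.pos i) (B.pos j) < (\<epsilon> ^ 3 / 8192)\<^sup>2" if "{i, j} \<in> edges F" for i j
    using lenB[OF that] \<delta> ends[OF that] B.vertex_hdisk by (intro chord2_less) auto
  have quarter: "(\<epsilon> ^ 3 / 8192)\<^sup>2 \<le> 1 / 4"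
    using power_mono[OF \<delta>, of 2] eps by (simp add: power2_eq_square)
  obtain u where u: "sinh (edge_length \<psi> i j / 2) = exp ((u i + u j) / 2) * sinh (edge_length \<phi> i j / 2)"
    if "{i, j} \<in> edges F" for i j
    using conf unfolding discretely_conformal_def by blast
  have chord: "chord2 (B.pos i) (B.pos j) = exp (u i + u j) * chord2 (A.pos i) (A.pos j)"
    if e: "{i, j} \<in> edges F" for i j
  proof -
    have d: "A.pos i \<in> hdisk" "A.pos j \<in> hdisk" "B.pos i \<in> hdisk" "B.pos j \<in> hdisk"
      using ends[OF e] A.vertex_hdisk B.vertex_hdisk by auto
    have "(sqrt (chord2 (B.pos i) (B.pos j)))\<^sup>2 = (exp ((u i + u j) / 2) * sqrt (chord2 (A.pos i) (A.pos j)))\<^sup>2"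
      using u[OF e] by (simp add: edge_length_def sinh_half_hdist d)
    moreover have "(exp ((u i + u j) / 2))\<^sup>2 = exp (u i + u j)"
      by (simp flip: exp_double)
    ultimately show ?thesis by (simp add: power_mult_distrib chord2_nonneg d)
  qed
  have chord': "chord2 (A.pos i) (A.pos j) = exp (- u i + - u j) * chord2 (B.pos i) (B.pos j)"
    if "{i, j} \<in> edges F" for i j
  proof -
    have "exp (- u i + - u j) * exp (u i + u j) = 1" unfolding exp_add[symmetric] by simp
    then show ?thesis unfolding chord[OF that] mult.assoc[symmetric] by simp
  qed
  have quarterA: "chord2 (A.pos i) (A.pos j) \<le> 1 / 4" if "{i, j} \<in> edges F" for i j
    using smallA[OF that] quarter by linarith
  have quarterB: "chord2 (B.pos i) (B.pos j) \<le> 1 / 4" if "{i, j} \<in> edges F" for i j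
    using smallB[OF that] quarter by linarith
  interpret P: delaunay_conformal_pair F \<phi> \<psi> u \<epsilon>
    by unfold_locales (fact eps del_phi del_psi angA angB chord quarterA smallB)+
  interpret Q: delaunay_conformal_pair F \<psi> \<phi> "\<lambda>i. - u i" \<epsilon>
    by unfold_locales (fact eps del_phi del_psi angA angB chord' quarterB smallA)+
  show ?thesis
  proof (intro allI impI)
    fix i j assume e: "{i, j} \<in> edges F"
    have "u i = 0" "u j = 0"
      using P.conformal_factor_nonpos[OF ends(1)[OF e]] Q.conformal_factor_nonpos[OF ends(1)[OF e]]
        P.conformal_factor_nonpos[OF ends(2)[OF e]] Q.conformal_factor_nonpos[OF ends(2)[OF e]] by auto
    then have "chord2 (B.pos i) (B.pos j) = chord2 (A.pos i) (A.pos j)" using chord[OF e] by simp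
    then show "edge_length \<phi> i j = edge_length \<psi> i j" by (simp add: edge_length_def hdist_chord2)
  qed
qed

end
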